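(* Let $(\mathcal{M},\omega)$ be a symplectic supermanifold, i.e. a finite-dimensional supermanifold $\mathcal{M}$ endowed with a homogeneous (even or odd) closed non-degenerate 2-form $\omega$. Then there exists at least one symplectic connection on $\mathcal{M}$, i.e. a connection $\nabla$ on $\mathcal{M}$ such that for all homogeneous vector fields $X,Y,Z$ on $\mathcal{M}$ $$\nabla_XY-(-1)^{|X||Y|}\nabla_YX=[X,Y]$$ and $$X(\omega(Y,Z))-(-1)^{|X||\omega|}\omega(\nabla_XY,Z)-(-1)^{|X|(|Y|+|\omega|)}\omega(Y,\nabla_XZ)=0.$$
   Context: "Supermanifold" means a finite-dimensional supermanifold in the sense of Berezin and Leites (also called a graded manifold). $\mathcal{X}(\mathcal{M})$ denotes the vector fields on $\mathcal{M}$ (superderivations of the superfunctions), $|\cdot|\in\mathbb{Z}/2$ denotes parity of a homogeneous object, and $[X,Y]=XY-(-1)^{|X||Y|}YX$ is the graded commutator. A connection on $\mathcal{M}$ is a mapping $\nabla:\mathcal{X}(\mathcal{M})\times\mathcal{X}(\mathcal{M})\to\mathcal{X}(\mathcal{M})$, $(X,Y)\mapsto\nabla_XY$, such that: (i) $\nabla$ is additive in both arguments; (ii) $\nabla_{fX}Y=f\nabla_XY$ for every superfunction $f$; (iii) $\nabla_X(fY)=X(f)\,Y+(-1)^{|X||f|}f\nabla_XY$ for homogeneous $X$, $f$, $Y$. The torsion of $\nabla$ is $T(X,Y)=\nabla_XY-(-1)^{|X||Y|}\nabla_YX-[X,Y]$ for homogeneous $X,Y$; $\nabla$ is symmetric if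 $T=0$. For a homogeneous twice covariant tensor field $g$, $$(\nabla_Xg)(Y,Z)=X(g(Y,Z))-(-1)^{|X||g|}g(\nabla_XY,Z)-(-1)^{|X|(|Y|+|g|)}g(Y,\nabla_XZ).$$ A connection on $(\mathcal{M},\omega)$ is symplectic if it is symmetric and $\nabla_X\omega=0$ for all homogeneous $X$. A homogeneous 2-form $\omega$ is a homogeneous twice covariant tensor field with $\omega(Y,Z)=-(-1)^{|Y||Z|}\omega(Z,Y)$, with signs following the sign rule: $\omega(fY,Z)=(-1)^{|f||\omega|}f\,\omega(Y,Z)$ and $\omega(Y,fZ)=(-1)^{|f|(|\omega|+|Y|)}f\,\omega(Y,Z)$, and $|\omega(Y,Z)|=|\omega|+|Y|+|Z|$. It is closed if $d\omega=0$, where $$\begin{aligned}d\omega(X,Y,Z)={}&(-1)^{|\omega||X|}X(\omega(Y,Z))-(-1)^{|Y|(|\omega|+|X|)}Y(\omega(X,Z))\\&+(-1)^{|Z|(|\omega|+|X|+|Y|)}Z(\omega(X,Y))-\omega([X,Y],Z)\\&+(-1)^{|Y||Z|}\omega([X,Z],Y)-(-1)^{|X|(|Y|+|Z|)}\omega([Y,Z],X).\end{aligned}$$ It is non-degenerate in the usual sense: $Y\mapsto\omega(Y,\cdot)$ is an isomorphism from vector fields to 1-forms (parity-preserving or parity-reversing according to $|\omega|$). *)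

theory Defs
  imports
    "HOL-Analysis.Analysis"
    "HOL-Algebra.Module"
    "HOL-Algebra.AbelCoset"
    "HOL-Decision_Procs.Algebra_Aux"
    "HOL-Library.Z2"
begin

section \<open>Real superalgebras\<close>

text \<open>Parities are elements of the two-element field \<^typ>\<open>bit\<close>, so that parities are added
  and multiplied in $\mathbb{Z}/2$.\<close>

abbreviation reals :: "real ring"
  where "reals \<equiv> cring_class_ops"

record 'a salgebra = "(real, 'a) module" +
  grade :: "bit \<Rightarrow> 'a set"

definition signed :: "('a, 'b) ring_scheme \<Rightarrow> bit \<Rightarrow> 'a \<Rightarrow> 'a"
  where "signed A e x = (if e = 0 then x else \<ominus>\<^bsub>A\<^esub> x)"

locale superalgebra = module reals A + ring A for A :: "'a salgebra" (structure) +
  assumes smult_mult_left: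
      "\<lbrakk>x \<in> carrier A; y \<in> carrier A\<rbrakk> \<Longrightarrow> (r \<odot> x) \<otimes> y = r \<odot> (x \<otimes> y)"
    and smult_mult_right:
      "\<lbrakk>x \<in> carrier A; y \<in> carrier A\<rbrakk> \<Longrightarrow> x \<otimes> (r \<odot> y) = r \<odot> (x \<otimes> y)"
    and grade_submodule: "submodule (grade A i) reals A"
    and grade_sum: "carrier A = grade A 0 <+> grade A 1"
    and grade_Int: "grade A 0 \<inter> grade A 1 = {\<zero>}"
    and grade_mult: "\<lbrakk>x \<in> grade A i; y \<in> grade A j\<rbrakk> \<Longrightarrow> x \<otimes> y \<in> grade A (i + j)"
    and supercomm: "\<lbrakk>x \<in> grade A i; y \<in> grade A j\<rbrakk> \<Longrightarrow> x \<otimes> y = signed A (i * j) (y \<otimes> x)"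

definition salgebra_hom :: "'a salgebra \<Rightarrow> 'b salgebra \<Rightarrow> ('a \<Rightarrow> 'b) set"
  where "salgebra_hom A B = {h \<in> ring_hom A B.
    (\<forall>r. \<forall>x\<in>carrier A. h (r \<odot>\<^bsub>A\<^esub> x) = r \<odot>\<^bsub>B\<^esub> h x) \<and>
    (\<forall>i. h ` grade A i \<subseteq> grade B i)}"


section \<open>Sheaves of superalgebras\<close>

text \<open>\<^term>\<open>restr M U V\<close> is the restriction map from sections over \<open>U\<close> to sections over
  \<open>V \<subseteq> U\<close>.\<close>

record ('m, 'a) superspace =
  body :: "'m topology"
  sec :: "'m set \<Rightarrow> 'a salgebra"
  restr :: "'m set \<Rightarrow> 'm set \<Rightarrow> 'a \<Rightarrow> 'a"

locale superspace =
  fixes M :: "('m, 'a) superspace"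
  assumes sec_superalgebra: "openin (body M) U \<Longrightarrow> superalgebra (sec M U)"
    and restr_hom: "\<lbrakk>openin (body M) U; openin (body M) V; V \<subseteq> U\<rbrakk>
      \<Longrightarrow> restr M U V \<in> salgebra_hom (sec M U) (sec M V)"
    and restr_id: "\<lbrakk>openin (body M) U; f \<in> carrier (sec M U)\<rbrakk> \<Longrightarrow> restr M U U f = f"
    and restr_restr: "\<lbrakk>openin (body M) U; openin (body M) V; openin (body M) W; W \<subseteq> V; V \<subseteq> U;
      f \<in> carrier (sec M U)\<rbrakk> \<Longrightarrow> restr M V W (restr M U V f) = restr M U W f"
    and locality: "\<lbrakk>\<And>V. V \<in> \<U> \<Longrightarrow> openin (body M) V;
      f \<in> carrier (sec M (\<Union>\<U>)); g \<in> carrier (sec M (\<Union>\<U>));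
      \<And>V. V \<in> \<U> \<Longrightarrow> restr M (\<Union>\<U>) V f = restr M (\<Union>\<U>) V g\<rbrakk> \<Longrightarrow> f = g"
    and gluing: "\<lbrakk>\<And>V. V \<in> \<U> \<Longrightarrow> openin (body M) V;
      \<And>V. V \<in> \<U> \<Longrightarrow> s V \<in> carrier (sec M V);
      \<And>V W. \<lbrakk>V \<in> \<U>; W \<in> \<U>\<rbrakk> \<Longrightarrow> restr M V (V \<inter> W) (s V) = restr M W (V \<inter> W) (s W)\<rbrakk>
      \<Longrightarrow> \<exists>f\<in>carrier (sec M (\<Union>\<U>)). \<forall>V\<in>\<U>. restr M (\<Union>\<U>) V f = s V"

definition open_subspace :: "('m, 'a) superspace \<Rightarrow> 'm set \<Rightarrow> ('m, 'a) superspace"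
  where "open_subspace M U = M\<lparr>body := subtopology (body M) U\<rparr>"

definition superspace_iso :: "('m, 'a) superspace \<Rightarrow> ('n, 'b) superspace
    \<Rightarrow> ('m \<Rightarrow> 'n) \<Rightarrow> ('m set \<Rightarrow> 'a \<Rightarrow> 'b) \<Rightarrow> bool"
  where "superspace_iso M N \<phi> \<Phi> \<longleftrightarrow>
    homeomorphic_map (body M) (body N) \<phi> \<and>
    (\<forall>U. openin (body M) U \<longrightarrow>
      \<Phi> U \<in> salgebra_hom (sec M U) (sec N (\<phi> ` U)) \<and>
      bij_betw (\<Phi> U) (carrier (sec M U)) (carrier (sec N (\<phi> ` U)))) \<and>
    (\<forall>U V. openin (body M) U \<longrightarrow> openin (body M) V \<longrightarrow> V \<subseteq> U \<longrightarrow>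
      (\<forall>f\<in>carrier (sec M U). \<Phi> V (restr M U V f) = restr N (\<phi> ` U) (\<phi> ` V) (\<Phi> U f)))"


section \<open>The model space and supermanifolds\<close>

definition partial :: "nat \<Rightarrow> ((nat \<Rightarrow> real) \<Rightarrow> real) \<Rightarrow> (nat \<Rightarrow> real) \<Rightarrow> real"
  where "partial i f = (\<lambda>x. deriv (\<lambda>t. f (x(i := t))) (x i))"

primrec C_k_on :: "nat \<Rightarrow> nat \<Rightarrow> (nat \<Rightarrow> real) set \<Rightarrow> ((nat \<Rightarrow> real) \<Rightarrow> real) \<Rightarrow> bool"
  where
    "C_k_on p 0 V f \<longleftrightarrow> continuous_map (subtopology (Euclidean_space p) V) euclideanreal f"
  | "C_k_on p (Suc k) V f \<longleftrightarrow>
      continuous_map (subtopology (Euclidean_space p) V) euclideanreal f \<and>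
      (\<forall>i<p. (\<forall>x\<in>V. (\<lambda>t. f (x(i := t))) field_differentiable at (x i)) \<and>
        C_k_on p k V (partial i f))"

definition smooth_on :: "nat \<Rightarrow> (nat \<Rightarrow> real) set \<Rightarrow> ((nat \<Rightarrow> real) \<Rightarrow> real) \<Rightarrow> bool"
  where "smooth_on p V f \<longleftrightarrow> (\<forall>k. C_k_on p k V f)"

text \<open>With $\theta_I = \theta_{i_1} \cdots \theta_{i_k}$ for $I = \{i_1 < \dots < i_k\}$, one has
  $\theta_I \theta_J = \pm\theta_{I \cup J}$ for disjoint \<open>I\<close>, \<open>J\<close>, with the following sign.\<close>

definition grassmann_sign :: "nat set \<Rightarrow> nat set \<Rightarrow> real"
  where "grassmann_sign I J = (- 1) ^ card {(i, j). i \<in> I \<and> j \<in> J \<and> j < i}"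

text \<open>The model superspace $\mathbb{R}^{p|q}$, with structure sheaf
  $C^\infty \otimes \Lambda(\theta_0, \dots, \theta_{q-1})$. The superfunction
  $\sum_I f_I \theta_I$ over \<open>V\<close> is represented by its coefficient family
  $I \mapsto f_I$; the coefficients vanish by convention for $I \not\subseteq \{0, \dots, q-1\}$
  and at points outside \<open>V\<close>, so that equality of superfunctions is equality of families.\<close>

definition superdomain_sec :: "nat \<Rightarrow> nat \<Rightarrow> (nat \<Rightarrow> real) set
    \<Rightarrow> (nat set \<Rightarrow> (nat \<Rightarrow> real) \<Rightarrow> real) salgebra"
  where "superdomain_sec p q V =
    (let C = {F. (\<forall>I. smooth_on p V (F I)) \<and> (\<forall>I x. \<not> I \<subseteq> {..<q} \<or> x \<notin> V \<longrightarrow> F I x = 0)}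
     in \<lparr>carrier = C,
         monoid.mult = (\<lambda>F G I x. \<Sum>J\<in>Pow I. grassmann_sign J (I - J) * F J x * G (I - J) x),
         one = (\<lambda>I x. if I = {} \<and> x \<in> V then 1 else 0),
         zero = (\<lambda>I x. 0),
         add = (\<lambda>F G I x. F I x + G I x),
         smult = (\<lambda>r F I x. r * F I x),
         grade = (\<lambda>e. {F \<in> C. \<forall>I x. of_nat (card I) \<noteq> e \<longrightarrow> F I x = 0})\<rparr>)"

definition superdomain :: "nat \<Rightarrow> nat
    \<Rightarrow> (nat \<Rightarrow> real, nat set \<Rightarrow> (nat \<Rightarrow> real) \<Rightarrow> real) superspace"
  where "superdomain p q =
    \<lparr>body = Euclidean_space p,
     sec = superdomain_sec p q,
     restr = (\<lambda>U V F I x. if x \<in> V then F I x else 0)\<rparr>"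

text \<open>Supermanifolds of dimension $p|q$ in the sense of Berezin and Leites.\<close>

locale supermanifold = superspace M for p q :: nat and M :: "('m, 'a) superspace" +
  assumes Hausdorff: "Hausdorff_space (body M)"
    and second_countable: "second_countable (body M)"
    and charts: "x \<in> topspace (body M) \<Longrightarrow>
      \<exists>U V \<phi> \<Phi>. openin (body M) U \<and> x \<in> U \<and> openin (Euclidean_space p) V \<and>
        superspace_iso (open_subspace M U) (open_subspace (superdomain p q) V) \<phi> \<Phi>"

definition superfunctions :: "('m, 'a) superspace \<Rightarrow> 'a salgebra"
  where "superfunctions M = sec M (topspace (body M))"


section \<open>Vector fields\<close>

text \<open>The remaining notions only refer to the superalgebra \<open>A\<close> of global superfunctions. Vector
  fields are extensional, so that equality of vector fields is equality of functions.\<close>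

definition hom_vector_fields :: "'a salgebra \<Rightarrow> bit \<Rightarrow> ('a \<Rightarrow> 'a) set"
  where "hom_vector_fields A a = {X \<in> carrier A \<rightarrow>\<^sub>E carrier A.
    (\<forall>f\<in>carrier A. \<forall>g\<in>carrier A. X (f \<oplus>\<^bsub>A\<^esub> g) = X f \<oplus>\<^bsub>A\<^esub> X g) \<and>
    (\<forall>r. \<forall>f\<in>carrier A. X (r \<odot>\<^bsub>A\<^esub> f) = r \<odot>\<^bsub>A\<^esub> X f) \<and>
    (\<forall>e. \<forall>f\<in>grade A e. X f \<in> grade A (a + e)) \<and>
    (\<forall>e. \<forall>f\<in>grade A e. \<forall>g\<in>carrier A.
      X (f \<otimes>\<^bsub>A\<^esub> g) = X f \<otimes>\<^bsub>A\<^esub> g \<oplus>\<^bsub>A\<^esub> signed A (a * e) (f \<otimes>\<^bsub>A\<^esub> X g))}"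

definition vf_add :: "'a salgebra \<Rightarrow> ('a \<Rightarrow> 'a) \<Rightarrow> ('a \<Rightarrow> 'a) \<Rightarrow> 'a \<Rightarrow> 'a"
  where "vf_add A X Y = (\<lambda>f\<in>carrier A. X f \<oplus>\<^bsub>A\<^esub> Y f)"

definition vf_diff :: "'a salgebra \<Rightarrow> ('a \<Rightarrow> 'a) \<Rightarrow> ('a \<Rightarrow> 'a) \<Rightarrow> 'a \<Rightarrow> 'a"
  where "vf_diff A X Y = (\<lambda>f\<in>carrier A. X f \<ominus>\<^bsub>A\<^esub> Y f)"

definition vf_signed :: "'a salgebra \<Rightarrow> bit \<Rightarrow> ('a \<Rightarrow> 'a) \<Rightarrow> 'a \<Rightarrow> 'a"
  where "vf_signed A e X = (\<lambda>f\<in>carrier A. signed A e (X f))"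

definition vf_zero :: "'a salgebra \<Rightarrow> 'a \<Rightarrow> 'a"
  where "vf_zero A = (\<lambda>f\<in>carrier A. \<zero>\<^bsub>A\<^esub>)"

definition vf_scale :: "'a salgebra \<Rightarrow> 'a \<Rightarrow> ('a \<Rightarrow> 'a) \<Rightarrow> 'a \<Rightarrow> 'a"
  where "vf_scale A f X = (\<lambda>g\<in>carrier A. f \<otimes>\<^bsub>A\<^esub> X g)"

definition vector_fields :: "'a salgebra \<Rightarrow> ('a \<Rightarrow> 'a) set"
  where "vector_fields A = {vf_add A X Y |X Y. X \<in> hom_vector_fields A 0 \<and> Y \<in> hom_vector_fields A 1}"

text \<open>The graded commutator of \<open>X\<close>, \<open>Y\<close> homogeneous of parities \<open>a\<close>, \<open>b\<close>.\<close>

definition bracket :: "'a salgebra \<Rightarrow> bit \<Rightarrow> bit \<Rightarrow> ('a \<Rightarrow> 'a) \<Rightarrow> ('a \<Rightarrow> 'a) \<Rightarrow> 'a \<Rightarrow> 'a"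
  where "bracket A a b X Y = (\<lambda>f\<in>carrier A. X (Y f) \<ominus>\<^bsub>A\<^esub> signed A (a * b) (Y (X f)))"


section \<open>Symplectic forms\<close>

text \<open>Below, \<open>w\<close> is the parity of the tensor field, and \<open>a\<close>, \<open>b\<close>, \<open>c\<close> are
  those of \<open>X\<close>, \<open>Y\<close>, \<open>Z\<close>.\<close>

definition covariant_2_tensor ::
    "'a salgebra \<Rightarrow> bit \<Rightarrow> (('a \<Rightarrow> 'a) \<Rightarrow> ('a \<Rightarrow> 'a) \<Rightarrow> 'a) \<Rightarrow> bool"
  where "covariant_2_tensor A w g \<longleftrightarrow>
    (\<forall>Y\<in>vector_fields A. \<forall>Z\<in>vector_fields A. g Y Z \<in> carrier A) \<and>
    (\<forall>b c. \<forall>Y\<in>hom_vector_fields A b. \<forall>Z\<in>hom_vector_fields A c. g Y Z \<in> grade A (w + b + c)) \<and>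
    (\<forall>Y\<in>vector_fields A. \<forall>Y'\<in>vector_fields A. \<forall>Z\<in>vector_fields A.
      g (vf_add A Y Y') Z = g Y Z \<oplus>\<^bsub>A\<^esub> g Y' Z) \<and>
    (\<forall>Y\<in>vector_fields A. \<forall>Z\<in>vector_fields A. \<forall>Z'\<in>vector_fields A.
      g Y (vf_add A Z Z') = g Y Z \<oplus>\<^bsub>A\<^esub> g Y Z') \<and>
    (\<forall>e. \<forall>f\<in>grade A e. \<forall>Y\<in>vector_fields A. \<forall>Z\<in>vector_fields A.
      g (vf_scale A f Y) Z = signed A (e * w) (f \<otimes>\<^bsub>A\<^esub> g Y Z)) \<and>
    (\<forall>e b. \<forall>f\<in>grade A e. \<forall>Y\<in>hom_vector_fields A b. \<forall>Z\<in>vector_fields A.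
      g Y (vf_scale A f Z) = signed A (e * (w + b)) (f \<otimes>\<^bsub>A\<^esub> g Y Z))"

definition two_form ::
    "'a salgebra \<Rightarrow> bit \<Rightarrow> (('a \<Rightarrow> 'a) \<Rightarrow> ('a \<Rightarrow> 'a) \<Rightarrow> 'a) \<Rightarrow> bool"
  where "two_form A w \<omega> \<longleftrightarrow> covariant_2_tensor A w \<omega> \<and>
    (\<forall>b c. \<forall>Y\<in>hom_vector_fields A b. \<forall>Z\<in>hom_vector_fields A c.
      \<omega> Y Z = \<ominus>\<^bsub>A\<^esub> signed A (b * c) (\<omega> Z Y))"

definition ext_deriv :: "'a salgebra \<Rightarrow> bit \<Rightarrow> (('a \<Rightarrow> 'a) \<Rightarrow> ('a \<Rightarrow> 'a) \<Rightarrow> 'a)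
    \<Rightarrow> bit \<Rightarrow> bit \<Rightarrow> bit \<Rightarrow> ('a \<Rightarrow> 'a) \<Rightarrow> ('a \<Rightarrow> 'a) \<Rightarrow> ('a \<Rightarrow> 'a) \<Rightarrow> 'a"
  where "ext_deriv A w \<omega> a b c X Y Z =
    signed A (w * a) (X (\<omega> Y Z))
    \<ominus>\<^bsub>A\<^esub> signed A (b * (w + a)) (Y (\<omega> X Z))
    \<oplus>\<^bsub>A\<^esub> signed A (c * (w + a + b)) (Z (\<omega> X Y))
    \<ominus>\<^bsub>A\<^esub> \<omega> (bracket A a b X Y) Z
    \<oplus>\<^bsub>A\<^esub> signed A (b * c) (\<omega> (bracket A a c X Z) Y)
    \<ominus>\<^bsub>A\<^esub> signed A (a * (b + c)) (\<omega> (bracket A b c Y Z) X)"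

definition closed_two_form ::
    "'a salgebra \<Rightarrow> bit \<Rightarrow> (('a \<Rightarrow> 'a) \<Rightarrow> ('a \<Rightarrow> 'a) \<Rightarrow> 'a) \<Rightarrow> bool"
  where "closed_two_form A w \<omega> \<longleftrightarrow>
    (\<forall>a b c. \<forall>X\<in>hom_vector_fields A a. \<forall>Y\<in>hom_vector_fields A b. \<forall>Z\<in>hom_vector_fields A c.
      ext_deriv A w \<omega> a b c X Y Z = \<zero>\<^bsub>A\<^esub>)"

definition hom_one_forms :: "'a salgebra \<Rightarrow> bit \<Rightarrow> (('a \<Rightarrow> 'a) \<Rightarrow> 'a) set"
  where "hom_one_forms A a = {\<alpha> \<in> vector_fields A \<rightarrow>\<^sub>E carrier A.
    (\<forall>b. \<forall>Y\<in>hom_vector_fields A b. \<alpha> Y \<in> grade A (a + b)) \<and>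
    (\<forall>Y\<in>vector_fields A. \<forall>Z\<in>vector_fields A. \<alpha> (vf_add A Y Z) = \<alpha> Y \<oplus>\<^bsub>A\<^esub> \<alpha> Z) \<and>
    (\<forall>e. \<forall>f\<in>grade A e. \<forall>Y\<in>vector_fields A.
      \<alpha> (vf_scale A f Y) = signed A (e * a) (f \<otimes>\<^bsub>A\<^esub> \<alpha> Y))}"

definition one_forms :: "'a salgebra \<Rightarrow> (('a \<Rightarrow> 'a) \<Rightarrow> 'a) set"
  where "one_forms A = {(\<lambda>Y\<in>vector_fields A. \<alpha> Y \<oplus>\<^bsub>A\<^esub> \<beta> Y) |\<alpha> \<beta>.
    \<alpha> \<in> hom_one_forms A 0 \<and> \<beta> \<in> hom_one_forms A 1}"

text \<open>For a two-form, \<open>Y \<mapsto> \<omega>(Y, \<cdot>)\<close> is additive, linear over the superfunctions up to the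
  sign rule, and of parity \<open>w\<close>; it is therefore an isomorphism as soon as it is bijective.\<close>

definition nondegenerate :: "'a salgebra \<Rightarrow> (('a \<Rightarrow> 'a) \<Rightarrow> ('a \<Rightarrow> 'a) \<Rightarrow> 'a) \<Rightarrow> bool"
  where "nondegenerate A \<omega> \<longleftrightarrow>
    bij_betw (\<lambda>Y. restrict (\<omega> Y) (vector_fields A)) (vector_fields A) (one_forms A)"

definition symplectic_form ::
    "'a salgebra \<Rightarrow> bit \<Rightarrow> (('a \<Rightarrow> 'a) \<Rightarrow> ('a \<Rightarrow> 'a) \<Rightarrow> 'a) \<Rightarrow> bool"
  where "symplectic_form A w \<omega> \<longleftrightarrow> two_form A w \<omega> \<and> closed_two_form A w \<omega> \<and> nondegenerate A \<omega>"


section \<open>Connections\<close>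

definition is_connection ::
    "'a salgebra \<Rightarrow> (('a \<Rightarrow> 'a) \<Rightarrow> ('a \<Rightarrow> 'a) \<Rightarrow> ('a \<Rightarrow> 'a)) \<Rightarrow> bool"
  where "is_connection A D \<longleftrightarrow>
    (\<forall>X\<in>vector_fields A. \<forall>Y\<in>vector_fields A. D X Y \<in> vector_fields A) \<and>
    (\<forall>X\<in>vector_fields A. \<forall>X'\<in>vector_fields A. \<forall>Y\<in>vector_fields A.
      D (vf_add A X X') Y = vf_add A (D X Y) (D X' Y)) \<and>
    (\<forall>X\<in>vector_fields A. \<forall>Y\<in>vector_fields A. \<forall>Y'\<in>vector_fields A.
      D X (vf_add A Y Y') = vf_add A (D X Y) (D X Y')) \<and>
    (\<forall>f\<in>carrier A. \<forall>X\<in>vector_fields A. \<forall>Y\<in>vector_fields A.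
      D (vf_scale A f X) Y = vf_scale A f (D X Y)) \<and>
    (\<forall>a e b. \<forall>X\<in>hom_vector_fields A a. \<forall>f\<in>grade A e. \<forall>Y\<in>hom_vector_fields A b.
      D X (vf_scale A f Y) =
        vf_add A (vf_scale A (X f) Y) (vf_signed A (a * e) (vf_scale A f (D X Y))))"

definition torsion :: "'a salgebra \<Rightarrow> (('a \<Rightarrow> 'a) \<Rightarrow> ('a \<Rightarrow> 'a) \<Rightarrow> ('a \<Rightarrow> 'a))
    \<Rightarrow> bit \<Rightarrow> bit \<Rightarrow> ('a \<Rightarrow> 'a) \<Rightarrow> ('a \<Rightarrow> 'a) \<Rightarrow> 'a \<Rightarrow> 'a"
  where "torsion A D a b X Y =
    vf_diff A (vf_diff A (D X Y) (vf_signed A (a * b) (D Y X))) (bracket A a b X Y)"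

definition symmetric_connection ::
    "'a salgebra \<Rightarrow> (('a \<Rightarrow> 'a) \<Rightarrow> ('a \<Rightarrow> 'a) \<Rightarrow> ('a \<Rightarrow> 'a)) \<Rightarrow> bool"
  where "symmetric_connection A D \<longleftrightarrow>
    (\<forall>a b. \<forall>X\<in>hom_vector_fields A a. \<forall>Y\<in>hom_vector_fields A b. torsion A D a b X Y = vf_zero A)"

definition cov_deriv :: "'a salgebra \<Rightarrow> (('a \<Rightarrow> 'a) \<Rightarrow> ('a \<Rightarrow> 'a) \<Rightarrow> ('a \<Rightarrow> 'a))
    \<Rightarrow> bit \<Rightarrow> (('a \<Rightarrow> 'a) \<Rightarrow> ('a \<Rightarrow> 'a) \<Rightarrow> 'a)
    \<Rightarrow> bit \<Rightarrow> bit \<Rightarrow> ('a \<Rightarrow> 'a) \<Rightarrow> ('a \<Rightarrow> 'a) \<Rightarrow> ('a \<Rightarrow> 'a) \<Rightarrow> 'a"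
  where "cov_deriv A D w g a b X Y Z =
    X (g Y Z) \<ominus>\<^bsub>A\<^esub> signed A (a * w) (g (D X Y) Z) \<ominus>\<^bsub>A\<^esub> signed A (a * (b + w)) (g Y (D X Z))"

definition symplectic_connection :: "'a salgebra \<Rightarrow> bit \<Rightarrow> (('a \<Rightarrow> 'a) \<Rightarrow> ('a \<Rightarrow> 'a) \<Rightarrow> 'a)
    \<Rightarrow> (('a \<Rightarrow> 'a) \<Rightarrow> ('a \<Rightarrow> 'a) \<Rightarrow> ('a \<Rightarrow> 'a)) \<Rightarrow> bool"
  where "symplectic_connection A w \<omega> D \<longleftrightarrow>
    is_connection A D \<and> symmetric_connection A D \<and>
    (\<forall>a b c. \<forall>X\<in>hom_vector_fields A a. \<forall>Y\<in>hom_vector_fields A b. \<forall>Z\<in>hom_vector_fields A c.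
      cov_deriv A D w \<omega> a b X Y Z = \<zero>\<^bsub>A\<^esub>)"

end

theory Submission
  imports Defs "HOL-Computational_Algebra.Polynomial"
begin

text \<open>The proof has an algebraic and a geometric half.

  Algebra: on any superalgebra with a symplectic form, a connection \<open>\<nabla>\<close> can be made symplectic.
  Subtracting half of the torsion makes it symmetric (\<open>symmetrized_symmetric\<close>). For symmetric
  \<open>\<nabla>\<close>, a new connection \<open>D\<close> is defined by
  \[ \omega(D_X Y, Z) = \omega(\nabla_X Y, Z) + \tfrac{1}{3} \bigl((-1)^{|X||\omega|} (\nabla_X\omega)(Y, Z)
    + (-1)^{|X||Y| + |Y||\omega|} (\nabla_Y\omega)(X, Z)\bigr). \]
  The right-hand side is a one-form in \<open>Z\<close>, so non-degeneracy yields the vector field \<open>D\<^sub>X Y\<close>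
  (\<open>sharp_exists\<close>). The correction is graded symmetric in \<open>X\<close> and \<open>Y\<close>, so \<open>D\<close> is still symmetric, and
  \<open>D \<omega>\<close> is one third of the cyclic sum of \<open>\<nabla>\<omega>\<close>. For symmetric \<open>\<nabla>\<close> this cyclic sum is \<open>d \<omega>\<close>
  (\<open>P_cyclic\<close>), which is zero.

  Geometry: a supermanifold has a connection. Near each point there are a bump function \<open>b\<close>, cut-off
  coordinates \<open>x\<^sub>k\<close> and vector fields \<open>d\<^sub>k\<close>, namely the partial derivatives times \<open>b\<close>, all defined globally
  through extension by zero. They satisfy \<open>b Y = (\<Sum>k. Y(x\<^sub>k) d\<^sub>k)\<close> for every vector field \<open>Y\<close>
  (\<open>coordinate_expansion\<close>), because a vector field that annihilates the coordinates is zero; this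
  is Hadamard's lemma for the even variables and an induction on the odd ones. Countably many sets
  \<open>W\<^sub>n\<close> with \<open>b\<^sub>n = 1\<close> on \<open>W\<^sub>n\<close> cover the supermanifold. With \<open>c\<^sub>n = (\<Prod>m<n. 1 - b\<^sub>m)\<close>, the products
  \<open>c\<^sub>n b\<^sub>n\<close> are a partition of unity that is finite on each \<open>W\<^sub>n\<close>, and
  \[ \nabla_X Y = \sum_n c_n \sum_k X(Y(x_{n,k})) \, d_{n,k} \]
  is a connection, whose Leibniz rule comes from \<open>(\<Sum>n. c\<^sub>n b\<^sub>n Y) = Y\<close> (\<open>patched_connection\<close>).

  Calculations in \<open>A\<close> with many signs are done by applying an arbitrary real-linear functional, which
  leaves an identity between real numbers (\<open>functionals_separate\<close>).\<close>

section \<open>Real-linear functionals and signs\<close>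

text \<open>Parities index the grading, so their sums and products have to stay symbolic; the default rules
  turn them into Boolean connectives.\<close>

declare add_bit_eq_xor [simp del] mult_bit_eq_and [simp del]

definition sg :: "bit \<Rightarrow> real" where "sg e = (if e = 0 then 1 else - 1)"

lemma sg_simps [simp]: "sg 0 = 1" "sg 1 = - 1"
  by (simp_all add: sg_def)

lemma sg_add: "sg (a + b) = sg a * sg b"
  by (cases a; cases b; simp)

lemma sg_square [simp]: "sg a * sg a = 1" "sg a * (sg a * r) = r"
  by (cases a; simp)+

lemma bit_add_cancel [simp]: "(a::bit) + (a + b) = b" "(a::bit) + a = 0"
  by (cases a; cases b; simp)+

definition (in superalgebra) functional :: "('a \<Rightarrow> real) \<Rightarrow> bool"
  where "functional l \<longleftrightarrow> (\<forall>x\<in>carrier A. \<forall>y\<in>carrier A. l (x \<oplus> y) = l x + l y) \<and>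
    (\<forall>r. \<forall>x\<in>carrier A. l (r \<odot> x) = r * l x)"

context superalgebra
begin

lemma reals_simps: "x \<in> carrier reals" "(\<oplus>\<^bsub>reals\<^esub>) = (+)" "(\<otimes>\<^bsub>reals\<^esub>) = (*)"
  "\<zero>\<^bsub>reals\<^esub> = 0" "\<one>\<^bsub>reals\<^esub> = 1"
  by (auto simp: fun_eq_iff class_simps)

lemma real_smult_closed [simp, intro]: "x \<in> carrier A \<Longrightarrow> r \<odot> x \<in> carrier A"
  using smult_closed[of r x] by (simp add: reals_simps)

lemma smult_add_left: "x \<in> carrier A \<Longrightarrow> (r + s) \<odot> x = r \<odot> x \<oplus> s \<odot> x"
  using smult_l_distr[of r s x] by (simp add: reals_simps)

lemma smult_add_right: "\<lbrakk>x \<in> carrier A; y \<in> carrier A\<rbrakk> \<Longrightarrow> r \<odot> (x \<oplus> y) = r \<odot> x \<oplus> r \<odot> y"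
  using smult_r_distr[of r x y] by (simp add: reals_simps)

lemma smult_smult: "x \<in> carrier A \<Longrightarrow> r \<odot> (s \<odot> x) = (r * s) \<odot> x"
  using smult_assoc1[of r s x] by (simp add: reals_simps)

lemma smult_1 [simp]: "x \<in> carrier A \<Longrightarrow> 1 \<odot> x = x"
  using smult_one[of x] by (simp add: reals_simps)

lemma smult_0 [simp]: "x \<in> carrier A \<Longrightarrow> 0 \<odot> x = \<zero>"
  using smult_l_null[of x] by (simp add: reals_simps)

lemma smult_zero [simp]: "r \<odot> \<zero> = \<zero>"
  using smult_r_null[of r] by (simp add: reals_simps)

lemma smult_minus_1: "x \<in> carrier A \<Longrightarrow> (- 1) \<odot> x = \<ominus> x"
  using smult_l_minus[of 1 x] by (simp add: reals_simps uminus_class)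

lemma signed_eq_smult: "x \<in> carrier A \<Longrightarrow> signed A e x = sg e \<odot> x"
  by (simp add: signed_def sg_def smult_minus_1)

lemma signed_closed [simp, intro]: "x \<in> carrier A \<Longrightarrow> signed A e x \<in> carrier A"
  by (simp add: signed_def)

lemma minus_eq_smult: "\<lbrakk>x \<in> carrier A; y \<in> carrier A\<rbrakk> \<Longrightarrow> x \<ominus> y = x \<oplus> (- 1) \<odot> y"
  by (simp add: smult_minus_1 a_minus_def)

lemma functional_add: "\<lbrakk>functional l; x \<in> carrier A; y \<in> carrier A\<rbrakk> \<Longrightarrow> l (x \<oplus> y) = l x + l y"
  and functional_smult: "\<lbrakk>functional l; x \<in> carrier A\<rbrakk> \<Longrightarrow> l (r \<odot> x) = r * l x"
  by (auto simp: functional_def)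

lemma functional_neg: "\<lbrakk>functional l; x \<in> carrier A\<rbrakk> \<Longrightarrow> l (\<ominus> x) = - l x"
  using smult_minus_1[of x, symmetric] by (simp add: functional_smult)

lemma functional_diff: "\<lbrakk>functional l; x \<in> carrier A; y \<in> carrier A\<rbrakk> \<Longrightarrow> l (x \<ominus> y) = l x - l y"
  by (simp add: a_minus_def functional_add functional_neg)

lemma functional_signed: "\<lbrakk>functional l; x \<in> carrier A\<rbrakk> \<Longrightarrow> l (signed A e x) = sg e * l x"
  by (simp add: signed_eq_smult functional_smult)

lemma functional_zero: "functional l \<Longrightarrow> l \<zero> = 0"
  using functional_smult[of l \<zero> 0] by simp

lemmas functional_simps = functional_add functional_smult functional_neg functional_diff
  functional_signed functional_zero

definition subspace :: "'a set \<Rightarrow> bool"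
  where "subspace N \<longleftrightarrow> N \<subseteq> carrier A \<and> \<zero> \<in> N \<and> (\<forall>x\<in>N. \<forall>y\<in>N. x \<oplus> y \<in> N) \<and> (\<forall>r. \<forall>x\<in>N. r \<odot> x \<in> N)"

text \<open>By Zorn's lemma there is a maximal subspace that avoids \<open>v\<close>; by maximality, adding any further
  vector to it captures \<open>v\<close>, so it is a hyperplane.\<close>

lemma complement_of_line:
  assumes "v \<in> carrier A" "v \<noteq> \<zero>"
  shows "\<exists>N. subspace N \<and> v \<notin> N \<and> (\<forall>x\<in>carrier A. \<exists>r. x \<ominus> r \<odot> v \<in> N)"
proof -
  define S where "S = {N. subspace N \<and> v \<notin> N}"
  have 0: "{\<zero>} \<in> S" using assms by (simp add: S_def subspace_def)
  have "\<Union>C \<in> S" if C: "C \<noteq> {}" "subset.chain S C" for C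
  proof -
    have sub: "\<And>N. N \<in> C \<Longrightarrow> subspace N \<and> v \<notin> N" and lin: "\<And>M N. M \<in> C \<Longrightarrow> N \<in> C \<Longrightarrow> M \<subseteq> N \<or> N \<subseteq> M"
      using C by (auto simp: subset.chain_def S_def)
    have add: "x \<oplus> y \<in> \<Union>C" if "x \<in> M" "M \<in> C" "y \<in> N" "N \<in> C" for x y M N
      using lin[OF that(2,4)] sub[OF that(2)] sub[OF that(4)] that unfolding subspace_def by blast
    have zero: "\<zero> \<in> \<Union>C"
      using C(1) sub by (auto simp: subspace_def)
    have smult: "r \<odot> x \<in> \<Union>C" if "x \<in> M" "M \<in> C" for x r M
      using sub[OF that(2)] that unfolding subspace_def by blast
    have "\<Union>C \<subseteq> carrier A" using sub unfolding subspace_def by blast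
    have "subspace (\<Union>C)" unfolding subspace_def
    proof (intro conjI ballI allI)
      show "\<Union>C \<subseteq> carrier A" "\<zero> \<in> \<Union>C" by fact+
    next
      fix x y assume "x \<in> \<Union>C" "y \<in> \<Union>C"
      then obtain M N where "x \<in> M" "M \<in> C" "y \<in> N" "N \<in> C" by blast
      then show "x \<oplus> y \<in> \<Union>C" by (rule add)
    next
      fix r x assume "x \<in> \<Union>C"
      then obtain M where "x \<in> M" "M \<in> C" by blast
      then show "r \<odot> x \<in> \<Union>C" by (rule smult)
    qed
    moreover have "v \<notin> \<Union>C" using sub by blast
    ultimately show ?thesis by (simp add: S_def)
  qed
  then obtain N where N: "N \<in> S" "\<And>M. M \<in> S \<Longrightarrow> N \<subseteq> M \<Longrightarrow> M = N"
    using subset_Zorn_nonempty[of S] 0 by blast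
  have subN: "subspace N" "v \<notin> N" using N by (auto simp: S_def)
  note N' = subN(1)[unfolded subspace_def]
  have "\<exists>r. x \<ominus> r \<odot> v \<in> N" if x: "x \<in> carrier A" for x
  proof (cases "x \<in> N")
    case True
    then show ?thesis using x assms by (intro exI[of _ 0]) (simp add: a_minus_def)
  next
    case False
    define M where "M = {n \<oplus> s \<odot> x |n s. n \<in> N}"
    have carN: "n \<in> carrier A" if "n \<in> N" for n using N' that by auto
    have "x \<in> M" unfolding M_def using N' x by (auto intro!: exI[of _ \<zero>] exI[of _ 1])
    moreover have NM: "N \<subseteq> M" unfolding M_def
    proof
      fix n assume "n \<in> N"
      then show "n \<in> {n \<oplus> s \<odot> x |n s. n \<in> N}"
        using x carN[of n] by (intro CollectI exI[of _ n] exI[of _ 0]) simp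
    qed
    ultimately have "M \<notin> S" using N(2) False by blast
    have "subspace M" unfolding subspace_def
    proof (intro conjI ballI allI)
      show "M \<subseteq> carrier A" unfolding M_def using carN x by auto
      show "\<zero> \<in> M" using NM N' by auto
    next
      fix y z assume "y \<in> M" "z \<in> M"
      then obtain n s m t where yz: "y = n \<oplus> s \<odot> x" "z = m \<oplus> t \<odot> x" "n \<in> N" "m \<in> N"
        unfolding M_def by blast
      then have "y \<oplus> z = (n \<oplus> m) \<oplus> (s + t) \<odot> x"
        using carN x by (simp add: smult_add_left a_ac)
      then show "y \<oplus> z \<in> M" unfolding M_def using yz N' by blast
    next
      fix y r assume "y \<in> M"
      then obtain n s where y: "y = n \<oplus> s \<odot> x" "n \<in> N" unfolding M_def by blast
      then have "r \<odot> y = r \<odot> n \<oplus> (r * s) \<odot> x"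
        using carN x by (simp add: smult_add_right smult_smult)
      then show "r \<odot> y \<in> M" unfolding M_def using y N' by blast
    qed
    then have "v \<in> M" using \<open>M \<notin> S\<close> by (auto simp: S_def)
    then obtain n s where v: "v = n \<oplus> s \<odot> x" "n \<in> N" unfolding M_def by blast
    have "s \<noteq> 0"
    proof
      assume "s = 0"
      then have "v = n" using v(1) x carN[OF v(2)] by simp
      then show False using v(2) subN(2) by simp
    qed
    have "x \<ominus> (1/s) \<odot> v = x \<oplus> (- 1/s) \<odot> v"
      using x assms by (simp add: minus_eq_smult smult_smult)
    also have "(- 1/s) \<odot> v = (- 1/s) \<odot> n \<oplus> ((- 1/s) * s) \<odot> x"
      using x carN[OF v(2)] by (simp only: v(1) smult_add_right smult_smult real_smult_closed)
    also have "(- 1/s) * s = - 1" using \<open>s \<noteq> 0\<close> by simp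
    also have "x \<oplus> ((- 1/s) \<odot> n \<oplus> (- 1) \<odot> x) = (- 1/s) \<odot> n"
      using x carN[OF v(2)] by (simp add: smult_minus_1 a_ac r_neg r_neg2)
    finally have "x \<ominus> (1/s) \<odot> v \<in> N" using v(2) N' by simp
    then show ?thesis by blast
  qed
  then show ?thesis using subN by blast
qed

text \<open>Identities in \<open>A\<close> that only involve sums, signs and rational multiples of a few elements
  follow from the corresponding identities between real numbers, since the functionals separate
  the elements of \<open>A\<close>.\<close>

lemma functionals_separate:
  assumes x: "x \<in> carrier A" and y: "y \<in> carrier A"
    and eq: "\<And>l. functional l \<Longrightarrow> l x = l y"
  shows "x = y"
proof (rule ccontr)
  assume "x \<noteq> y"
  define v where "v = x \<ominus> y"
  have v: "v \<in> carrier A" "v \<noteq> \<zero>"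
    using x y \<open>x \<noteq> y\<close> by (auto simp: v_def a_minus_def dest: minus_equality)
  obtain N where N: "subspace N" "v \<notin> N" "\<And>x. x \<in> carrier A \<Longrightarrow> \<exists>r. x \<ominus> r \<odot> v \<in> N"
    using complement_of_line[OF v] by blast
  note N' = N(1)[unfolded subspace_def]
  define l where "l z = (THE r. z \<ominus> r \<odot> v \<in> N)" for z
  have uniq: "r = s" if "z \<in> carrier A" "z \<ominus> r \<odot> v \<in> N" "z \<ominus> s \<odot> v \<in> N" for z r s
  proof (rule ccontr)
    assume "r \<noteq> s"
    have "(z \<ominus> s \<odot> v) \<oplus> (- 1) \<odot> (z \<ominus> r \<odot> v) \<in> N" using that N' by blast
    also have "(z \<ominus> s \<odot> v) \<oplus> (- 1) \<odot> (z \<ominus> r \<odot> v)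
        = (z \<oplus> (- 1) \<odot> z) \<oplus> ((- s) \<odot> v \<oplus> r \<odot> v)"
      using that(1) v by (simp add: minus_eq_smult smult_add_right smult_smult a_ac)
    also have "\<dots> = (r - s) \<odot> v"
      using that(1) v by (simp add: smult_minus_1 r_neg flip: smult_add_left)
    finally have "(1 / (r - s)) \<odot> ((r - s) \<odot> v) \<in> N" using N' by blast
    then show False using N(2) v \<open>r \<noteq> s\<close> by (simp add: smult_smult)
  qed
  have l_eq: "l z = r" if "z \<in> carrier A" "z \<ominus> r \<odot> v \<in> N" for z r
    unfolding l_def using uniq[OF that(1)] that by (intro the_equality) auto
  have l_mem: "z \<ominus> l z \<odot> v \<in> N" if "z \<in> carrier A" for z
    using N(3)[OF that] l_eq[OF that] by auto
  have "functional l" unfolding functional_def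
  proof (intro conjI ballI allI)
    fix a b assume ab: "a \<in> carrier A" "b \<in> carrier A"
    have "(a \<ominus> l a \<odot> v) \<oplus> (b \<ominus> l b \<odot> v) \<in> N" using l_mem ab N' by blast
    also have "(a \<ominus> l a \<odot> v) \<oplus> (b \<ominus> l b \<odot> v) = (a \<oplus> b) \<ominus> (l a + l b) \<odot> v"
      using ab v by (simp add: a_minus_def smult_add_left minus_add a_ac)
    finally show "l (a \<oplus> b) = l a + l b" using ab by (intro l_eq) auto
  next
    fix r a assume a: "a \<in> carrier A"
    have "r \<odot> (a \<ominus> l a \<odot> v) \<in> N" using l_mem a N' by blast
    also have "r \<odot> (a \<ominus> l a \<odot> v) = r \<odot> a \<ominus> (r * l a) \<odot> v"
      using a v by (simp add: minus_eq_smult smult_add_right smult_smult)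
    finally show "l (r \<odot> a) = r * l a" using a by (intro l_eq) auto
  qed
  then have "l v = 0"
    using eq functional_diff[of l x y] x y by (simp add: v_def)
  moreover have "l v = 1"
    using v N' by (intro l_eq) (auto simp: a_minus_def r_neg)
  ultimately show False by simp
qed

end

section \<open>Homogeneous components and vector fields\<close>

context superalgebra
begin

lemma grade_closed [simp]: "x \<in> grade A i \<Longrightarrow> x \<in> carrier A"
  and grade_add: "\<lbrakk>x \<in> grade A i; y \<in> grade A i\<rbrakk> \<Longrightarrow> x \<oplus> y \<in> grade A i"
  and grade_smult: "x \<in> grade A i \<Longrightarrow> r \<odot> x \<in> grade A i"
  and grade_zero [simp]: "\<zero> \<in> grade A i"
  using submodule.axioms[OF grade_submodule[of i]]
  by (auto simp: submodule_axioms_def reals_simps dest: subgroup.mem_carrier subgroup.m_closed subgroup.one_closed)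

lemma grade_signed: "x \<in> grade A i \<Longrightarrow> signed A e x \<in> grade A i"
  using grade_smult[of x i "sg e"] by (simp add: signed_eq_smult)

lemma grade_minus: "x \<in> grade A i \<Longrightarrow> \<ominus> x \<in> grade A i"
  using grade_smult[of x i "- 1"] by (simp add: smult_minus_1)

lemma grade_diff: "\<lbrakk>x \<in> grade A i; y \<in> grade A i\<rbrakk> \<Longrightarrow> x \<ominus> y \<in> grade A i"
  by (simp add: a_minus_def grade_add grade_minus)

lemma grade_disjoint: "\<lbrakk>x \<in> grade A i; x \<in> grade A j; i \<noteq> j\<rbrakk> \<Longrightarrow> x = \<zero>"
  using grade_Int by (cases i; cases j) auto

lemma grade_decompose:
  assumes "x \<in> carrier A"
  obtains x0 x1 where "x0 \<in> grade A 0" "x1 \<in> grade A 1" "x = x0 \<oplus> x1"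
proof -
  have "x \<in> grade A 0 <+> grade A 1" using assms by (simp only: grade_sum)
  then show ?thesis using that by (auto simp: set_add_def')
qed

text \<open>Let \<open>1 = u + v\<close> with \<open>u\<close> even and \<open>v\<close> odd. Multiplication by \<open>v\<close> shows that the even element
  \<open>v v\<close> is odd, hence zero, and \<open>v = u v\<close>; then multiplication by \<open>u\<close> shows that \<open>v = u - u u\<close> is even.\<close>

lemma one_grade: "\<one> \<in> grade A 0"
proof -
  obtain u v where uv: "u \<in> grade A 0" "v \<in> grade A 1" "\<one> = u \<oplus> v"
    using grade_decompose[OF one_closed] .
  have "v = u \<otimes> v \<oplus> v \<otimes> v"
    using l_one[of v] uv by (simp add: l_distr)
  then have 1: "u \<otimes> v \<oplus> v \<otimes> v = v" ..
  have "v \<otimes> v = v \<ominus> u \<otimes> v"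
  proof (rule functionals_separate)
    fix l assume l: "functional l"
    show "l (v \<otimes> v) = l (v \<ominus> u \<otimes> v)"
      using functional_add[OF l, of "u \<otimes> v" "v \<otimes> v"] uv by (simp add: 1 functional_simps l)
  qed (use uv in auto)
  moreover have "v \<otimes> v \<in> grade A 0" "u \<otimes> v \<in> grade A 1"
    using grade_mult[of v 1 v 1] grade_mult[of u 0 v 1] uv by auto
  ultimately have "v \<otimes> v = \<zero>"
    using grade_disjoint[of "v \<otimes> v" 0 1] grade_diff[of v 1 "u \<otimes> v"] uv by auto
  then have "v = u \<otimes> v"
    using 1 uv by simp
  have "u = u \<otimes> u \<oplus> u \<otimes> v"
    using r_one[of u] uv by (simp add: r_distr)
  then have 2: "u \<otimes> u \<oplus> v = u" using \<open>v = u \<otimes> v\<close> by simp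
  have "v = u \<ominus> u \<otimes> u"
  proof (rule functionals_separate)
    fix l assume l: "functional l"
    show "l v = l (u \<ominus> u \<otimes> u)"
      using functional_add[OF l, of "u \<otimes> u" v] uv by (simp add: 2 functional_simps l)
  qed (use uv in auto)
  then have "v \<in> grade A 0"
    using grade_diff[of u 0 "u \<otimes> u"] grade_mult[of u 0 u 0] uv by auto
  then have "v = \<zero>" using grade_disjoint[of v 0 1] uv(2) by simp
  then have "\<one> = u" using uv(3) r_zero[OF grade_closed[OF uv(1)]] by metis
  then show ?thesis using uv(1) by metis
qed

abbreviation HV :: "bit \<Rightarrow> ('a \<Rightarrow> 'a) set" where "HV \<equiv> hom_vector_fields A"
abbreviation VF :: "('a \<Rightarrow> 'a) set" where "VF \<equiv> vector_fields A"

lemma hvf_closed [simp]: "\<lbrakk>X \<in> HV a; f \<in> carrier A\<rbrakk> \<Longrightarrow> X f \<in> carrier A"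
  unfolding hom_vector_fields_def by blast

lemma hvf_extensional: "X \<in> HV a \<Longrightarrow> X \<in> extensional (carrier A)"
  unfolding hom_vector_fields_def PiE_def by blast

lemma hvf_add [simp]: "\<lbrakk>X \<in> HV a; f \<in> carrier A; g \<in> carrier A\<rbrakk> \<Longrightarrow> X (f \<oplus> g) = X f \<oplus> X g"
  unfolding hom_vector_fields_def by blast

lemma hvf_smult [simp]: "\<lbrakk>X \<in> HV a; f \<in> carrier A\<rbrakk> \<Longrightarrow> X (r \<odot> f) = r \<odot> X f"
  unfolding hom_vector_fields_def by blast

lemma hvf_minus [simp]: "\<lbrakk>X \<in> HV a; f \<in> carrier A\<rbrakk> \<Longrightarrow> X (\<ominus> f) = \<ominus> X f"
  using hvf_smult[of X a f "- 1"] by (simp add: smult_minus_1)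

lemma hvf_diff [simp]: "\<lbrakk>X \<in> HV a; f \<in> carrier A; g \<in> carrier A\<rbrakk> \<Longrightarrow> X (f \<ominus> g) = X f \<ominus> X g"
  by (simp add: a_minus_def)

lemma hvf_signed [simp]: "\<lbrakk>X \<in> HV a; f \<in> carrier A\<rbrakk> \<Longrightarrow> X (signed A e f) = signed A e (X f)"
  by (simp add: signed_eq_smult)

lemma hvf_zero [simp]: "X \<in> HV a \<Longrightarrow> X \<zero> = \<zero>"
  using hvf_smult[of X a \<zero> 0] by simp

lemma hvf_grade: "\<lbrakk>X \<in> HV a; f \<in> grade A e\<rbrakk> \<Longrightarrow> X f \<in> grade A (a + e)"
  unfolding hom_vector_fields_def by blast

lemma hvf_mult: "\<lbrakk>X \<in> HV a; f \<in> grade A e; g \<in> carrier A\<rbrakk> \<Longrightarrow>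
    X (f \<otimes> g) = X f \<otimes> g \<oplus> signed A (a * e) (f \<otimes> X g)"
  unfolding hom_vector_fields_def by blast

lemma hvfI:
  assumes "X \<in> extensional (carrier A)" "\<And>f. f \<in> carrier A \<Longrightarrow> X f \<in> carrier A"
    "\<And>f g. \<lbrakk>f \<in> carrier A; g \<in> carrier A\<rbrakk> \<Longrightarrow> X (f \<oplus> g) = X f \<oplus> X g"
    "\<And>r f. f \<in> carrier A \<Longrightarrow> X (r \<odot> f) = r \<odot> X f"
    "\<And>e f. f \<in> grade A e \<Longrightarrow> X f \<in> grade A (a + e)"
    "\<And>e f g. \<lbrakk>f \<in> grade A e; g \<in> carrier A\<rbrakk> \<Longrightarrow>
      X (f \<otimes> g) = X f \<otimes> g \<oplus> signed A (a * e) (f \<otimes> X g)"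
  shows "X \<in> HV a"
  unfolding hom_vector_fields_def PiE_def by (intro CollectI conjI allI ballI IntI Pi_I assms)

lemma extensional_eqI:
  "\<lbrakk>X \<in> extensional (carrier A); Y \<in> extensional (carrier A); \<And>f. f \<in> carrier A \<Longrightarrow> X f = Y f\<rbrakk> \<Longrightarrow> X = Y"
  by (rule extensionalityI)

lemma vf_op_extensional [simp]:
  "vf_add A X Y \<in> extensional (carrier A)" "vf_diff A X Y \<in> extensional (carrier A)"
  "vf_signed A e X \<in> extensional (carrier A)" "vf_zero A \<in> extensional (carrier A)"
  "vf_scale A f X \<in> extensional (carrier A)" "bracket A a b X Y \<in> extensional (carrier A)"
  by (auto simp: vf_add_def vf_diff_def vf_signed_def vf_zero_def vf_scale_def bracket_def)

lemma vf_op_apply [simp]: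
  assumes "f \<in> carrier A"
  shows "vf_add A X Y f = X f \<oplus> Y f" "vf_diff A X Y f = X f \<ominus> Y f"
    "vf_signed A e X f = signed A e (X f)" "vf_zero A f = \<zero>"
    "vf_scale A g X f = g \<otimes> X f" "bracket A a b X Y f = X (Y f) \<ominus> signed A (a * b) (Y (X f))"
  using assms by (auto simp: vf_add_def vf_diff_def vf_signed_def vf_zero_def vf_scale_def bracket_def)

lemma mult_signed_right: "\<lbrakk>f \<in> carrier A; g \<in> carrier A\<rbrakk> \<Longrightarrow> f \<otimes> signed A e g = signed A e (f \<otimes> g)"
  and mult_signed_left: "\<lbrakk>f \<in> carrier A; g \<in> carrier A\<rbrakk> \<Longrightarrow> signed A e f \<otimes> g = signed A e (f \<otimes> g)"
  by (simp_all add: signed_eq_smult smult_mult_left smult_mult_right)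

lemma mult_minus_right: "\<lbrakk>f \<in> carrier A; g \<in> carrier A; h \<in> carrier A\<rbrakk> \<Longrightarrow> f \<otimes> (g \<ominus> h) = f \<otimes> g \<ominus> f \<otimes> h"
  and mult_minus_left: "\<lbrakk>f \<in> carrier A; g \<in> carrier A; h \<in> carrier A\<rbrakk> \<Longrightarrow> (g \<ominus> h) \<otimes> f = g \<otimes> f \<ominus> h \<otimes> f"
  by (simp_all add: minus_eq_smult l_distr r_distr smult_mult_left smult_mult_right)

lemmas distribs = l_distr r_distr mult_minus_right mult_minus_left mult_signed_right
  mult_signed_left smult_mult_left smult_mult_right

lemma vf_zero_hvf [simp]: "vf_zero A \<in> HV a"
  by (rule hvfI) (simp_all add: signed_def)

lemma vf_add_hvf:
  assumes "X \<in> HV a" "Y \<in> HV a" shows "vf_add A X Y \<in> HV a"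
proof (rule hvfI)
  fix e f g assume "f \<in> grade A e" "g \<in> carrier A"
  then show "vf_add A X Y (f \<otimes> g) = vf_add A X Y f \<otimes> g \<oplus> signed A (a * e) (f \<otimes> vf_add A X Y g)"
    using assms by (intro functionals_separate)
      (simp_all add: hvf_mult[of _ a f e] functional_simps distribs algebra_simps)
qed (use assms in \<open>simp_all add: hvf_grade grade_add smult_add_right a_ac\<close>)

lemma vf_scale_hvf:
  assumes "f \<in> grade A e" "X \<in> HV a" shows "vf_scale A f X \<in> HV (e + a)"
proof (rule hvfI)
  fix c g h assume g: "g \<in> grade A c" and h: "h \<in> carrier A"
  have "f \<otimes> (g \<otimes> X h) = signed A (e * c) (g \<otimes> (f \<otimes> X h))"
    using supercomm[OF assms(1) g] assms g h by (simp add: m_assoc[symmetric] mult_signed_left)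
  then show "vf_scale A f X (g \<otimes> h)
      = vf_scale A f X g \<otimes> h \<oplus> signed A ((e + a) * c) (g \<otimes> vf_scale A f X h)"
    using assms g h
    by (intro functionals_separate)
      (simp_all add: hvf_mult[of _ a g c] functional_simps distribs m_assoc sg_add algebra_simps)
qed (use assms in \<open>simp_all add: distribs add.assoc grade_mult hvf_grade\<close>)

lemma vf_signed_hvf: "X \<in> HV a \<Longrightarrow> vf_signed A e X \<in> HV a"
proof -
  assume X: "X \<in> HV a"
  have "vf_signed A e X = vf_scale A (sg e \<odot> \<one>) X"
    using X by (intro extensional_eqI) (simp_all add: smult_mult_left signed_eq_smult hvf_extensional)
  then show ?thesis using vf_scale_hvf[OF grade_smult[OF one_grade] X] by simp
qed

lemma vf_diff_eq: "\<lbrakk>X \<in> HV a; Y \<in> HV b\<rbrakk> \<Longrightarrow> vf_diff A X Y = vf_add A X (vf_signed A 1 Y)"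
  by (intro extensional_eqI) (simp_all add: signed_def a_minus_def)

lemma vf_diff_hvf: "\<lbrakk>X \<in> HV a; Y \<in> HV a\<rbrakk> \<Longrightarrow> vf_diff A X Y \<in> HV a"
  by (simp add: vf_diff_eq vf_add_hvf vf_signed_hvf)

lemma bracket_hvf:
  assumes X: "X \<in> HV a" and Y: "Y \<in> HV b" shows "bracket A a b X Y \<in> HV (a + b)"
proof (rule hvfI)
  fix c f g assume f: "f \<in> grade A c" and g: "g \<in> carrier A"
  note fX = hvf_grade[OF X f] and fY = hvf_grade[OF Y f]
  show "bracket A a b X Y (f \<otimes> g) =
      bracket A a b X Y f \<otimes> g \<oplus> signed A ((a + b) * c) (f \<otimes> bracket A a b X Y g)"
    using X Y f g fX fY
    by (intro functionals_separate; cases a; cases b; cases c)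
      (simp_all add: hvf_mult[OF X f] hvf_mult[OF Y f] hvf_mult[OF X fY] hvf_mult[OF Y fX]
        functional_simps distribs)
next
  fix e f assume f: "f \<in> grade A e"
  have "X (Y f) \<in> grade A (a + (b + e))" "Y (X f) \<in> grade A (b + (a + e))"
    using X Y f by (simp_all add: hvf_grade)
  moreover have "a + (b + e) = a + b + e" "b + (a + e) = a + b + e"
    by (auto simp: algebra_simps)
  ultimately show "bracket A a b X Y f \<in> grade A (a + b + e)"
    using f X Y by (simp add: grade_diff grade_signed)
next
  fix f g assume "f \<in> carrier A" "g \<in> carrier A"
  then show "bracket A a b X Y (f \<oplus> g) = bracket A a b X Y f \<oplus> bracket A a b X Y g"
    using assms by (intro functionals_separate) (simp_all add: functional_simps algebra_simps)
next
  fix r f assume "f \<in> carrier A"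
  then show "bracket A a b X Y (r \<odot> f) = r \<odot> bracket A a b X Y f"
    using assms by (intro functionals_separate) (simp_all add: functional_simps algebra_simps)
qed (use assms in simp_all)

end

context superalgebra
begin

lemma vf_add_commute: "\<lbrakk>X \<in> HV a; Y \<in> HV b\<rbrakk> \<Longrightarrow> vf_add A X Y = vf_add A Y X"
  by (intro extensional_eqI) (simp_all add: a_comm)

lemma vf_add_zero [simp]: "X \<in> HV a \<Longrightarrow> vf_add A X (vf_zero A) = X"
  "X \<in> HV a \<Longrightarrow> vf_add A (vf_zero A) X = X"
  by (intro extensional_eqI; simp add: hvf_extensional)+

lemma vf_idempotent:
  assumes "X \<in> HV a" "vf_add A X X = X" shows "X = vf_zero A"
proof (intro extensional_eqI)
  fix f assume f: "f \<in> carrier A"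
  then have "X f \<oplus> X f = X f" using fun_cong[OF assms(2), of f] by simp
  then show "X f = vf_zero A f" using f assms(1) by simp
qed (use assms in \<open>simp_all add: hvf_extensional\<close>)

lemma vf_decompose:
  assumes "X \<in> VF"
  obtains X0 X1 where "X0 \<in> HV 0" "X1 \<in> HV 1" "X = vf_add A X0 X1"
  using assms unfolding vector_fields_def by blast

lemma vf_addI: "\<lbrakk>X \<in> HV a; Y \<in> HV (a + 1)\<rbrakk> \<Longrightarrow> vf_add A X Y \<in> VF"
proof (cases a)
  assume XY: "X \<in> HV a" "Y \<in> HV (a + 1)"
  show "a = 0 \<Longrightarrow> ?thesis" using XY unfolding vector_fields_def by auto
  assume "a = 1"
  then have "vf_add A Y X \<in> VF" using XY unfolding vector_fields_def by auto
  then show ?thesis using vf_add_commute[OF XY] by simp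
qed

lemma hvf_vf [simp]: "X \<in> HV a \<Longrightarrow> X \<in> VF"
  using vf_addI[of X a "vf_zero A"] by simp

lemma vf_closed [simp]: "\<lbrakk>X \<in> VF; f \<in> carrier A\<rbrakk> \<Longrightarrow> X f \<in> carrier A"
  by (erule vf_decompose) simp

lemma vf_extensional: "X \<in> VF \<Longrightarrow> X \<in> extensional (carrier A)"
  by (erule vf_decompose) simp

lemma hvf_agree:
  assumes X: "X \<in> HV a" and Y: "Y \<in> HV b" and eq: "\<And>e f. f \<in> grade A e \<Longrightarrow> X f = Y f"
  shows "X = Y"
proof (intro extensional_eqI)
  fix f assume "f \<in> carrier A"
  then obtain f0 f1 where "f0 \<in> grade A 0" "f1 \<in> grade A 1" "f = f0 \<oplus> f1" by (rule grade_decompose)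
  then show "X f = Y f" using X Y eq[of f0 0] eq[of f1 1] by simp
qed (use X Y in \<open>simp_all add: hvf_extensional\<close>)

text \<open>On homogeneous functions the two sides of \<open>Y - Y' = Z' - Z\<close> have different parities.\<close>

lemma vf_decompose_unique:
  assumes Y: "Y \<in> HV a" "Y' \<in> HV a" and Z: "Z \<in> HV (a + 1)" "Z' \<in> HV (a + 1)"
    and eq: "vf_add A Y Z = vf_add A Y' Z'"
  shows "Y = Y'"
proof (rule hvf_agree[OF Y])
  fix e f assume f: "f \<in> grade A e"
  have car: "Y f \<in> carrier A" "Y' f \<in> carrier A" "Z f \<in> carrier A" "Z' f \<in> carrier A"
    using Y Z f by simp_all
  have sum: "Y f \<oplus> Z f = Y' f \<oplus> Z' f"
    using fun_cong[OF eq, of f] f by simp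
  have "Y f \<ominus> Y' f = Z' f \<ominus> Z f"
  proof (rule functionals_separate)
    fix l assume l: "functional l"
    have "l (Y f \<oplus> Z f) = l (Y' f \<oplus> Z' f)" using sum by simp
    then show "l (Y f \<ominus> Y' f) = l (Z' f \<ominus> Z f)" using l car by (simp add: functional_simps)
  qed (use car in auto)
  moreover have "Y f \<ominus> Y' f \<in> grade A (a + e)" "Z' f \<ominus> Z f \<in> grade A (a + 1 + e)"
    using f Y Z by (simp_all add: grade_diff hvf_grade)
  ultimately have "Y f \<ominus> Y' f = \<zero>"
    using grade_disjoint[of "Y f \<ominus> Y' f" "a + e" "a + 1 + e"] by (cases a; cases e) auto
  then show "Y f = Y' f"
    using car minus_equality by (auto simp: a_minus_def dest: minus_equality)
qed

definition vpart :: "bit \<Rightarrow> ('a \<Rightarrow> 'a) \<Rightarrow> ('a \<Rightarrow> 'a)"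
  where "vpart a X = (THE Y. Y \<in> HV a \<and> (\<exists>Z\<in>HV (a + 1). X = vf_add A Y Z))"

lemma vpart_eq:
  assumes "Y \<in> HV a" "Z \<in> HV (a + 1)" shows "vpart a (vf_add A Y Z) = Y"
  unfolding vpart_def using assms by (intro the_equality) (auto intro: vf_decompose_unique)

lemma vpart_vf_add [simp]:
  "\<lbrakk>X \<in> HV 0; Y \<in> HV 1\<rbrakk> \<Longrightarrow> vpart 0 (vf_add A X Y) = X"
  "\<lbrakk>X \<in> HV 0; Y \<in> HV 1\<rbrakk> \<Longrightarrow> vpart 1 (vf_add A X Y) = Y"
  using vpart_eq[of X 0 Y] vpart_eq[of Y 1 X] vf_add_commute[of X 0 Y 1] by simp_all

lemma vf_add_mix:
  assumes "X \<in> HV a" "X' \<in> HV a" "Y \<in> HV b" "Y' \<in> HV b"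
  shows "vf_add A (vf_add A X Y) (vf_add A X' Y') = vf_add A (vf_add A X X') (vf_add A Y Y')"
  using assms by (intro extensional_eqI) (simp_all add: a_ac)

lemma vf_add_closed:
  assumes "X \<in> VF" "Y \<in> VF" shows "vf_add A X Y \<in> VF"
proof -
  obtain X0 X1 Y0 Y1 where "X0 \<in> HV 0" "X1 \<in> HV 1" "X = vf_add A X0 X1"
    "Y0 \<in> HV 0" "Y1 \<in> HV 1" "Y = vf_add A Y0 Y1" using assms by (metis vf_decompose)
  then show ?thesis by (simp add: vf_add_mix[of X0 0 Y0] vf_addI[of _ 0] vf_add_hvf)
qed

lemma vf_scale_mix:
  assumes "f \<in> grade A 0" "g \<in> grade A 1" "X \<in> HV 0" "Y \<in> HV 1"
  shows "vf_scale A (f \<oplus> g) (vf_add A X Y)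
    = vf_add A (vf_add A (vf_scale A f X) (vf_scale A g Y)) (vf_add A (vf_scale A f Y) (vf_scale A g X))"
  using assms by (intro extensional_eqI) (simp_all add: distribs a_ac)

lemma vf_scale_mix_hvf:
  assumes "f \<in> grade A 0" "g \<in> grade A 1" "X \<in> HV 0" "Y \<in> HV 1"
  shows "vf_add A (vf_scale A f X) (vf_scale A g Y) \<in> HV 0"
    "vf_add A (vf_scale A f Y) (vf_scale A g X) \<in> HV 1"
  using assms vf_scale_hvf[of f 0 X 0] vf_scale_hvf[of g 1 Y 1] vf_scale_hvf[of f 0 Y 1]
    vf_scale_hvf[of g 1 X 0] by (simp_all add: vf_add_hvf)

lemma vf_scale_closed:
  assumes "f \<in> carrier A" "X \<in> VF" shows "vf_scale A f X \<in> VF"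
proof -
  obtain X0 X1 where X: "X0 \<in> HV 0" "X1 \<in> HV 1" "X = vf_add A X0 X1"
    using vf_decompose[OF assms(2)] .
  obtain f0 f1 where f: "f0 \<in> grade A 0" "f1 \<in> grade A 1" "f = f0 \<oplus> f1"
    using grade_decompose[OF assms(1)] .
  show ?thesis
    using X f vf_scale_mix_hvf[of f0 f1 X0 X1] vf_addI[of _ 0] by (simp add: vf_scale_mix)
qed

end

context superalgebra
begin

lemma diff_zero_eq: "\<lbrakk>x \<in> carrier A; y \<in> carrier A; x \<ominus> y = \<zero>\<rbrakk> \<Longrightarrow> x = y"
  using minus_equality by (auto simp: a_minus_def dest: minus_equality)

primrec vf_sum :: "(nat \<Rightarrow> 'a \<Rightarrow> 'a) \<Rightarrow> nat \<Rightarrow> 'a \<Rightarrow> 'a" where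
  "vf_sum V 0 = vf_zero A"
| "vf_sum V (Suc n) = vf_add A (vf_sum V n) (V n)"

lemma vf_sum_hvf: "(\<And>k. k < n \<Longrightarrow> V k \<in> HV a) \<Longrightarrow> vf_sum V n \<in> HV a"
  by (induction n) (simp_all add: vf_add_hvf)

end

lemma salgebra_homD:
  assumes "h \<in> salgebra_hom A B"
  shows "x \<in> carrier A \<Longrightarrow> h x \<in> carrier B"
    "\<lbrakk>x \<in> carrier A; y \<in> carrier A\<rbrakk> \<Longrightarrow> h (x \<oplus>\<^bsub>A\<^esub> y) = h x \<oplus>\<^bsub>B\<^esub> h y"
    "\<lbrakk>x \<in> carrier A; y \<in> carrier A\<rbrakk> \<Longrightarrow> h (x \<otimes>\<^bsub>A\<^esub> y) = h x \<otimes>\<^bsub>B\<^esub> h y"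
    "h \<one>\<^bsub>A\<^esub> = \<one>\<^bsub>B\<^esub>"
    "x \<in> carrier A \<Longrightarrow> h (r \<odot>\<^bsub>A\<^esub> x) = r \<odot>\<^bsub>B\<^esub> h x"
    "x \<in> grade A i \<Longrightarrow> h x \<in> grade B i"
proof -
  have h: "h \<in> ring_hom A B" using assms unfolding salgebra_hom_def by blast
  show "x \<in> carrier A \<Longrightarrow> h x \<in> carrier B" by (rule ring_hom_closed[OF h])
  show "\<lbrakk>x \<in> carrier A; y \<in> carrier A\<rbrakk> \<Longrightarrow> h (x \<oplus>\<^bsub>A\<^esub> y) = h x \<oplus>\<^bsub>B\<^esub> h y" by (rule ring_hom_add[OF h])
  show "\<lbrakk>x \<in> carrier A; y \<in> carrier A\<rbrakk> \<Longrightarrow> h (x \<otimes>\<^bsub>A\<^esub> y) = h x \<otimes>\<^bsub>B\<^esub> h y" by (rule ring_hom_mult[OF h])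
  show "h \<one>\<^bsub>A\<^esub> = \<one>\<^bsub>B\<^esub>" by (rule ring_hom_one[OF h])
  show "x \<in> carrier A \<Longrightarrow> h (r \<odot>\<^bsub>A\<^esub> x) = r \<odot>\<^bsub>B\<^esub> h x" "x \<in> grade A i \<Longrightarrow> h x \<in> grade B i"
    using assms unfolding salgebra_hom_def by blast+
qed

section \<open>Connections on homogeneous vector fields\<close>

text \<open>The operator \<open>D a b\<close> is meant for fields of parities \<open>a\<close> and \<open>b\<close>. The parities are arguments
  because a field does not determine them: the zero field has both.\<close>

locale graded_connection = superalgebra A for A :: "'a salgebra" (structure) +
  fixes D :: "bit \<Rightarrow> bit \<Rightarrow> ('a \<Rightarrow> 'a) \<Rightarrow> ('a \<Rightarrow> 'a) \<Rightarrow> ('a \<Rightarrow> 'a)"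
  assumes D_hvf: "\<lbrakk>X \<in> HV a; Y \<in> HV b\<rbrakk> \<Longrightarrow> D a b X Y \<in> HV (a + b)"
    and D_add_left: "\<lbrakk>X \<in> HV a; X' \<in> HV a; Y \<in> HV b\<rbrakk> \<Longrightarrow>
      D a b (vf_add A X X') Y = vf_add A (D a b X Y) (D a b X' Y)"
    and D_add_right: "\<lbrakk>X \<in> HV a; Y \<in> HV b; Y' \<in> HV b\<rbrakk> \<Longrightarrow>
      D a b X (vf_add A Y Y') = vf_add A (D a b X Y) (D a b X Y')"
    and D_scale_left: "\<lbrakk>f \<in> grade A e; X \<in> HV a; Y \<in> HV b\<rbrakk> \<Longrightarrow>
      D (e + a) b (vf_scale A f X) Y = vf_scale A f (D a b X Y)"
    and D_leibniz: "\<lbrakk>f \<in> grade A e; X \<in> HV a; Y \<in> HV b\<rbrakk> \<Longrightarrow>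
      D a (e + b) X (vf_scale A f Y) =
        vf_add A (vf_scale A (X f) Y) (vf_signed A (a * e) (vf_scale A f (D a b X Y)))"
begin

definition total :: "('a \<Rightarrow> 'a) \<Rightarrow> ('a \<Rightarrow> 'a) \<Rightarrow> ('a \<Rightarrow> 'a)"
  where "total X Y = vf_add A
    (vf_add A (D 0 0 (vpart 0 X) (vpart 0 Y)) (D 1 1 (vpart 1 X) (vpart 1 Y)))
    (vf_add A (D 0 1 (vpart 0 X) (vpart 1 Y)) (D 1 0 (vpart 1 X) (vpart 0 Y)))"

lemma D_apply_closed [simp]: "\<lbrakk>X \<in> HV a; Y \<in> HV b; f \<in> carrier A\<rbrakk> \<Longrightarrow> D a b X Y f \<in> carrier A"
  by (rule hvf_closed[OF D_hvf])

lemma D_zero [simp]: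
  assumes X: "X \<in> HV a" shows "D b a (vf_zero A) X = vf_zero A" "D a b X (vf_zero A) = vf_zero A"
proof -
  show "D b a (vf_zero A) X = vf_zero A"
    using X D_add_left[of "vf_zero A" b "vf_zero A" X a]
    by (intro vf_idempotent[OF D_hvf[of _ b]]) (auto simp: vf_add_zero[of _ b])
  show "D a b X (vf_zero A) = vf_zero A"
    using X D_add_right[of X a "vf_zero A" b "vf_zero A"]
    by (intro vf_idempotent[OF D_hvf[of _ a]]) (auto simp: vf_add_zero[of _ b])
qed

lemma total_hvf:
  assumes "X \<in> HV a" "Y \<in> HV b" shows "total X Y = D a b X Y"
proof -
  have part: "vpart a X = X" "vpart (a + 1) X = vf_zero A" if "X \<in> HV a" for a X
    using vpart_eq[of X a "vf_zero A"] vpart_eq[of "vf_zero A" "a + 1" X] that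
    by (simp_all add: add.assoc)
  show ?thesis
    unfolding total_def using assms part[OF assms(1)] part[OF assms(2)] D_hvf[OF assms]
    by (cases a; cases b) (simp_all add: vf_add_zero[of "vf_zero A" 0])
qed

lemma total_vf_add:
  assumes "X0 \<in> HV 0" "X1 \<in> HV 1" "Y0 \<in> HV 0" "Y1 \<in> HV 1"
  shows "total (vf_add A X0 X1) (vf_add A Y0 Y1) = vf_add A
    (vf_add A (D 0 0 X0 Y0) (D 1 1 X1 Y1)) (vf_add A (D 0 1 X0 Y1) (D 1 0 X1 Y0))"
  using assms by (simp add: total_def)

lemma total_is_connection: "is_connection A total"
  unfolding is_connection_def
proof (intro conjI ballI allI)
  fix X Y assume "X \<in> VF" "Y \<in> VF"
  then obtain X0 X1 Y0 Y1 where XY: "X0 \<in> HV 0" "X1 \<in> HV 1" "X = vf_add A X0 X1"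
    "Y0 \<in> HV 0" "Y1 \<in> HV 1" "Y = vf_add A Y0 Y1" by (metis vf_decompose)
  then have "D 0 0 X0 Y0 \<in> HV 0" "D 1 1 X1 Y1 \<in> HV 0" "D 0 1 X0 Y1 \<in> HV 1" "D 1 0 X1 Y0 \<in> HV 1"
    using D_hvf[of X0 0 Y0 0] D_hvf[of X1 1 Y1 1] D_hvf[of X0 0 Y1 1] D_hvf[of X1 1 Y0 0] by auto
  then show "total X Y \<in> VF"
    using XY by (simp add: total_vf_add vf_addI[of _ 0] vf_add_hvf)
  fix X' assume "X' \<in> VF"
  then obtain X0' X1' where X': "X0' \<in> HV 0" "X1' \<in> HV 1" "X' = vf_add A X0' X1'"
    by (metis vf_decompose)
  show "total (vf_add A X X') Y = vf_add A (total X Y) (total X' Y)"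
  proof (intro extensional_eqI)
    fix f assume "f \<in> carrier A"
    then show "total (vf_add A X X') Y f = vf_add A (total X Y) (total X' Y) f"
      using XY X' by (simp add: vf_add_mix total_vf_add vf_add_hvf D_add_left a_ac)
  qed (use XY X' in \<open>simp_all add: vf_add_mix total_vf_add vf_add_hvf\<close>)
next
  fix X Y Y' assume "X \<in> VF" "Y \<in> VF" "Y' \<in> VF"
  then obtain X0 X1 Y0 Y1 Y0' Y1' where XY: "X0 \<in> HV 0" "X1 \<in> HV 1" "X = vf_add A X0 X1"
    "Y0 \<in> HV 0" "Y1 \<in> HV 1" "Y = vf_add A Y0 Y1" "Y0' \<in> HV 0" "Y1' \<in> HV 1" "Y' = vf_add A Y0' Y1'"
    by (metis vf_decompose)
  show "total X (vf_add A Y Y') = vf_add A (total X Y) (total X Y')"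
  proof (intro extensional_eqI)
    fix f assume "f \<in> carrier A"
    then show "total X (vf_add A Y Y') f = vf_add A (total X Y) (total X Y') f"
      using XY by (simp add: vf_add_mix total_vf_add vf_add_hvf D_add_right a_ac)
  qed (use XY in \<open>simp_all add: vf_add_mix total_vf_add vf_add_hvf\<close>)
next
  fix f X Y assume f: "f \<in> carrier A" and "X \<in> VF" "Y \<in> VF"
  then obtain X0 X1 Y0 Y1 where XY: "X0 \<in> HV 0" "X1 \<in> HV 1" "X = vf_add A X0 X1"
    "Y0 \<in> HV 0" "Y1 \<in> HV 1" "Y = vf_add A Y0 Y1" by (metis vf_decompose)
  obtain f0 f1 where f01: "f0 \<in> grade A 0" "f1 \<in> grade A 1" "f = f0 \<oplus> f1"
    using grade_decompose[OF f] .
  have fX: "vf_scale A f0 X0 \<in> HV 0" "vf_scale A f1 X1 \<in> HV 0" "vf_scale A f0 X1 \<in> HV 1"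
     "vf_scale A f1 X0 \<in> HV 1"
    using vf_scale_hvf[of f0 0 X0 0] vf_scale_hvf[of f1 1 X1 1] vf_scale_hvf[of f0 0 X1 1]
      vf_scale_hvf[of f1 1 X0 0] XY f01 by simp_all
  have D_fX: "D 0 b (vf_scale A f0 X0) Y = vf_scale A f0 (D 0 b X0 Y)"
    "D 0 b (vf_scale A f1 X1) Y = vf_scale A f1 (D 1 b X1 Y)"
    "D 1 b (vf_scale A f0 X1) Y = vf_scale A f0 (D 1 b X1 Y)"
    "D 1 b (vf_scale A f1 X0) Y = vf_scale A f1 (D 0 b X0 Y)" if "Y \<in> HV b" for b Y
    using D_scale_left[of f0 0 X0 0 Y b] D_scale_left[of f1 1 X1 1 Y b]
      D_scale_left[of f0 0 X1 1 Y b] D_scale_left[of f1 1 X0 0 Y b] XY f01 that by simp_all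
  have eq: "vf_scale A f X = vf_add A (vf_add A (vf_scale A f0 X0) (vf_scale A f1 X1))
      (vf_add A (vf_scale A f0 X1) (vf_scale A f1 X0))"
    using vf_scale_mix[of f0 f1 X0 X1] XY f01 by simp
  show "total (vf_scale A f X) Y = vf_scale A f (total X Y)"
  proof (intro extensional_eqI)
    fix g assume g: "g \<in> carrier A"
    show "total (vf_scale A f X) Y g = vf_scale A f (total X Y) g"
      using XY g f01 unfolding eq
      by (simp add: total_vf_add vf_add_hvf fX D_add_left D_fX distribs a_ac)
  qed (simp_all add: total_def)
next
  fix a e b X f Y assume "X \<in> HV a" "f \<in> grade A e" "Y \<in> HV b"
  then show "total X (vf_scale A f Y) =
        vf_add A (vf_scale A (X f) Y) (vf_signed A (a * e) (vf_scale A f (total X Y)))"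
    using total_hvf[of X a "vf_scale A f Y" "e + b"] by (simp add: vf_scale_hvf D_leibniz total_hvf)
qed

end

section \<open>Symmetrization\<close>

locale symmetric_graded_connection = superalgebra A for A :: "'a salgebra" (structure) +
  fixes D :: "bit \<Rightarrow> bit \<Rightarrow> ('a \<Rightarrow> 'a) \<Rightarrow> ('a \<Rightarrow> 'a) \<Rightarrow> ('a \<Rightarrow> 'a)"
  assumes sym_hvf: "\<lbrakk>X \<in> HV a; Y \<in> HV b\<rbrakk> \<Longrightarrow> D a b X Y \<in> HV (a + b)"
    and sym_add_left: "\<lbrakk>X \<in> HV a; X' \<in> HV a; Y \<in> HV b\<rbrakk> \<Longrightarrow>
      D a b (vf_add A X X') Y = vf_add A (D a b X Y) (D a b X' Y)"
    and sym_scale_left: "\<lbrakk>f \<in> grade A e; X \<in> HV a; Y \<in> HV b\<rbrakk> \<Longrightarrow>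
      D (e + a) b (vf_scale A f X) Y = vf_scale A f (D a b X Y)"
    and sym_torsion: "\<lbrakk>X \<in> HV a; Y \<in> HV b; f \<in> carrier A\<rbrakk> \<Longrightarrow>
      D a b X Y f = signed A (a * b) (D b a Y X f) \<oplus> (X (Y f) \<ominus> signed A (a * b) (Y (X f)))"

text \<open>A symmetric connection can exchange its arguments at the cost of a bracket. Additivity and the
  Leibniz rule in the second argument thus follow from linearity in the first one and from the
  Leibniz rule for brackets.\<close>

sublocale symmetric_graded_connection \<subseteq> graded_connection A D
proof
  fix X Y Y' a b assume XY: "X \<in> HV a" "Y \<in> HV b" "Y' \<in> HV b"
  show "D a b X (vf_add A Y Y') = vf_add A (D a b X Y) (D a b X Y')"
  proof (intro extensional_eqI)
    fix f assume f: "f \<in> carrier A"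
    have car: "D b a Y X f \<in> carrier A" "D b a Y' X f \<in> carrier A"
      using sym_hvf[of Y b X a] sym_hvf[of Y' b X a] XY f by auto
    show "D a b X (vf_add A Y Y') f = vf_add A (D a b X Y) (D a b X Y') f"
      using XY f car sym_torsion[of X a Y b f] sym_torsion[of X a Y' b f]
        sym_torsion[of X a "vf_add A Y Y'" b f]
      by (intro functionals_separate)
        (simp_all add: vf_add_hvf sym_add_left functional_simps algebra_simps)
  qed (use XY hvf_extensional[OF sym_hvf] vf_add_hvf in \<open>simp_all\<close>)
next
  fix f e X a Y b assume f: "f \<in> grade A e" and X: "X \<in> HV a" and Y: "Y \<in> HV b"
  note fY = vf_scale_hvf[OF f Y]
  show "D a (e + b) X (vf_scale A f Y) =
        vf_add A (vf_scale A (X f) Y) (vf_signed A (a * e) (vf_scale A f (D a b X Y)))"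
  proof (intro extensional_eqI)
    fix g assume g: "g \<in> carrier A"
    have car: "D b a Y X g \<in> carrier A"
      using sym_hvf[OF Y X] g by simp
    show "D a (e + b) X (vf_scale A f Y) g = vf_add A (vf_scale A (X f) Y)
        (vf_signed A (a * e) (vf_scale A f (D a b X Y))) g"
      using f X Y g car sym_torsion[OF X fY g] sym_torsion[OF X Y g]
      by (intro functionals_separate) (simp_all add: sym_scale_left hvf_mult[of X a f e]
          functional_simps distribs, simp add: algebra_simps sg_add)
  qed (use hvf_extensional[OF sym_hvf[OF X fY]] in simp_all)
qed (rule sym_hvf sym_add_left sym_scale_left; assumption)+

context symmetric_graded_connection
begin

lemma total_symmetric: "symmetric_connection A total"
  unfolding symmetric_connection_def torsion_def
proof (intro allI ballI extensional_eqI)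
  fix a b X Y f assume "X \<in> HV a" "Y \<in> HV b" "f \<in> carrier A"
  then show "vf_diff A (vf_diff A (total X Y) (vf_signed A (a * b) (total Y X))) (bracket A a b X Y) f
      = vf_zero A f"
    using sym_torsion[of X a Y b f]
    by (intro functionals_separate) (simp_all add: total_hvf functional_simps)
qed simp_all

end

context graded_connection
begin

text \<open>This is \<open>D\<close> minus half of its torsion.\<close>

definition symmetrized :: "bit \<Rightarrow> bit \<Rightarrow> ('a \<Rightarrow> 'a) \<Rightarrow> ('a \<Rightarrow> 'a) \<Rightarrow> ('a \<Rightarrow> 'a)"
  where "symmetrized a b X Y = vf_scale A ((1/2) \<odot> \<one>)
    (vf_add A (vf_add A (D a b X Y) (vf_signed A (a * b) (D b a Y X))) (bracket A a b X Y))"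

lemma symmetrized_apply:
  assumes "X \<in> HV a" "Y \<in> HV b" "f \<in> carrier A"
  shows "symmetrized a b X Y f = (1/2) \<odot> ((D a b X Y f \<oplus> signed A (a * b) (D b a Y X f))
    \<oplus> (X (Y f) \<ominus> signed A (a * b) (Y (X f))))"
  using assms by (simp add: symmetrized_def smult_mult_left)

text \<open>Linearity in \<open>X\<close> holds because the derivative of \<open>f\<close> in \<open>D\<^sub>Y(f X)\<close> cancels the one in
  \<open>[f X, Y]\<close>.\<close>

lemma symmetrized_symmetric: "symmetric_graded_connection A symmetrized"
proof
  fix X Y a b assume XY: "X \<in> HV a" "Y \<in> HV b"
  show hvf: "symmetrized a b X Y \<in> HV (a + b)"
    using vf_scale_hvf[OF grade_smult[OF one_grade, of "1/2"], of _ "a + b"] XY D_hvf[of X a Y b] D_hvf[of Y b X a]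
    unfolding symmetrized_def by (simp add: vf_add_hvf vf_signed_hvf bracket_hvf add.commute)
  fix f assume f: "f \<in> carrier A"
  show "symmetrized a b X Y f = signed A (a * b) (symmetrized b a Y X f)
      \<oplus> (X (Y f) \<ominus> signed A (a * b) (Y (X f)))"
    using XY f by (intro functionals_separate)
      (simp_all add: symmetrized_apply functional_simps mult.commute algebra_simps)
next
  fix X X' Y a b assume XY: "X \<in> HV a" "X' \<in> HV a" "Y \<in> HV b"
  show "symmetrized a b (vf_add A X X') Y = vf_add A (symmetrized a b X Y) (symmetrized a b X' Y)"
  proof (intro extensional_eqI)
    fix f assume f: "f \<in> carrier A"
    show "symmetrized a b (vf_add A X X') Y f = vf_add A (symmetrized a b X Y) (symmetrized a b X' Y) f"
      using XY f by (intro functionals_separate)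
        (simp_all add: symmetrized_apply vf_add_hvf D_add_left D_add_right functional_simps algebra_simps)
  qed (simp_all add: symmetrized_def)
next
  fix f e X a Y b assume f: "f \<in> grade A e" and X: "X \<in> HV a" and Y: "Y \<in> HV b"
  show "symmetrized (e + a) b (vf_scale A f X) Y = vf_scale A f (symmetrized a b X Y)"
  proof (intro extensional_eqI)
    fix g assume g: "g \<in> carrier A"
    show "symmetrized (e + a) b (vf_scale A f X) Y g = vf_scale A f (symmetrized a b X Y) g"
      using f X Y g by (intro functionals_separate)
        (simp_all add: symmetrized_apply vf_scale_hvf[OF f X] D_scale_left[OF f X Y] D_leibniz[OF f Y X]
          hvf_mult[OF Y f] functional_simps distribs, simp (no_asm) add: algebra_simps sg_add)
  qed (simp_all add: symmetrized_def)
qed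

end

section \<open>The symplectic correction\<close>

locale symplectic_superalgebra = superalgebra A for A :: "'a salgebra" (structure) +
  fixes w :: bit and \<omega> :: "('a \<Rightarrow> 'a) \<Rightarrow> ('a \<Rightarrow> 'a) \<Rightarrow> 'a"
  assumes symplectic: "symplectic_form A w \<omega>"
begin

lemma two_form: "two_form A w \<omega>" and tensor: "covariant_2_tensor A w \<omega>"
  and closed: "closed_two_form A w \<omega>" and nondeg: "nondegenerate A \<omega>"
  using symplectic unfolding symplectic_form_def two_form_def by blast+

lemma form_closed [simp]: "\<lbrakk>Y \<in> VF; Z \<in> VF\<rbrakk> \<Longrightarrow> \<omega> Y Z \<in> carrier A"
  using tensor unfolding covariant_2_tensor_def by metis

lemma form_grade: "\<lbrakk>Y \<in> HV b; Z \<in> HV c\<rbrakk> \<Longrightarrow> \<omega> Y Z \<in> grade A (w + b + c)"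
  using tensor unfolding covariant_2_tensor_def by metis

lemma form_add_left: "\<lbrakk>Y \<in> VF; Y' \<in> VF; Z \<in> VF\<rbrakk> \<Longrightarrow> \<omega> (vf_add A Y Y') Z = \<omega> Y Z \<oplus> \<omega> Y' Z"
  using tensor unfolding covariant_2_tensor_def by metis

lemma form_add_right: "\<lbrakk>Y \<in> VF; Z \<in> VF; Z' \<in> VF\<rbrakk> \<Longrightarrow> \<omega> Y (vf_add A Z Z') = \<omega> Y Z \<oplus> \<omega> Y Z'"
  using tensor unfolding covariant_2_tensor_def by metis

lemma form_scale_left: "\<lbrakk>f \<in> grade A e; Y \<in> VF; Z \<in> VF\<rbrakk> \<Longrightarrow>
    \<omega> (vf_scale A f Y) Z = signed A (e * w) (f \<otimes> \<omega> Y Z)"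
  using tensor unfolding covariant_2_tensor_def by metis

lemma form_scale_right: "\<lbrakk>f \<in> grade A e; Y \<in> HV b; Z \<in> VF\<rbrakk> \<Longrightarrow>
    \<omega> Y (vf_scale A f Z) = signed A (e * (w + b)) (f \<otimes> \<omega> Y Z)"
  using tensor unfolding covariant_2_tensor_def by metis

lemma form_antisym: "\<lbrakk>Y \<in> HV b; Z \<in> HV c\<rbrakk> \<Longrightarrow> \<omega> Y Z = \<ominus> signed A (b * c) (\<omega> Z Y)"
  using two_form unfolding two_form_def by metis

lemma vf_signed_eq_scale: "X \<in> VF \<Longrightarrow> vf_signed A e X = vf_scale A (sg e \<odot> \<one>) X"
  by (intro extensional_eqI) (simp_all add: smult_mult_left signed_eq_smult)

lemma vf_signed_closed: "X \<in> VF \<Longrightarrow> vf_signed A e X \<in> VF"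
  by (simp add: vf_signed_eq_scale vf_scale_closed)

lemma form_signed_left: "\<lbrakk>Y \<in> VF; Z \<in> VF\<rbrakk> \<Longrightarrow> \<omega> (vf_signed A e Y) Z = signed A e (\<omega> Y Z)"
  and form_signed_right: "\<lbrakk>Y \<in> HV b; Z \<in> VF\<rbrakk> \<Longrightarrow> \<omega> Y (vf_signed A e Z) = signed A e (\<omega> Y Z)"
  using form_scale_left[OF grade_smult[OF one_grade, of "sg e"], of Y Z]
    form_scale_right[OF grade_smult[OF one_grade, of "sg e"], of Y b Z]
  by (simp_all add: vf_signed_eq_scale signed_eq_smult smult_mult_left)

lemma form_zero_left: "Z \<in> VF \<Longrightarrow> \<omega> (vf_zero A) Z = \<zero>"
proof -
  assume Z: "Z \<in> VF"
  have "\<omega> (vf_add A (vf_zero A) (vf_zero A)) Z = \<omega> (vf_zero A) Z \<oplus> \<omega> (vf_zero A) Z"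
    using Z hvf_vf[OF vf_zero_hvf] by (intro form_add_left)
  then show ?thesis using Z hvf_vf[OF vf_zero_hvf] by (simp add: vf_add_zero[of _ 0])
qed

lemma form_left_eqI:
  assumes V: "V \<in> VF" "V' \<in> VF" and eq: "\<And>c Z. Z \<in> HV c \<Longrightarrow> \<omega> V Z = \<omega> V' Z"
  shows "V = V'"
proof -
  have "\<omega> V Z = \<omega> V' Z" if "Z \<in> VF" for Z
  proof -
    obtain Z0 Z1 where "Z0 \<in> HV 0" "Z1 \<in> HV 1" "Z = vf_add A Z0 Z1" using vf_decompose[OF \<open>Z \<in> VF\<close>] .
    then show ?thesis using eq[of Z0 0] eq[of Z1 1] V by (simp add: form_add_right)
  qed
  then have "restrict (\<omega> V) VF = restrict (\<omega> V') VF" by (auto simp: fun_eq_iff)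
  then show ?thesis
    using nondeg V unfolding nondegenerate_def bij_betw_def inj_on_def by blast
qed

lemma one_form_grade: "\<lbrakk>\<alpha> \<in> hom_one_forms A u; Z \<in> HV c\<rbrakk> \<Longrightarrow> \<alpha> Z \<in> grade A (u + c)"
  unfolding hom_one_forms_def by blast

lemma hom_one_form_one_form:
  assumes "\<alpha> \<in> hom_one_forms A u" shows "\<alpha> \<in> one_forms A"
proof -
  define z where "z = (\<lambda>Z\<in>VF. \<zero>)"
  have z: "z \<in> hom_one_forms A i" for i
    unfolding hom_one_forms_def z_def by (auto simp: vf_add_closed vf_scale_closed signed_def)
  have "\<alpha> \<in> VF \<rightarrow>\<^sub>E carrier A" using assms unfolding hom_one_forms_def by blast
  then have "(\<lambda>Y\<in>VF. \<alpha> Y \<oplus> z Y) = \<alpha>" "(\<lambda>Y\<in>VF. z Y \<oplus> \<alpha> Y) = \<alpha>"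
    by (auto simp: z_def fun_eq_iff restrict_def PiE_def extensional_def dest!: funcset_mem)
  moreover have "(\<lambda>Y\<in>VF. \<alpha> Y \<oplus> z Y) \<in> one_forms A" if "u = 0"
    using assms z[of 1] that unfolding one_forms_def by blast
  moreover have "(\<lambda>Y\<in>VF. z Y \<oplus> \<alpha> Y) \<in> one_forms A" if "u = 1"
    using assms z[of 0] that unfolding one_forms_def by blast
  ultimately show ?thesis by (cases u) simp_all
qed

text \<open>Surjectivity gives some field \<open>V\<close>. Its component of the wrong parity pairs with every homogeneous
  field to a value that has both parities, so this component vanishes.\<close>

lemma sharp_exists:
  assumes \<alpha>: "\<alpha> \<in> hom_one_forms A (w + u)"
  shows "\<exists>V\<in>HV u. \<forall>Z\<in>VF. \<omega> V Z = \<alpha> Z"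
proof -
  have "\<alpha> \<in> (\<lambda>Y. restrict (\<omega> Y) VF) ` VF"
    using hom_one_form_one_form[OF \<alpha>] nondeg unfolding nondegenerate_def bij_betw_def by simp
  then obtain V where V: "V \<in> VF" "restrict (\<omega> V) VF = \<alpha>" by blast
  obtain V0 V1 where V01: "V0 \<in> HV 0" "V1 \<in> HV 1" "V = vf_add A V0 V1" using vf_decompose[OF V(1)] .
  obtain U U' where U: "U \<in> HV u" "U' \<in> HV (u + 1)" "V = vf_add A U U'"
  proof (cases u)
    case zero then show ?thesis using V01 that[of V0 V1] by simp
  next
    case one then show ?thesis using V01 that[of V1 V0] vf_add_commute[of V0 0 V1 1] by simp
  qed
  have eq: "\<alpha> Z = \<omega> U Z \<oplus> \<omega> U' Z" if "Z \<in> VF" for Z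
  proof -
    have "\<alpha> Z = \<omega> V Z" using fun_cong[OF V(2), of Z] that by simp
    also have "\<dots> = \<omega> U Z \<oplus> \<omega> U' Z"
      unfolding U(3) using that hvf_vf[OF U(1)] hvf_vf[OF U(2)] by (simp add: form_add_left)
    finally show ?thesis .
  qed
  have "U' = vf_zero A"
  proof (rule form_left_eqI)
    fix c Z assume Z: "Z \<in> HV c"
    have g: "\<alpha> Z \<in> grade A (w + u + c)" "\<omega> U Z \<in> grade A (w + u + c)" "\<omega> U' Z \<in> grade A (w + (u + 1) + c)"
      using one_form_grade[OF \<alpha> Z] form_grade[OF U(1) Z] form_grade[OF U(2) Z] by simp_all
    have "\<omega> U' Z = \<alpha> Z \<ominus> \<omega> U Z"
      unfolding eq[OF hvf_vf[OF Z]] using U Z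
      by (intro functionals_separate) (simp_all add: functional_simps)
    then have "\<omega> U' Z \<in> grade A (w + u + c)" using g by (simp add: grade_diff)
    then have "\<omega> U' Z = \<zero>" using g(3) by (rule grade_disjoint) (cases u; cases w; cases c; simp)
    then show "\<omega> U' Z = \<omega> (vf_zero A) Z" using Z by (simp add: form_zero_left)
  qed (use U hvf_vf[OF vf_zero_hvf] in simp_all)
  then have "\<omega> U Z = \<alpha> Z" if "Z \<in> VF" for Z
    using eq[OF that] U that by (simp add: form_zero_left)
  then show ?thesis using U(1) by blast
qed

end

locale symplectic_correction = symplectic_superalgebra A w \<omega> + symmetric_graded_connection A D
  for A :: "'a salgebra" (structure) and w \<omega> D
begin

lemma nabla_hvf: "\<lbrakk>X \<in> HV a; Y \<in> HV b\<rbrakk> \<Longrightarrow> total X Y \<in> HV (a + b)"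
  by (simp add: total_hvf D_hvf)

lemma nabla_closed [simp]: "\<lbrakk>X \<in> VF; Y \<in> VF\<rbrakk> \<Longrightarrow> total X Y \<in> VF"
  and nabla_add_left: "\<lbrakk>X \<in> VF; X' \<in> VF; Y \<in> VF\<rbrakk> \<Longrightarrow>
    total (vf_add A X X') Y = vf_add A (total X Y) (total X' Y)"
  and nabla_add_right: "\<lbrakk>X \<in> VF; Y \<in> VF; Y' \<in> VF\<rbrakk> \<Longrightarrow>
    total X (vf_add A Y Y') = vf_add A (total X Y) (total X Y')"
  and nabla_scale_left: "\<lbrakk>f \<in> carrier A; X \<in> VF; Y \<in> VF\<rbrakk> \<Longrightarrow>
    total (vf_scale A f X) Y = vf_scale A f (total X Y)"
  and nabla_leibniz: "\<lbrakk>X \<in> HV a; f \<in> grade A e; Y \<in> HV b\<rbrakk> \<Longrightarrow> total X (vf_scale A f Y) =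
    vf_add A (vf_scale A (X f) Y) (vf_signed A (a * e) (vf_scale A f (total X Y)))"
  using total_is_connection unfolding is_connection_def by metis+

text \<open>This is \<open>(\<nabla>\<^sub>X \<omega>)(Y, Z)\<close> for the symmetric connection \<open>\<nabla> = total\<close>.\<close>

abbreviation P :: "bit \<Rightarrow> bit \<Rightarrow> ('a \<Rightarrow> 'a) \<Rightarrow> ('a \<Rightarrow> 'a) \<Rightarrow> ('a \<Rightarrow> 'a) \<Rightarrow> 'a"
  where "P \<equiv> cov_deriv A total w \<omega>"

lemma P_closed [simp]: "\<lbrakk>X \<in> HV a; Y \<in> HV b; Z \<in> VF\<rbrakk> \<Longrightarrow> P a b X Y Z \<in> carrier A"
  by (simp add: cov_deriv_def)

lemma functional_P:
  assumes "functional l" "X \<in> HV a" "Y \<in> HV b" "Z \<in> VF"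
  shows "l (P a b X Y Z) = l (X (\<omega> Y Z)) - sg (a * w) * l (\<omega> (total X Y) Z)
    - sg (a * (b + w)) * l (\<omega> Y (total X Z))"
  using assms by (simp add: cov_deriv_def functional_simps)

lemma functional_mult_P:
  assumes "functional l" "X \<in> HV a" "Y \<in> HV b" "Z \<in> VF" "f \<in> carrier A"
  shows "l (f \<otimes> P a b X Y Z) = l (f \<otimes> X (\<omega> Y Z)) - sg (a * w) * l (f \<otimes> \<omega> (total X Y) Z)
    - sg (a * (b + w)) * l (f \<otimes> \<omega> Y (total X Z))"
proof -
  have "X (\<omega> Y Z) \<in> carrier A" "\<omega> (total X Y) Z \<in> carrier A" "\<omega> Y (total X Z) \<in> carrier A"
    using assms by simp_all
  then show ?thesis
    using assms(1,5) by (simp add: cov_deriv_def distribs functional_simps)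
qed

lemma P_grade:
  assumes X: "X \<in> HV a" and Y: "Y \<in> HV b" and Z: "Z \<in> HV c"
  shows "P a b X Y Z \<in> grade A (w + (a + b) + c)"
proof -
  have "X (\<omega> Y Z) \<in> grade A (a + (w + b + c))" "\<omega> (total X Y) Z \<in> grade A (w + (a + b) + c)"
    "\<omega> Y (total X Z) \<in> grade A (w + b + (a + c))"
    by (intro hvf_grade form_grade nabla_hvf assms)+
  moreover have "a + (w + b + c) = w + (a + b) + c" "w + b + (a + c) = w + (a + b) + c"
    by (simp_all add: ac_simps)
  ultimately show ?thesis
    unfolding cov_deriv_def by (simp add: grade_diff grade_signed)
qed

lemma P_add_right:
  assumes "X \<in> HV a" "Y \<in> HV b" "Z \<in> VF" "Z' \<in> VF"
  shows "P a b X Y (vf_add A Z Z') = P a b X Y Z \<oplus> P a b X Y Z'"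
  using assms by (intro functionals_separate)
    (simp_all add: functional_P functional_simps form_add_right nabla_add_right vf_add_closed algebra_simps)

text \<open>In each of its three arguments \<open>\<nabla>\<omega>\<close> is linear over superfunctions up to the sign rule, because the
  terms that differentiate \<open>f\<close> cancel. The correction below inherits this linearity.\<close>

lemma P_scale_right:
  assumes X: "X \<in> HV a" and Y: "Y \<in> HV b" and f: "f \<in> grade A e" and Z: "Z \<in> HV c"
  shows "P a b X Y (vf_scale A f Z) = signed A (e * (w + (a + b))) (f \<otimes> P a b X Y Z)"
proof (rule functionals_separate)
  note VF = hvf_vf[OF X] hvf_vf[OF Y] hvf_vf[OF Z] nabla_closed grade_closed[OF f] vf_scale_closed
  note Xf = hvf_grade[OF X f]
  have fP: "f \<otimes> P a b X Y Z \<in> carrier A" using X Y Z f by simp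
  fix l assume l: "functional l"
  have "l (P a b X Y (vf_scale A f Z)) = l (X (\<omega> Y (vf_scale A f Z)))
      - sg (a * w) * l (\<omega> (total X Y) (vf_scale A f Z))
      - sg (a * (b + w)) * l (\<omega> Y (total X (vf_scale A f Z)))"
    by (intro functional_P l X Y VF)
  also have "l (X (\<omega> Y (vf_scale A f Z)))
      = sg (e * (w + b)) * (l (X f \<otimes> \<omega> Y Z) + sg (a * e) * l (f \<otimes> X (\<omega> Y Z)))"
    using VF X Y Z f l by (simp add: form_scale_right[OF f Y] hvf_mult[OF X f] functional_simps)
  also have "l (\<omega> (total X Y) (vf_scale A f Z)) = sg (e * (w + (a + b))) * l (f \<otimes> \<omega> (total X Y) Z)"
    using VF l by (simp add: form_scale_right[OF f nabla_hvf[OF X Y]] functional_simps)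
  also have "l (\<omega> Y (total X (vf_scale A f Z))) = sg ((a + e) * (w + b)) * l (X f \<otimes> \<omega> Y Z)
      + sg (a * e) * (sg (e * (w + b)) * l (f \<otimes> \<omega> Y (total X Z)))"
    using VF X l by (simp add: nabla_leibniz[OF X f Z] form_add_right vf_signed_closed
        form_signed_right[OF Y] form_scale_right[OF f Y] form_scale_right[OF Xf Y] functional_simps)
  finally show "l (P a b X Y (vf_scale A f Z)) = l (signed A (e * (w + (a + b))) (f \<otimes> P a b X Y Z))"
    unfolding functional_signed[OF l fP] functional_mult_P[OF l X Y VF(3) grade_closed[OF f]]
    by (cases a; cases b; cases e; cases w) simp_all
qed (use X Y Z f in \<open>simp_all add: vf_scale_closed\<close>)

lemma P_scale_left:
  assumes X: "X \<in> HV a" and Y: "Y \<in> HV b" and f: "f \<in> grade A e" and Z: "Z \<in> HV c"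
  shows "P (e + a) b (vf_scale A f X) Y Z = f \<otimes> P a b X Y Z"
proof (rule functionals_separate)
  note VF = hvf_vf[OF X] hvf_vf[OF Y] hvf_vf[OF Z] nabla_closed grade_closed[OF f] vf_scale_closed
  fix l assume l: "functional l"
  have "l (P (e + a) b (vf_scale A f X) Y Z) = l (vf_scale A f X (\<omega> Y Z))
      - sg ((e + a) * w) * l (\<omega> (total (vf_scale A f X) Y) Z)
      - sg ((e + a) * (b + w)) * l (\<omega> Y (total (vf_scale A f X) Z))"
    by (intro functional_P l vf_scale_hvf f X Y VF)
  also have "\<dots> = l (f \<otimes> X (\<omega> Y Z)) - sg ((e + a) * w) * (sg (e * w) * l (f \<otimes> \<omega> (total X Y) Z))
      - sg ((e + a) * (b + w)) * (sg (e * (w + b)) * l (f \<otimes> \<omega> Y (total X Z)))"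
    using VF l by (simp add: nabla_scale_left form_scale_left[OF f] form_scale_right[OF f Y] functional_simps)
  finally show "l (P (e + a) b (vf_scale A f X) Y Z) = l (f \<otimes> P a b X Y Z)"
    unfolding functional_mult_P[OF l X Y VF(3) grade_closed[OF f]]
    by (cases a; cases b; cases e; cases w) simp_all
qed (use X Y Z f vf_scale_hvf[OF f X] in \<open>simp_all add: vf_scale_closed\<close>)

lemma P_scale_middle:
  assumes X: "X \<in> HV a" and Y: "Y \<in> HV b" and f: "f \<in> grade A e" and Z: "Z \<in> HV c"
  shows "P a (e + b) X (vf_scale A f Y) Z = signed A (e * (w + a)) (f \<otimes> P a b X Y Z)"
proof (rule functionals_separate)
  note VF = hvf_vf[OF X] hvf_vf[OF Y] hvf_vf[OF Z] nabla_closed grade_closed[OF f] vf_scale_closed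
  note Xf = hvf_grade[OF X f]
  have fP: "f \<otimes> P a b X Y Z \<in> carrier A" using X Y Z f by simp
  fix l assume l: "functional l"
  have "l (P a (e + b) X (vf_scale A f Y) Z) = l (X (\<omega> (vf_scale A f Y) Z))
      - sg (a * w) * l (\<omega> (total X (vf_scale A f Y)) Z)
      - sg (a * (e + b + w)) * l (\<omega> (vf_scale A f Y) (total X Z))"
    by (intro functional_P l vf_scale_hvf f X Y VF)
  also have "l (X (\<omega> (vf_scale A f Y) Z))
      = sg (e * w) * (l (X f \<otimes> \<omega> Y Z) + sg (a * e) * l (f \<otimes> X (\<omega> Y Z)))"
    using VF X Y Z f l by (simp add: form_scale_left[OF f] hvf_mult[OF X f] functional_simps)
  also have "l (\<omega> (total X (vf_scale A f Y)) Z) = sg ((a + e) * w) * l (X f \<otimes> \<omega> Y Z)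
      + sg (a * e) * (sg (e * w) * l (f \<otimes> \<omega> (total X Y) Z))"
    using VF X l by (simp add: nabla_leibniz[OF X f Y] form_add_left vf_signed_closed
        form_signed_left form_scale_left[OF f] form_scale_left[OF Xf] functional_simps)
  also have "l (\<omega> (vf_scale A f Y) (total X Z)) = sg (e * w) * l (f \<otimes> \<omega> Y (total X Z))"
    using VF l by (simp add: form_scale_left[OF f] functional_simps)
  finally show "l (P a (e + b) X (vf_scale A f Y) Z) = l (signed A (e * (w + a)) (f \<otimes> P a b X Y Z))"
    unfolding functional_signed[OF l fP] functional_mult_P[OF l X Y VF(3) grade_closed[OF f]]
    by (cases a; cases b; cases e; cases w) simp_all
qed (use X Y Z f vf_scale_hvf[OF f Y] in \<open>simp_all add: vf_scale_closed\<close>)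

lemma P_antisym:
  assumes l: "functional l" and X: "X \<in> HV a" and Y: "Y \<in> HV b" and Z: "Z \<in> HV c"
  shows "l (P a c X Z Y) = - sg (b * c) * l (P a b X Y Z)"
proof -
  note VF = hvf_vf[OF X] hvf_vf[OF Y] hvf_vf[OF Z] nabla_closed
  have "l (P a c X Z Y) = l (X (\<omega> Z Y)) - sg (a * w) * l (\<omega> (total X Z) Y)
      - sg (a * (c + w)) * l (\<omega> Z (total X Y))"
    by (intro functional_P l X Z VF)
  also have "\<dots> = - sg (c * b) * l (X (\<omega> Y Z)) + sg (a * w) * sg ((a + c) * b) * l (\<omega> Y (total X Z))
      + sg (a * (c + w)) * sg (c * (a + b)) * l (\<omega> (total X Y) Z)"
    using VF X l by (simp add: form_antisym[OF Z Y] form_antisym[OF nabla_hvf[OF X Z] Y]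
        form_antisym[OF Z nabla_hvf[OF X Y]] functional_simps)
  finally show ?thesis
    unfolding functional_P[OF l X Y VF(3)] by (cases a; cases b; cases c; cases w) simp_all
qed

lemma form_bracket:
  assumes l: "functional l" and X: "X \<in> HV a" and Y: "Y \<in> HV b" and Z: "Z \<in> VF"
  shows "l (\<omega> (bracket A a b X Y) Z) = l (\<omega> (total X Y) Z) - sg (a * b) * l (\<omega> (total Y X) Z)"
    "\<omega> (bracket A a b X Y) Z \<in> carrier A"
proof -
  note VF = hvf_vf[OF X] hvf_vf[OF Y] Z nabla_closed vf_signed_closed hvf_vf[OF bracket_hvf[OF X Y]]
  have "total X Y = vf_add A (vf_signed A (a * b) (total Y X)) (bracket A a b X Y)"
    using X Y vf_extensional[OF nabla_closed[OF VF(1,2)]] D_hvf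
    by (intro extensional_eqI) (simp_all add: total_hvf sym_torsion[OF X Y])
  then have "\<omega> (total X Y) Z = signed A (a * b) (\<omega> (total Y X) Z) \<oplus> \<omega> (bracket A a b X Y) Z"
    using VF by (simp add: form_add_left form_signed_left)
  then show "l (\<omega> (bracket A a b X Y) Z) = l (\<omega> (total X Y) Z) - sg (a * b) * l (\<omega> (total Y X) Z)"
    using VF l by (simp add: functional_simps)
  show "\<omega> (bracket A a b X Y) Z \<in> carrier A" using VF by simp
qed

text \<open>Symmetry of \<open>\<nabla>\<close> writes each bracket in \<open>d\<omega>\<close> as a difference of covariant derivatives, which
  turns \<open>d\<omega>(X, Y, Z)\<close> into the cyclic sum of \<open>\<nabla>\<omega>\<close>.\<close>

lemma P_cyclic:
  assumes l: "functional l" and X: "X \<in> HV a" and Y: "Y \<in> HV b" and Z: "Z \<in> HV c"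
  shows "sg (a * w) * l (P a b X Y Z) - sg (b * (w + a)) * l (P b a Y X Z)
    + sg (c * (w + a + b)) * l (P c a Z X Y) = 0"
proof -
  note VF = hvf_vf[OF X] hvf_vf[OF Y] hvf_vf[OF Z] nabla_closed
  have swap: "l (\<omega> V (total U W)) = - sg (v * (i + j)) * l (\<omega> (total U W) V)"
    if "V \<in> HV v" "U \<in> HV i" "W \<in> HV j" for U V W v i j
    using that l by (simp add: form_antisym[OF that(1) nabla_hvf[OF that(2,3)]] functional_simps)
  have "ext_deriv A w \<omega> a b c X Y Z = \<zero>"
    using closed X Y Z unfolding closed_two_form_def by blast
  then have "l (ext_deriv A w \<omega> a b c X Y Z) = 0"
    using l functional_zero[OF l] by (metis zero_closed)
  then have "sg (w * a) * l (X (\<omega> Y Z)) - sg (b * (w + a)) * l (Y (\<omega> X Z))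
      + sg (c * (w + a + b)) * l (Z (\<omega> X Y))
      - (l (\<omega> (total X Y) Z) - sg (a * b) * l (\<omega> (total Y X) Z))
      + sg (b * c) * (l (\<omega> (total X Z) Y) - sg (a * c) * l (\<omega> (total Z X) Y))
      - sg (a * (b + c)) * (l (\<omega> (total Y Z) X) - sg (b * c) * l (\<omega> (total Z Y) X)) = 0"
    using X Y Z VF l form_bracket(2)[OF l X Y VF(3)] form_bracket(2)[OF l X Z VF(2)] form_bracket(2)[OF l Y Z VF(1)]
    by (simp add: ext_deriv_def functional_simps form_bracket(1)[OF l X Y VF(3)] form_bracket(1)[OF l X Z VF(2)]
        form_bracket(1)[OF l Y Z VF(1)])
  then show ?thesis
    unfolding functional_P[OF l X Y VF(3)] functional_P[OF l Y X VF(3)] functional_P[OF l Z X VF(2)]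
      swap[OF Y X Z] swap[OF X Y Z] swap[OF X Z Y]
    by (cases a; cases b; cases c; cases w) simp_all
qed

text \<open>The prescribed value of \<open>\<omega>(D\<^sub>X Y, Z)\<close>. With a factor \<open>t\<close> in place of \<open>1/3\<close>, the term
  \<open>(\<nabla>\<^sub>X \<omega>)(Y, Z)\<close> occurs in \<open>(D\<^sub>X \<omega>)(Y, Z)\<close> with factor \<open>1 - 2 t\<close> and the two other terms of the
  cyclic sum with factor \<open>t\<close>; these agree for \<open>t = 1/3\<close>.\<close>

definition corrected_form :: "bit \<Rightarrow> bit \<Rightarrow> ('a \<Rightarrow> 'a) \<Rightarrow> ('a \<Rightarrow> 'a) \<Rightarrow> ('a \<Rightarrow> 'a) \<Rightarrow> 'a"
  where "corrected_form a b X Y Z = \<omega> (total X Y) Z \<oplus>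
    (1/3) \<odot> (signed A (a * w) (P a b X Y Z) \<oplus> signed A (a * b + b * w) (P b a Y X Z))"

lemma corrected_form_closed [simp]: "\<lbrakk>X \<in> HV a; Y \<in> HV b; Z \<in> VF\<rbrakk> \<Longrightarrow> corrected_form a b X Y Z \<in> carrier A"
  by (simp add: corrected_form_def)

lemma functional_corrected_form:
  assumes "functional l" "X \<in> HV a" "Y \<in> HV b" "Z \<in> VF"
  shows "l (corrected_form a b X Y Z) = l (\<omega> (total X Y) Z)
    + (sg (a * w) * l (P a b X Y Z) + sg (a * b + b * w) * l (P b a Y X Z)) / 3"
  using assms by (simp add: corrected_form_def functional_simps)

lemma corrected_form_scale_right:
  assumes X: "X \<in> HV a" and Y: "Y \<in> HV b" and f: "f \<in> grade A e" and Z: "Z \<in> HV c"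
  shows "corrected_form a b X Y (vf_scale A f Z) = signed A (e * (w + (a + b))) (f \<otimes> corrected_form a b X Y Z)"
proof (rule functionals_separate)
  fix l assume l: "functional l"
  show "l (corrected_form a b X Y (vf_scale A f Z)) = l (signed A (e * (w + (a + b))) (f \<otimes> corrected_form a b X Y Z))"
    using X Y Z f l by (simp add: corrected_form_def form_scale_right[OF f nabla_hvf[OF X Y]] P_scale_right[of _ _ _ _ f e Z c]
        distribs functional_simps vf_scale_closed, simp (no_asm) add: algebra_simps)
qed (use X Y Z f in \<open>simp_all add: vf_scale_closed\<close>)

lemma corrected_form_add_right:
  assumes "X \<in> HV a" "Y \<in> HV b" "Z \<in> VF" "Z' \<in> VF"
  shows "corrected_form a b X Y (vf_add A Z Z') = corrected_form a b X Y Z \<oplus> corrected_form a b X Y Z'"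
  using assms by (intro functionals_separate)
    (simp_all add: functional_corrected_form functional_simps form_add_right P_add_right vf_add_closed add_divide_distrib algebra_simps)

lemma corrected_form_one_form:
  assumes X: "X \<in> HV a" and Y: "Y \<in> HV b"
  shows "restrict (corrected_form a b X Y) VF \<in> hom_one_forms A (w + (a + b))"
proof -
  have grade: "corrected_form a b X Y Z \<in> grade A (w + (a + b) + c)" if Z: "Z \<in> HV c" for c Z
  proof -
    have "P b a Y X Z \<in> grade A (w + (a + b) + c)"
      using P_grade[OF Y X Z] by (simp add: add.commute)
    then show ?thesis
      unfolding corrected_form_def using P_grade[OF X Y Z] form_grade[OF nabla_hvf[OF X Y] Z]
      by (simp add: grade_add grade_smult grade_signed)
  qed
  have scale: "corrected_form a b X Y (vf_scale A f Z) = signed A (e * (w + (a + b))) (f \<otimes> corrected_form a b X Y Z)"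
    if f: "f \<in> grade A e" and Z: "Z \<in> VF" for e f Z
  proof -
    obtain Z0 Z1 where Z01: "Z0 \<in> HV 0" "Z1 \<in> HV 1" "Z = vf_add A Z0 Z1" using vf_decompose[OF Z] .
    have "vf_scale A f Z = vf_add A (vf_scale A f Z0) (vf_scale A f Z1)"
      using Z01 f by (intro extensional_eqI) (simp_all add: r_distr)
    then show ?thesis
      using X Y Z01 f corrected_form_scale_right[OF X Y f Z01(1)] corrected_form_scale_right[OF X Y f Z01(2)]
      by (simp add: corrected_form_add_right vf_scale_closed) (simp add: signed_eq_smult r_distr smult_add_right)
  qed
  show ?thesis
    unfolding hom_one_forms_def using X Y
    by (intro CollectI conjI restrict_PiE_iff[THEN iffD2] ballI allI)
      (simp_all add: grade scale corrected_form_add_right vf_scale_closed vf_add_closed)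
qed

definition corrected :: "bit \<Rightarrow> bit \<Rightarrow> ('a \<Rightarrow> 'a) \<Rightarrow> ('a \<Rightarrow> 'a) \<Rightarrow> ('a \<Rightarrow> 'a)"
  where "corrected a b X Y = (SOME V. V \<in> HV (a + b) \<and> (\<forall>Z\<in>VF. \<omega> V Z = corrected_form a b X Y Z))"

lemma corrected:
  assumes X: "X \<in> HV a" and Y: "Y \<in> HV b"
  shows "corrected a b X Y \<in> HV (a + b)" "Z \<in> VF \<Longrightarrow> \<omega> (corrected a b X Y) Z = corrected_form a b X Y Z"
proof -
  obtain V where "V \<in> HV (a + b)" "\<forall>Z\<in>VF. \<omega> V Z = restrict (corrected_form a b X Y) VF Z"
    using sharp_exists[OF corrected_form_one_form[OF X Y]] by blast
  then have "V \<in> HV (a + b) \<and> (\<forall>Z\<in>VF. \<omega> V Z = corrected_form a b X Y Z)" by simp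
  then have "corrected a b X Y \<in> HV (a + b) \<and> (\<forall>Z\<in>VF. \<omega> (corrected a b X Y) Z = corrected_form a b X Y Z)"
    unfolding corrected_def
    by (rule someI[where P = "\<lambda>V. V \<in> HV (a + b) \<and> (\<forall>Z\<in>VF. \<omega> V Z = corrected_form a b X Y Z)"])
  then show "corrected a b X Y \<in> HV (a + b)" "Z \<in> VF \<Longrightarrow> \<omega> (corrected a b X Y) Z = corrected_form a b X Y Z"
    by blast+
qed

lemma P_add_left:
  assumes "X \<in> HV a" "X' \<in> HV a" "Y \<in> HV b" "Z \<in> VF"
  shows "P a b (vf_add A X X') Y Z = P a b X Y Z \<oplus> P a b X' Y Z"
    "P b a Y (vf_add A X X') Z = P b a Y X Z \<oplus> P b a Y X' Z"
  using assms by (intro functionals_separate;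
    simp add: functional_P vf_add_hvf functional_simps form_add_right form_add_left nabla_add_left nabla_add_right algebra_simps)+

text \<open>The correction is graded symmetric in \<open>X\<close> and \<open>Y\<close>, so it does not change the torsion. All
  identities between fields are checked after pairing with \<open>Z\<close>.\<close>

lemma corrected_symmetric: "symmetric_graded_connection A corrected"
proof
  fix X Y a b assume X: "X \<in> HV a" and Y: "Y \<in> HV b"
  show "corrected a b X Y \<in> HV (a + b)" by (rule corrected(1)[OF X Y])
  have V: "corrected a b X Y \<in> VF" "corrected b a Y X \<in> VF"
    using corrected(1)[OF X Y] corrected(1)[OF Y X] hvf_vf by blast+
  fix f assume f: "f \<in> carrier A"
  have "corrected a b X Y = vf_add A (vf_signed A (a * b) (corrected b a Y X)) (bracket A a b X Y)"
  proof (rule form_left_eqI)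
    fix c Z assume "Z \<in> HV c"
    then have Z: "Z \<in> VF" by simp
    have "corrected_form a b X Y Z = signed A (a * b) (corrected_form b a Y X Z) \<oplus> \<omega> (bracket A a b X Y) Z"
    proof (rule functionals_separate)
      fix l assume l: "functional l"
      have "l (corrected_form a b X Y Z) = sg (a * b) * l (corrected_form b a Y X Z) + l (\<omega> (bracket A a b X Y) Z)"
        unfolding functional_corrected_form[OF l X Y Z] functional_corrected_form[OF l Y X Z] form_bracket(1)[OF l X Y Z]
        by (cases a; cases b; cases w) (simp_all add: field_simps)
      then show "l (corrected_form a b X Y Z) = l (signed A (a * b) (corrected_form b a Y X Z) \<oplus> \<omega> (bracket A a b X Y) Z)"
        using X Y Z l form_bracket(2)[OF l X Y Z] by (simp add: functional_simps)
    qed (use X Y Z hvf_vf[OF bracket_hvf[OF X Y]] in simp_all)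
    then show "\<omega> (corrected a b X Y) Z
        = \<omega> (vf_add A (vf_signed A (a * b) (corrected b a Y X)) (bracket A a b X Y)) Z"
      using V Z corrected(2)[OF X Y Z] corrected(2)[OF Y X Z] hvf_vf[OF bracket_hvf[OF X Y]]
      by (simp add: form_add_left form_signed_left vf_signed_closed)
  qed (use V hvf_vf[OF bracket_hvf[OF X Y]] in \<open>simp_all add: vf_add_closed vf_signed_closed\<close>)
  then have "corrected a b X Y f = vf_add A (vf_signed A (a * b) (corrected b a Y X)) (bracket A a b X Y) f"
    by (rule fun_cong)
  then show "corrected a b X Y f = signed A (a * b) (corrected b a Y X f)
      \<oplus> (X (Y f) \<ominus> signed A (a * b) (Y (X f)))"
    using f by simp
next
  fix X X' Y a b assume X: "X \<in> HV a" and X': "X' \<in> HV a" and Y: "Y \<in> HV b"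
  note sum = vf_add_hvf[OF X X']
  have V: "corrected a b X Y \<in> VF" "corrected a b X' Y \<in> VF" "corrected a b (vf_add A X X') Y \<in> VF"
    using corrected(1)[OF X Y] corrected(1)[OF X' Y] corrected(1)[OF sum Y] hvf_vf by blast+
  show "corrected a b (vf_add A X X') Y = vf_add A (corrected a b X Y) (corrected a b X' Y)"
  proof (rule form_left_eqI)
    fix c Z assume "Z \<in> HV c"
    then have Z: "Z \<in> VF" by simp
    have "corrected_form a b (vf_add A X X') Y Z = corrected_form a b X Y Z \<oplus> corrected_form a b X' Y Z"
      using X X' Y Z sum
      by (intro functionals_separate) (simp_all add: functional_corrected_form functional_simps
          nabla_add_left form_add_left P_add_left add_divide_distrib algebra_simps)
    then show "\<omega> (corrected a b (vf_add A X X') Y) Z = \<omega> (vf_add A (corrected a b X Y) (corrected a b X' Y)) Z"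
      using V Z corrected(2)[OF X Y Z] corrected(2)[OF X' Y Z] corrected(2)[OF sum Y Z]
      by (simp add: form_add_left)
  qed (use V in \<open>simp_all add: vf_add_closed\<close>)
next
  fix f e X a Y b assume f: "f \<in> grade A e" and X: "X \<in> HV a" and Y: "Y \<in> HV b"
  note fX = vf_scale_hvf[OF f X]
  have V: "corrected a b X Y \<in> VF" "corrected (e + a) b (vf_scale A f X) Y \<in> VF"
    using corrected(1)[OF X Y] corrected(1)[OF fX Y] hvf_vf by blast+
  show "corrected (e + a) b (vf_scale A f X) Y = vf_scale A f (corrected a b X Y)"
  proof (rule form_left_eqI)
    fix c Z assume Z': "Z \<in> HV c"
    then have Z: "Z \<in> VF" by simp
    have "corrected_form (e + a) b (vf_scale A f X) Y Z = signed A (e * w) (f \<otimes> corrected_form a b X Y Z)"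
    proof (rule functionals_separate)
      fix l assume l: "functional l"
      have "l (corrected_form (e + a) b (vf_scale A f X) Y Z) = sg (e * w) * l (f \<otimes> \<omega> (total X Y) Z)
          + (sg ((e + a) * w) * l (f \<otimes> P a b X Y Z)
            + sg ((e + a) * b + b * w) * (sg (e * (w + b)) * l (f \<otimes> P b a Y X Z))) / 3"
        using X Y Z f l by (simp add: functional_corrected_form[OF l fX Y Z] P_scale_left[OF X Y f Z']
            P_scale_middle[OF Y X f Z'] nabla_scale_left form_scale_left[OF f] functional_simps)
      also have "\<dots> = sg (e * w) * (l (f \<otimes> \<omega> (total X Y) Z)
          + (sg (a * w) * l (f \<otimes> P a b X Y Z) + sg (a * b + b * w) * l (f \<otimes> P b a Y X Z)) / 3)"
        by (cases a; cases b; cases e; cases w) (simp_all add: field_simps)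
      also have "\<dots> = l (signed A (e * w) (f \<otimes> corrected_form a b X Y Z))"
        using X Y Z f l by (simp add: corrected_form_def functional_simps distribs)
      finally show "l (corrected_form (e + a) b (vf_scale A f X) Y Z) = l (signed A (e * w) (f \<otimes> corrected_form a b X Y Z))" .
    qed (use X Y Z f fX in simp_all)
    then show "\<omega> (corrected (e + a) b (vf_scale A f X) Y) Z = \<omega> (vf_scale A f (corrected a b X Y)) Z"
      using V Z corrected(2)[OF X Y Z] corrected(2)[OF fX Y Z] by (simp add: form_scale_left[OF f])
  qed (use V f in \<open>simp_all add: vf_scale_closed\<close>)
qed

text \<open>Antisymmetry of \<open>\<omega>\<close> and of \<open>\<nabla>\<omega>\<close> reduces \<open>(D\<^sub>X \<omega>)(Y, Z)\<close> to one third of the cyclic sum of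
  \<open>\<nabla>\<omega>\<close>, which is zero because \<open>\<omega>\<close> is closed.\<close>

theorem symplectic_connection_exists: "\<exists>D. symplectic_connection A w \<omega> D"
proof -
  interpret C: symmetric_graded_connection A corrected by (rule corrected_symmetric)
  have "cov_deriv A C.total w \<omega> a b X Y Z = \<zero>"
    if X: "X \<in> HV a" and Y: "Y \<in> HV b" and Z: "Z \<in> HV c" for a b c X Y Z
  proof (rule functionals_separate)
    note VF = hvf_vf[OF X] hvf_vf[OF Y] hvf_vf[OF Z] nabla_closed
    have V: "C.total X Y \<in> VF" "C.total X Z \<in> VF" "C.total X Z \<in> HV (a + c)"
      using corrected(1)[OF X Y] corrected(1)[OF X Z] X Y Z hvf_vf by (auto simp: C.total_hvf)
    fix l assume l: "functional l"
    have "l (cov_deriv A C.total w \<omega> a b X Y Z) = l (X (\<omega> Y Z)) - sg (a * w) * l (\<omega> (C.total X Y) Z)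
        - sg (a * (b + w)) * l (\<omega> Y (C.total X Z))"
      using VF V l X by (simp add: cov_deriv_def functional_simps)
    also have "l (\<omega> Y (C.total X Z)) = - sg (b * (a + c)) * l (corrected_form a c X Z Y)"
      using l X Z VF(2) corrected(2)[OF X Z VF(2)] form_antisym[OF Y V(3)]
      by (simp add: functional_simps C.total_hvf[OF X Z])
    also have "l (\<omega> (C.total X Y) Z) = l (corrected_form a b X Y Z)"
      using corrected(2)[OF X Y VF(3)] by (simp add: C.total_hvf[OF X Y])
    finally have 1: "l (cov_deriv A C.total w \<omega> a b X Y Z) = l (X (\<omega> Y Z)) - sg (a * w) * l (corrected_form a b X Y Z)
        - sg (a * (b + w)) * (- sg (b * (a + c)) * l (corrected_form a c X Z Y))" .
    have 2: "l (\<omega> (total X Z) Y) = - sg ((a + c) * b) * l (\<omega> Y (total X Z))"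
      using VF l by (simp add: form_antisym[OF nabla_hvf[OF X Z] Y] functional_simps)
    have "l (cov_deriv A C.total w \<omega> a b X Y Z) = 0"
      unfolding 1 functional_corrected_form[OF l X Y VF(3)] functional_corrected_form[OF l X Z VF(2)] 2
      using P_antisym[OF l X Y Z] P_cyclic[OF l X Y Z] functional_P[OF l X Y VF(3)]
      by (cases a; cases b; cases c; cases w) (simp_all add: field_simps)
    then show "l (cov_deriv A C.total w \<omega> a b X Y Z) = l \<zero>" using functional_zero[OF l] by simp
  qed (use X Y Z corrected(1)[OF X Y] corrected(1)[OF X Z] hvf_vf in \<open>auto simp: cov_deriv_def C.total_hvf\<close>)
  then show ?thesis
    using C.total_is_connection C.total_symmetric unfolding symplectic_connection_def by blast
qed

end

section \<open>Smooth functions of several variables\<close>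

lemma topspace_Euclidean: "x \<in> topspace (Euclidean_space p) \<longleftrightarrow> (\<forall>i\<ge>p. x i = 0)"
  by (simp add: topspace_Euclidean_space)

lemma Euclidean_space_eq: "Euclidean_space p = top_of_set (topspace (Euclidean_space p))"
  by (simp add: Euclidean_space_def euclidean_product_topology topspace_Euclidean_space)

lemma continuous_map_Euclidean:
  assumes "V \<subseteq> topspace (Euclidean_space p)"
  shows "continuous_map (subtopology (Euclidean_space p) V) euclideanreal f \<longleftrightarrow> continuous_on V f"
  using assms by (subst Euclidean_space_eq) (simp add: subtopology_subtopology inf_absorb2)

lemma coordinate_line_continuous: "continuous_on UNIV (\<lambda>t::real. x(i := t))"
proof (rule continuous_on_coordinatewise_then_product)
  fix j show "continuous_on UNIV (\<lambda>t. (x(i := t)) j)"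
    by (cases "j = i") simp_all
qed

lemma open_coordinate_line:
  assumes V: "openin (Euclidean_space p) V" and i: "i < p" and x: "x \<in> V"
  shows "open {t. x(i := t) \<in> V}"
proof -
  obtain T where T: "open T" "V = topspace (Euclidean_space p) \<inter> T"
    using V by (subst (asm) Euclidean_space_eq) (auto simp: openin_open)
  have "x(i := t) \<in> topspace (Euclidean_space p)" for t
    using x i T by (auto simp: topspace_Euclidean)
  then have "{t. x(i := t) \<in> V} = (\<lambda>t. x(i := t)) -` T"
    using T by auto
  then show ?thesis
    using T(1) continuous_on_open_vimage[OF open_UNIV] coordinate_line_continuous by (metis inf_top_right)
qed

lemma eventually_coordinate_line:
  assumes "openin (Euclidean_space p) V" "i < p" "x \<in> V"
  shows "\<forall>\<^sub>F t in nhds (x i). x(i := t) \<in> V"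
  using open_coordinate_line[OF assms] assms(3) unfolding eventually_nhds
  by (intro exI[of _ "{t. x(i := t) \<in> V}"]) auto

locale open_domain =
  fixes p :: nat and V :: "(nat \<Rightarrow> real) set"
  assumes open_V: "openin (Euclidean_space p) V"
begin

lemma V_subset: "V \<subseteq> topspace (Euclidean_space p)"
  by (rule openin_subset[OF open_V])

lemma smooth_on_continuous: "smooth_on p V f \<Longrightarrow> continuous_on V f"
  unfolding smooth_on_def using continuous_map_Euclidean[OF V_subset] C_k_on.simps(1) by blast

lemma smooth_on_partial: "\<lbrakk>smooth_on p V f; i < p\<rbrakk> \<Longrightarrow> smooth_on p V (partial i f)"
  unfolding smooth_on_def using C_k_on.simps(2) by blast

lemma smooth_on_has_derivative:
  assumes "smooth_on p V f" "i < p" "x \<in> V"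
  shows "((\<lambda>t. f (x(i := t))) has_field_derivative partial i f x) (at (x i))"
proof -
  have "C_k_on p (Suc 0) V f" using assms(1) unfolding smooth_on_def by blast
  then have "(\<lambda>t. f (x(i := t))) field_differentiable at (x i)" using assms by simp
  then show ?thesis unfolding partial_def by (simp add: DERIV_deriv_iff_field_differentiable)
qed

lemma has_derivative_cong:
  assumes "\<And>x. x \<in> V \<Longrightarrow> f x = g x" "i < p" "x \<in> V"
  shows "((\<lambda>t. f (x(i := t))) has_field_derivative D) (at (x i))
    \<longleftrightarrow> ((\<lambda>t. g (x(i := t))) has_field_derivative D) (at (x i))"
  using eventually_coordinate_line[OF open_V assms(2,3)]
  by (intro DERIV_cong_ev) (auto elim!: eventually_mono simp: assms(1))

lemma partial_cong:
  assumes "\<And>x. x \<in> V \<Longrightarrow> f x = g x" "i < p" "x \<in> V"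
  shows "partial i f x = partial i g x"
  unfolding partial_def using eventually_coordinate_line[OF open_V assms(2,3)]
  by (intro deriv_cong_ev) (auto elim!: eventually_mono simp: assms(1))

text \<open>Smoothness is the largest property of continuous functions that passes to partial derivatives, so
  it suffices to exhibit a class of functions that is closed under differentiation.\<close>

lemma smooth_on_coinduct:
  assumes "P f"
    and cont: "\<And>f. P f \<Longrightarrow> continuous_on V f"
    and deriv: "\<And>f i. \<lbrakk>P f; i < p\<rbrakk> \<Longrightarrow> \<exists>g. P g \<and>
      (\<forall>x\<in>V. ((\<lambda>t. f (x(i := t))) has_field_derivative g x) (at (x i)))"
  shows "smooth_on p V f"
proof -
  have "C_k_on p k V f" if "P g" "\<forall>x\<in>V. f x = g x" for k f g
    using that
  proof (induction k arbitrary: f g)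
    case 0
    have "continuous_on V f \<longleftrightarrow> continuous_on V g"
      using 0(2) by (intro continuous_on_cong) auto
    then show ?case using cont[OF 0(1)] continuous_map_Euclidean[OF V_subset] by simp
  next
    case (Suc k)
    have "continuous_on V f \<longleftrightarrow> continuous_on V g"
      using Suc.prems(2) by (intro continuous_on_cong) auto
    then have "continuous_on V f" using cont[OF Suc.prems(1)] by simp
    moreover have "(\<forall>x\<in>V. (\<lambda>t. f (x(i := t))) field_differentiable at (x i)) \<and> C_k_on p k V (partial i f)"
      if i: "i < p" for i
    proof -
      obtain h where h: "P h" "\<forall>x\<in>V. ((\<lambda>t. g (x(i := t))) has_field_derivative h x) (at (x i))"
        using deriv[OF Suc.prems(1) i] by blast
      then have f: "\<forall>x\<in>V. ((\<lambda>t. f (x(i := t))) has_field_derivative h x) (at (x i))"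
        using has_derivative_cong[of f g i] Suc.prems(2) i by blast
      moreover have "\<forall>x\<in>V. partial i f x = h x"
        using f unfolding partial_def by (auto intro: DERIV_imp_deriv)
      ultimately show ?thesis
        using Suc.IH[OF h(1)] by (auto simp: field_differentiable_def)
    qed
    ultimately show ?case using continuous_map_Euclidean[OF V_subset] by simp
  qed
  then show ?thesis using assms(1) unfolding smooth_on_def by blast
qed

text \<open>These expressions are closed under partial derivatives, so by coinduction they are all smooth, and
  the closure properties of smooth functions come from a single induction. In the last rule,
  \<open>u n\<close> is the \<open>n\<close>-th derivative of a function of one variable.\<close>

inductive smooth_term :: "((nat \<Rightarrow> real) \<Rightarrow> real) \<Rightarrow> bool" where
  base: "smooth_on p V f \<Longrightarrow> smooth_term f"
| const: "smooth_term (\<lambda>x. c)"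
| coord: "smooth_term (\<lambda>x. x i)"
| add: "\<lbrakk>smooth_term f; smooth_term g\<rbrakk> \<Longrightarrow> smooth_term (\<lambda>x. f x + g x)"
| mult: "\<lbrakk>smooth_term f; smooth_term g\<rbrakk> \<Longrightarrow> smooth_term (\<lambda>x. f x * g x)"
| inverse: "\<lbrakk>smooth_term f; \<forall>x\<in>V. f x \<noteq> 0\<rbrakk> \<Longrightarrow> smooth_term (\<lambda>x. inverse (f x))"
| comp: "\<lbrakk>smooth_term f; \<forall>n t. (u n has_field_derivative u (Suc n) t) (at t)\<rbrakk> \<Longrightarrow>
    smooth_term (\<lambda>x. u n (f x))"

lemma smooth_term_continuous: "smooth_term f \<Longrightarrow> continuous_on V f"
proof (induction rule: smooth_term.induct)
  case (comp f u n)
  then have "continuous_on UNIV (u n)"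
    by (intro continuous_at_imp_continuous_on ballI) (auto intro: DERIV_isCont)
  then show ?case using comp continuous_on_compose2[of UNIV "u n" V f] by auto
next
  case (base f)
  then show ?case by (rule smooth_on_continuous)
next
  case (coord i)
  show ?case by (rule continuous_on_subset[OF continuous_on_product_coordinates]) simp
qed (auto intro!: continuous_intros)

lemma smooth_term_derivative:
  assumes "smooth_term f" "i < p"
  shows "\<exists>g. smooth_term g \<and> (\<forall>x\<in>V. ((\<lambda>t. f (x(i := t))) has_field_derivative g x) (at (x i)))"
  using assms(1)
proof (induction rule: smooth_term.induct)
  case (base f)
  then show ?case
    using smooth_on_partial[OF base assms(2)] smooth_on_has_derivative[OF base assms(2)] smooth_term.base by blast
next
  case (const c)
  then show ?case by (intro exI[of _ "\<lambda>x. 0"]) (auto intro: smooth_term.const)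
next
  case (coord j)
  show ?case
  proof (intro exI[of _ "\<lambda>x. if j = i then 1 else 0"] conjI ballI)
    show "smooth_term (\<lambda>x. if j = i then 1 else 0)" by (rule smooth_term.const)
  qed auto
next
  case (add f g)
  then obtain f' g' where *: "smooth_term f'" "smooth_term g'"
    "\<forall>x\<in>V. ((\<lambda>t. f (x(i := t))) has_field_derivative f' x) (at (x i))"
    "\<forall>x\<in>V. ((\<lambda>t. g (x(i := t))) has_field_derivative g' x) (at (x i))" by blast
  show ?case
  proof (intro exI[of _ "\<lambda>x. f' x + g' x"] conjI ballI)
    fix x assume "x \<in> V"
    then show "((\<lambda>t. f (x(i := t)) + g (x(i := t))) has_field_derivative f' x + g' x) (at (x i))"
      using * by (intro DERIV_add) blast+
  qed (intro smooth_term.add *)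
next
  case (mult f g)
  then obtain f' g' where *: "smooth_term f'" "smooth_term g'"
    "\<forall>x\<in>V. ((\<lambda>t. f (x(i := t))) has_field_derivative f' x) (at (x i))"
    "\<forall>x\<in>V. ((\<lambda>t. g (x(i := t))) has_field_derivative g' x) (at (x i))" by blast
  show ?case
  proof (intro exI[of _ "\<lambda>x. f' x * g x + g' x * f x"] conjI ballI)
    fix x assume "x \<in> V"
    then show "((\<lambda>t. f (x(i := t)) * g (x(i := t))) has_field_derivative f' x * g x + g' x * f x) (at (x i))"
      using DERIV_mult[of "\<lambda>t. f (x(i := t))" "f' x" "x i" UNIV "\<lambda>t. g (x(i := t))" "g' x"] * by simp
  qed (auto intro!: smooth_term.add smooth_term.mult * mult.hyps)
next
  case (inverse f)
  then obtain f' where *: "smooth_term f'"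
    "\<forall>x\<in>V. ((\<lambda>t. f (x(i := t))) has_field_derivative f' x) (at (x i))" by blast
  show ?case
  proof (intro exI[of _ "\<lambda>x. (- 1) * (inverse (f x) * (f' x * inverse (f x)))"] conjI ballI)
    fix x assume x: "x \<in> V"
    then show "((\<lambda>t. inverse (f (x(i := t)))) has_field_derivative
        (- 1) * (inverse (f x) * (f' x * inverse (f x)))) (at (x i))"
      using DERIV_inverse'[of "\<lambda>t. f (x(i := t))" "f' x" "x i" UNIV] * inverse.hyps by (simp add: mult.assoc)
  qed (intro smooth_term.const smooth_term.mult smooth_term.inverse * inverse.hyps)
next
  case (comp f u n)
  then obtain f' where *: "smooth_term f'"
    "\<forall>x\<in>V. ((\<lambda>t. f (x(i := t))) has_field_derivative f' x) (at (x i))" by blast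
  show ?case
  proof (intro exI[of _ "\<lambda>x. u (Suc n) (f x) * f' x"] conjI ballI)
    fix x assume x: "x \<in> V"
    show "((\<lambda>t. u n (f (x(i := t)))) has_field_derivative u (Suc n) (f x) * f' x) (at (x i))"
      using DERIV_chain2[of "u n" "u (Suc n) (f x)" "\<lambda>t. f (x(i := t))" "x i" "f' x" UNIV] comp x * by simp
  qed (rule smooth_term.mult[OF smooth_term.comp[OF comp.hyps] *(1)])
qed

lemma smooth_on_eq_smooth_term: "smooth_on p V f \<longleftrightarrow> smooth_term f"
  using smooth_on_coinduct[of smooth_term f] smooth_term_continuous smooth_term_derivative smooth_term.base
  by blast

lemmas smooth_intros = smooth_term.const[folded smooth_on_eq_smooth_term]
  smooth_term.coord[folded smooth_on_eq_smooth_term] smooth_term.add[folded smooth_on_eq_smooth_term]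
  smooth_term.mult[folded smooth_on_eq_smooth_term]

lemmas smooth_on_inverse = smooth_term.inverse[folded smooth_on_eq_smooth_term]
lemmas smooth_on_comp = smooth_term.comp[folded smooth_on_eq_smooth_term]

lemma smooth_on_cong:
  assumes "smooth_on p V f" "\<And>x. x \<in> V \<Longrightarrow> f x = g x" shows "smooth_on p V g"
proof (rule smooth_on_coinduct[of "\<lambda>g. \<exists>f. smooth_on p V f \<and> (\<forall>x\<in>V. f x = g x)"])
  show "\<exists>f. smooth_on p V f \<and> (\<forall>x\<in>V. f x = g x)" using assms by blast
next
  fix g assume "\<exists>f. smooth_on p V f \<and> (\<forall>x\<in>V. f x = g x)"
  then obtain f where f: "smooth_on p V f" "\<forall>x\<in>V. f x = g x" by blast
  then show "continuous_on V g"
    using smooth_on_continuous[OF f(1)] continuous_on_cong[of V V f g] by simp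
  fix i assume i: "i < p"
  show "\<exists>h. (\<exists>f. smooth_on p V f \<and> (\<forall>x\<in>V. f x = h x)) \<and>
      (\<forall>x\<in>V. ((\<lambda>t. g (x(i := t))) has_field_derivative h x) (at (x i)))"
    using smooth_on_partial[OF f(1) i] smooth_on_has_derivative[OF f(1) i] has_derivative_cong[of f g i] f(2) i
    by (intro exI[of _ "partial i f"]) auto
qed

lemma smooth_on_prod: "finite S \<Longrightarrow> (\<And>j. j \<in> S \<Longrightarrow> smooth_on p V (f j)) \<Longrightarrow> smooth_on p V (\<lambda>x. \<Prod>j\<in>S. f j x)"
  by (induction S rule: finite_induct) (auto intro: smooth_intros)

end

section \<open>Bump functions\<close>

text \<open>The \<open>n\<close>-th derivative of \<open>exp (- 1 / t)\<close> for \<open>t > 0\<close> is \<open>flat_poly n\<close>, evaluated at \<open>1 / t\<close>,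
  times \<open>exp (- 1 / t)\<close>.\<close>

primrec flat_poly :: "nat \<Rightarrow> real poly" where
  "flat_poly 0 = 1"
| "flat_poly (Suc n) = [:0, 0, 1:] * (flat_poly n - pderiv (flat_poly n))"

definition flat :: "nat \<Rightarrow> real \<Rightarrow> real"
  where "flat n t = (if t > 0 then poly (flat_poly n) (1 / t) * exp (- (1 / t)) else 0)"

lemma poly_exp_tendsto_0: "((\<lambda>u::real. u ^ k * poly Q u * exp (- u)) \<longlongrightarrow> 0) at_top"
proof (induction Q arbitrary: k rule: pCons_induct)
  case 0
  then show ?case by simp
next
  case (pCons a Q)
  have "((\<lambda>u::real. a * (u ^ k / exp u) + u ^ Suc k * poly Q u * exp (- u)) \<longlongrightarrow> a * 0 + 0) at_top"
    by (intro tendsto_intros tendsto_power_div_exp_0 pCons)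
  then show ?case by (simp add: algebra_simps exp_minus divide_inverse)
qed

lemma flat_has_derivative: "(flat n has_field_derivative flat (Suc n) t) (at t)"
proof -
  consider "t > 0" | "t < 0" | "t = 0" by linarith
  then show ?thesis
  proof cases
    case 1
    have "((\<lambda>t. poly (flat_poly n) (1 / t) * exp (- (1 / t))) has_field_derivative flat (Suc n) t) (at t)"
      using 1 by (auto intro!: derivative_eq_intros poly_DERIV[THEN DERIV_chain2] simp: flat_def field_simps power2_eq_square)
    moreover have "\<forall>\<^sub>F s in nhds t. flat n s = poly (flat_poly n) (1 / s) * exp (- (1 / s))"
      using eventually_nhds_in_open[of "{0<..}" t] 1 by (auto elim!: eventually_mono simp: flat_def)
    ultimately show ?thesis by (simp add: DERIV_cong_ev)
  next
    case 2
    have "\<forall>\<^sub>F s in nhds t. flat n s = 0"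
      using eventually_nhds_in_open[of "{..<0}" t] 2 by (auto elim!: eventually_mono simp: flat_def)
    then have "(flat n has_field_derivative 0) (at t) \<longleftrightarrow> ((\<lambda>s. 0) has_field_derivative 0) (at t)"
      by (intro DERIV_cong_ev) auto
    then show ?thesis using 2 by (simp add: flat_def)
  next
    case 3
    have "((\<lambda>u. flat n (inverse u) / inverse u) \<longlongrightarrow> 0) at_top"
    proof (rule Lim_transform_eventually[OF poly_exp_tendsto_0[of 1 "flat_poly n"]])
      show "\<forall>\<^sub>F u in at_top. u ^ 1 * poly (flat_poly n) u * exp (- u) = flat n (inverse u) / inverse u"
        using eventually_gt_at_top[of 0] by eventually_elim (simp add: flat_def field_simps)
    qed
    then have "((\<lambda>h. flat n h / h) \<longlongrightarrow> 0) (at_right 0)"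
      by (simp add: filterlim_at_right_to_top)
    moreover have "((\<lambda>h. flat n h / h) \<longlongrightarrow> 0) (at_left 0)"
      by (rule tendsto_eventually) (auto simp: eventually_at_filter flat_def)
    ultimately have "((\<lambda>h. flat n h / h) \<longlongrightarrow> 0) (at 0)"
      by (rule filterlim_split_at[rotated])
    then show ?thesis using 3 by (simp add: DERIV_def flat_def)
  qed
qed

lemma flat_pos: "t > 0 \<Longrightarrow> flat 0 t > 0" and flat_zero: "t \<le> 0 \<Longrightarrow> flat 0 t = 0"
  by (simp_all add: flat_def)

text \<open>The function has the form \<open>N / (N + R)\<close>, where \<open>N\<close> is positive exactly for \<open>\<bar>u\<bar> < t\<close> and \<open>R\<close>
  exactly for \<open>\<bar>u\<bar> > s\<close>.\<close>

definition plateau :: "real \<Rightarrow> real \<Rightarrow> real \<Rightarrow> real"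
  where "plateau s t u = (flat 0 (t - u) * flat 0 (t + u)) *
    inverse (flat 0 (t - u) * flat 0 (t + u) + (flat 0 (u - s) + flat 0 (- u - s)))"

lemma plateau_denominator:
  assumes "0 < s" "s < t"
  shows "flat 0 (t - u) * flat 0 (t + u) + (flat 0 (u - s) + flat 0 (- u - s)) > 0"
proof -
  have nonneg: "flat 0 v \<ge> 0" for v by (simp add: flat_def)
  consider "u > s" | "u < - s" | "\<bar>u\<bar> < t" using assms by linarith
  then show ?thesis
  proof cases
    case 1 then show ?thesis using flat_pos[of "u - s"] nonneg by (intro add_nonneg_pos add_pos_nonneg) auto
  next
    case 2 then show ?thesis using flat_pos[of "- u - s"] nonneg by (intro add_nonneg_pos) auto
  next
    case 3 then show ?thesis using flat_pos[of "t - u"] flat_pos[of "t + u"] nonneg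
      by (intro add_pos_nonneg mult_pos_pos add_nonneg_nonneg) auto
  qed
qed

lemma plateau_one: "\<lbrakk>0 < s; s < t; \<bar>u\<bar> \<le> s\<rbrakk> \<Longrightarrow> plateau s t u = 1"
proof -
  assume st: "0 < s" "s < t" "\<bar>u\<bar> \<le> s"
  let ?N = "flat 0 (t - u) * flat 0 (t + u)"
  have z: "flat 0 (u - s) = 0" "flat 0 (- u - s) = 0" using st by (auto intro!: flat_zero)
  have "?N > 0" using plateau_denominator[OF st(1,2), of u] unfolding z by simp
  then have "?N * inverse ?N = 1" by (intro right_inverse) linarith
  then show "plateau s t u = 1" unfolding plateau_def z by (simp only: add_0_right)
qed

lemma plateau_zero: "\<bar>u\<bar> \<ge> t \<Longrightarrow> plateau s t u = 0"
  by (cases "u \<ge> 0") (auto simp: plateau_def flat_zero)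

definition bump :: "nat \<Rightarrow> (nat \<Rightarrow> real) \<Rightarrow> real \<Rightarrow> real \<Rightarrow> (nat \<Rightarrow> real) \<Rightarrow> real"
  where "bump p c s t x = (\<Prod>i<p. plateau s t (x i - c i))"

lemma bump_one: "\<lbrakk>0 < s; s < t; \<And>i. i < p \<Longrightarrow> \<bar>x i - c i\<bar> \<le> s\<rbrakk> \<Longrightarrow> bump p c s t x = 1"
  by (simp add: bump_def plateau_one)

lemma bump_zero: "\<lbrakk>i < p; \<bar>x i - c i\<bar> \<ge> t\<rbrakk> \<Longrightarrow> bump p c s t x = 0"
  unfolding bump_def by (intro prod_zero) (auto intro!: bexI[of _ i] plateau_zero)

context open_domain
begin

lemma smooth_on_flat: "smooth_on p V f \<Longrightarrow> smooth_on p V (\<lambda>x. flat 0 (f x))"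
  by (rule smooth_on_comp[where u = flat]) (auto intro: flat_has_derivative)

lemma smooth_on_bump:
  assumes "0 < s" "s < t" shows "smooth_on p V (bump p c s t)"
proof -
  have affine: "smooth_on p V (\<lambda>x. a * x i + b)" for a b i
    by (intro smooth_intros)
  have shifts: "smooth_on p V (\<lambda>x. t - (x i - c i))" "smooth_on p V (\<lambda>x. t + (x i - c i))"
      "smooth_on p V (\<lambda>x. x i - c i - s)" "smooth_on p V (\<lambda>x. - (x i - c i) - s)" for i
    using affine[of "-1" i "t + c i"] affine[of 1 i "t - c i"] affine[of 1 i "- c i - s"]
      affine[of "-1" i "c i - s"] by (simp_all add: algebra_simps)
  have nonzero: "flat 0 (t - u) * flat 0 (t + u) + (flat 0 (u - s) + flat 0 (- u - s)) \<noteq> 0" for u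
    using plateau_denominator[OF assms, of u] by linarith
  have "smooth_on p V (\<lambda>x. plateau s t (x i - c i))" for i
    unfolding plateau_def
    by (intro smooth_intros(4) smooth_on_inverse smooth_intros(3) smooth_on_flat shifts ballI nonzero)
  then show ?thesis
    unfolding bump_def[abs_def] by (intro smooth_on_prod) auto
qed

end

section \<open>Hadamard's lemma\<close>

definition cube :: "nat \<Rightarrow> (nat \<Rightarrow> real) \<Rightarrow> real \<Rightarrow> (nat \<Rightarrow> real) set"
  where "cube p c r = {x \<in> topspace (Euclidean_space p). \<forall>i<p. \<bar>x i - c i\<bar> < r}"

lemma openin_cube: "openin (Euclidean_space p) (cube p c r)"
proof -
  have "open (\<Inter>i\<in>{..<p}. {x::nat \<Rightarrow> real. \<bar>x i - c i\<bar> < r})"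
    by (intro open_INT ballI open_Collect_less continuous_intros continuous_on_product_coordinates finite_lessThan)
  moreover have "cube p c r = topspace (Euclidean_space p) \<inter> (\<Inter>i\<in>{..<p}. {x. \<bar>x i - c i\<bar> < r})"
    by (auto simp: cube_def)
  ultimately show ?thesis
    by (subst Euclidean_space_eq) (auto simp: openin_open)
qed

locale cube_domain =
  fixes p :: nat and c :: "nat \<Rightarrow> real" and r :: real

sublocale cube_domain \<subseteq> open_domain p "cube p c r"
  by unfold_locales (rule openin_cube)

context cube_domain
begin

text \<open>For \<open>t\<close> from 0 to 1, the path runs parallel to the \<open>k\<close>-th axis; together these segments lead
  from \<open>y\<close> to \<open>x\<close>.\<close>

definition path :: "(nat \<Rightarrow> real) \<Rightarrow> nat \<Rightarrow> (nat \<Rightarrow> real) \<Rightarrow> real \<Rightarrow> (nat \<Rightarrow> real)"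
  where "path y k x t = (\<lambda>i. if i < k then y i else if i = k then y k + t * (x k - y k) else x i)"

lemma convex_coordinate:
  fixes t x y d :: real
  assumes "\<bar>x - d\<bar> < r" "\<bar>y - d\<bar> < r" "0 \<le> t" "t \<le> 1" shows "\<bar>y + t * (x - y) - d\<bar> < r"
proof -
  have "y + t * (x - y) - d = (1 - t) * (y - d) + t * (x - d)" by (simp add: algebra_simps)
  also have "\<bar>\<dots>\<bar> \<le> (1 - t) * \<bar>y - d\<bar> + t * \<bar>x - d\<bar>"
    using assms(3,4) abs_triangle_ineq[of "(1 - t) * (y - d)" "t * (x - d)"] by (simp add: abs_mult)
  also have "\<dots> < r"
    using assms convex_bound_lt[of "\<bar>y - d\<bar>" r "\<bar>x - d\<bar>" "1 - t" t] by simp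
  finally show ?thesis .
qed

lemma path_in_cube:
  assumes "x \<in> cube p c r" "y \<in> cube p c r" "0 \<le> t" "t \<le> 1"
  shows "path y k x t \<in> cube p c r"
  using assms by (auto simp: cube_def path_def topspace_Euclidean intro: convex_coordinate)

lemma path_continuous: "continuous_on UNIV (\<lambda>(x, t). path y k x t)"
  unfolding split_beta
proof (rule continuous_on_coordinatewise_then_product)
  fix i
  have coord: "continuous_on UNIV (\<lambda>z::(nat \<Rightarrow> real) \<times> real. fst z j)" for j
    by (rule continuous_on_product_then_coordinatewise[OF continuous_on_fst[OF continuous_on_id]])
  consider "i < k" | "i = k" | "i > k" by linarith
  then show "continuous_on UNIV (\<lambda>z. path y k (fst z) (snd z) i)"
    by cases (auto simp: path_def intro!: continuous_intros coord)
qed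

text \<open>The power of \<open>t\<close> makes this class of functions closed under differentiation: the derivative in
  the \<open>k\<close>-th variable produces a factor \<open>t\<close>.\<close>

definition path_mean :: "nat \<Rightarrow> ((nat \<Rightarrow> real) \<Rightarrow> real) \<Rightarrow> (nat \<Rightarrow> real) \<Rightarrow> nat \<Rightarrow> (nat \<Rightarrow> real) \<Rightarrow> real"
  where "path_mean m f y k x = integral (cbox 0 1) (\<lambda>t. t ^ m * f (path y k x t))"

lemma path_integrand_continuous:
  assumes "smooth_on p (cube p c r) f" "y \<in> cube p c r"
  shows "continuous_on (cube p c r \<times> cbox 0 1) (\<lambda>(x, t). t ^ m * f (path y k x t))"
proof -
  have "continuous_on (cube p c r \<times> cbox 0 1) (\<lambda>z. f ((\<lambda>(x, t). path y k x t) z))"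
    using path_in_cube[OF _ assms(2)]
    by (intro continuous_on_compose2[OF smooth_on_continuous[OF assms(1)]]
        continuous_on_subset[OF path_continuous]) auto
  then show ?thesis
    unfolding split_beta by (intro continuous_intros) (auto simp: split_beta)
qed

lemma coordinate_update_in_cube:
  "\<lbrakk>x \<in> cube p c r; i < p; \<bar>s - c i\<bar> < r\<rbrakk> \<Longrightarrow> x(i := s) \<in> cube p c r"
  by (auto simp: cube_def topspace_Euclidean)

lemma path_mean_derivative:
  assumes f: "smooth_on p (cube p c r) f" and y: "y \<in> cube p c r" and i: "i < p" and x: "x \<in> cube p c r"
    and k: "k \<le> i"
  shows "((\<lambda>s. path_mean m f y k (x(i := s))) has_field_derivative
    path_mean (if i = k then Suc m else m) (partial i f) y k x) (at (x i))"
proof -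
  define m' where "m' = (if i = k then Suc m else m)"
  define U where "U = {s. \<bar>s - c i\<bar> < r}"
  have U: "open U" "convex U" "x i \<in> U"
  proof -
    have "U = ball (c i) r" by (auto simp: U_def dist_real_def)
    then show "open U" "convex U" by simp_all
    show "x i \<in> U" using x i by (simp add: U_def cube_def)
  qed
  have cont_upd: "continuous_on (U \<times> cbox 0 1) (\<lambda>z. (x(i := fst z), snd z :: real))"
    by (intro continuous_on_Pair continuous_on_compose2[OF coordinate_line_continuous[of x i]] continuous_intros) auto
  have cont: "continuous_on (U \<times> cbox 0 1) (\<lambda>z. (\<lambda>(x, t). t ^ m * g (path y k x t)) (x(i := fst z), snd z))"
    if "smooth_on p (cube p c r) g" for g m
    using x i by (intro continuous_on_compose2[OF path_integrand_continuous[OF that y] cont_upd])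
      (auto simp: U_def intro: coordinate_update_in_cube)
  have "((\<lambda>s. integral (cbox 0 1) (\<lambda>t. t ^ m * f (path y k (x(i := s)) t))) has_field_derivative
      integral (cbox 0 1) (\<lambda>t. t ^ m' * partial i f (path y k (x(i := x i)) t))) (at (x i) within U)"
  proof (rule leibniz_rule_field_derivative[OF _ _ _ U(3,2)])
    show "continuous_on (U \<times> cbox 0 1) (\<lambda>(s, t). t ^ m' * partial i f (path y k (x(i := s)) t))"
      using cont[OF smooth_on_partial[OF f i], of m'] by (simp add: split_beta)
  next
    fix s assume s: "s \<in> U"
    have xs: "x(i := s) \<in> cube p c r"
      using x i s by (auto simp: U_def intro: coordinate_update_in_cube)
    have "continuous_on (cbox 0 1) (\<lambda>t. (\<lambda>(x, t). t ^ m * f (path y k x t)) (x(i := s), t))"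
      using xs by (intro continuous_on_compose2[OF path_integrand_continuous[OF f y]] continuous_intros) auto
    then show "(\<lambda>t. t ^ m * f (path y k (x(i := s)) t)) integrable_on cbox 0 1"
      by (intro integrable_continuous) simp
    fix t :: real assume t: "t \<in> cbox 0 1"
    define a where "a = (if i = k then t else 1)"
    define b where "b = (if i = k then y k - t * y k else 0)"
    define z where "z = path y k (x(i := s)) t"
    have z: "z \<in> cube p c r" unfolding z_def using path_in_cube[OF xs y] t by auto
    have upd: "path y k (x(i := s')) t = z(i := b + a * s')" for s'
      using k by (auto simp: z_def path_def a_def b_def fun_eq_iff algebra_simps)
    have zi: "z i = b + a * s" using k by (auto simp: z_def path_def a_def b_def algebra_simps)
    have "((\<lambda>v. f (z(i := v))) has_field_derivative partial i f z) (at (b + a * s))"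
      using smooth_on_has_derivative[OF f i z] zi by simp
    moreover have "((\<lambda>s'. b + a * s') has_field_derivative a) (at s)"
      by (auto intro!: derivative_eq_intros)
    ultimately have "((\<lambda>s'. f (z(i := b + a * s'))) has_field_derivative partial i f z * a) (at s)"
      by (rule DERIV_chain2)
    then have "((\<lambda>s'. t ^ m * f (path y k (x(i := s')) t)) has_field_derivative t ^ m * (partial i f z * a)) (at s)"
      unfolding upd by (rule DERIV_cmult)
    moreover have "t ^ m * (partial i f z * a) = t ^ m' * partial i f (path y k (x(i := s)) t)"
      by (simp add: a_def m'_def z_def)
    ultimately show "((\<lambda>s'. t ^ m * f (path y k (x(i := s')) t)) has_field_derivative
        t ^ m' * partial i f (path y k (x(i := s)) t)) (at s within U)"
      by (simp add: has_field_derivative_at_within)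
  qed
  then show ?thesis
    using at_within_open[OF U(3,1)] by (simp add: path_mean_def m'_def)
qed

lemma path_mean_smooth:
  assumes y: "y \<in> cube p c r" and f: "smooth_on p (cube p c r) f"
  shows "smooth_on p (cube p c r) (path_mean m f y k)"
proof (rule smooth_on_coinduct[of "\<lambda>h. \<exists>m f. smooth_on p (cube p c r) f \<and> h = path_mean m f y k"])
  show "\<exists>m' f'. smooth_on p (cube p c r) f' \<and> path_mean m f y k = path_mean m' f' y k"
    using f by blast
next
  fix h assume "\<exists>m f. smooth_on p (cube p c r) f \<and> h = path_mean m f y k"
  then obtain m f where f: "smooth_on p (cube p c r) f" and h: "h = path_mean m f y k" by blast
  show "continuous_on (cube p c r) h"
    unfolding h path_mean_def[abs_def] by (intro integral_continuous_on_param path_integrand_continuous f y)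
  fix i assume i: "i < p"
  show "\<exists>g. (\<exists>m f. smooth_on p (cube p c r) f \<and> g = path_mean m f y k) \<and>
      (\<forall>x\<in>cube p c r. ((\<lambda>t. h (x(i := t))) has_field_derivative g x) (at (x i)))"
  proof (cases "k \<le> i")
    case True
    then show ?thesis
      unfolding h using path_mean_derivative[OF f y i] smooth_on_partial[OF f i] by blast
  next
    case False
    then have "path y k (x(i := t)) s = path y k x s" for x t s
      by (auto simp: path_def fun_eq_iff)
    then have "path_mean m f y k (x(i := t)) = path_mean m f y k x" for x t
      by (simp add: path_mean_def)
    then have "\<forall>x\<in>cube p c r. ((\<lambda>t. h (x(i := t))) has_field_derivative path_mean 0 (\<lambda>x. 0) y k x) (at (x i))"
      unfolding h by (simp add: path_mean_def)
    moreover have "smooth_on p (cube p c r) (\<lambda>x. 0)" by (rule smooth_intros)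
    ultimately show ?thesis by blast
  qed
qed

text \<open>The difference \<open>f x - f y\<close> telescopes into increments along segments parallel to the axes, and
  each increment is the integral of a partial derivative.\<close>

lemma hadamard:
  assumes f: "smooth_on p (cube p c r) f" and y: "y \<in> cube p c r"
  shows "\<exists>h. (\<forall>k<p. smooth_on p (cube p c r) (h k)) \<and>
    (\<forall>x\<in>cube p c r. f x = f y + (\<Sum>k<p. (x k - y k) * h k x))"
proof (intro exI[of _ "\<lambda>k. path_mean 0 (partial k f) y k"] conjI allI impI ballI)
  fix k assume "k < p"
  then show "smooth_on p (cube p c r) (path_mean 0 (partial k f) y k)"
    by (intro path_mean_smooth y smooth_on_partial f)
next
  fix x assume x: "x \<in> cube p c r"
  have step: "f (path y k x 1) - f (path y k x 0) = (x k - y k) * path_mean 0 (partial k f) y k x"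
    if k: "k < p" for k
  proof -
    define z where "z = path y k x 0"
    have upd: "path y k x t = z(k := y k + t * (x k - y k))" for t
      by (auto simp: z_def path_def)
    have "((\<lambda>t. (x k - y k) * (t ^ 0 * partial k f (path y k x t))) has_integral
        f (path y k x 1) - f (path y k x 0)) {0..1}"
    proof (rule fundamental_theorem_of_calculus)
      fix t :: real assume t: "t \<in> {0..1}"
      have "path y k x t \<in> cube p c r" using path_in_cube[OF x y] t by auto
      then have "((\<lambda>v. f (z(k := v))) has_field_derivative partial k f (path y k x t)) (at (y k + t * (x k - y k)))"
        using smooth_on_has_derivative[OF f k, of "path y k x t"] by (simp add: upd)
      moreover have "((\<lambda>t. y k + t * (x k - y k)) has_field_derivative x k - y k) (at t)"
        by (auto intro!: derivative_eq_intros)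
      ultimately have "((\<lambda>t. f (z(k := y k + t * (x k - y k)))) has_field_derivative
          partial k f (path y k x t) * (x k - y k)) (at t)"
        by (rule DERIV_chain2)
      then show "((\<lambda>t. f (path y k x t)) has_vector_derivative
          (x k - y k) * (t ^ 0 * partial k f (path y k x t))) (at t within {0..1})"
        unfolding upd[symmetric] by (simp add: has_real_derivative_iff_has_vector_derivative mult.commute has_vector_derivative_at_within)
    qed simp
    then have "integral {0..1} (\<lambda>t. (x k - y k) * (t ^ 0 * partial k f (path y k x t)))
        = f (path y k x 1) - f (path y k x 0)"
      by (rule integral_unique)
    then show ?thesis by (simp add: path_mean_def)
  qed
  have shift: "path y k x 0 = path y (Suc k) x 1" for k
    by (auto simp: path_def fun_eq_iff less_Suc_eq)
  have telescope: "f (path y 0 x 1) - f (path y n x 1) = (\<Sum>k<n. (x k - y k) * path_mean 0 (partial k f) y k x)"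
    if "n \<le> p" for n
    using that
  proof (induction n)
    case (Suc n)
    then show ?case using step[of n] by (simp add: shift)
  qed simp
  have "path y 0 x 1 = x" by (auto simp: path_def)
  moreover have "path y p x 1 = y"
    using x y by (auto simp: path_def cube_def topspace_Euclidean fun_eq_iff)
  ultimately show "f x = f y + (\<Sum>k<p. (x k - y k) * path_mean 0 (partial k f) y k x)"
    using telescope[of p] by simp
qed

end

section \<open>Grassmann signs\<close>

lemma gs_empty [simp]: "grassmann_sign {} J = 1" "grassmann_sign I {} = 1"
  by (simp_all add: grassmann_sign_def)

lemma gs_square [simp]: "grassmann_sign I J * grassmann_sign I J = 1"
  "grassmann_sign I J * (grassmann_sign I J * x) = x"
proof -
  show *: "grassmann_sign I J * grassmann_sign I J = 1"
    unfolding grassmann_sign_def by (simp flip: power_add power_mult_distrib)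
  show "grassmann_sign I J * (grassmann_sign I J * x) = x"
    using * by (simp flip: mult.assoc)
qed

lemma gs_pairs_finite: "\<lbrakk>finite I; finite J\<rbrakk> \<Longrightarrow> finite {(i, j). i \<in> I \<and> j \<in> J \<and> j < (i::nat)}"
  by (rule finite_subset[of _ "I \<times> J"]) auto

lemma gs_union_left:
  assumes "finite I" "finite I'" "finite J" "I \<inter> I' = {}"
  shows "grassmann_sign (I \<union> I') J = grassmann_sign I J * grassmann_sign I' J"
proof -
  have "{(i, j). i \<in> I \<union> I' \<and> j \<in> J \<and> j < i}
      = {(i, j). i \<in> I \<and> j \<in> J \<and> j < i} \<union> {(i, j). i \<in> I' \<and> j \<in> J \<and> j < i}" by auto
  moreover have "card (\<dots>) = card {(i, j). i \<in> I \<and> j \<in> J \<and> j < i} + card {(i, j). i \<in> I' \<and> j \<in> J \<and> j < i}"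
    using assms by (intro card_Un_disjoint gs_pairs_finite) auto
  ultimately show ?thesis by (simp add: grassmann_sign_def power_add)
qed

lemma gs_union_right:
  assumes "finite I" "finite J" "finite J'" "J \<inter> J' = {}"
  shows "grassmann_sign I (J \<union> J') = grassmann_sign I J * grassmann_sign I J'"
proof -
  have "{(i, j). i \<in> I \<and> j \<in> J \<union> J' \<and> j < i}
      = {(i, j). i \<in> I \<and> j \<in> J \<and> j < i} \<union> {(i, j). i \<in> I \<and> j \<in> J' \<and> j < i}" by auto
  moreover have "card (\<dots>) = card {(i, j). i \<in> I \<and> j \<in> J \<and> j < i} + card {(i, j). i \<in> I \<and> j \<in> J' \<and> j < i}"
    using assms by (intro card_Un_disjoint gs_pairs_finite) auto
  ultimately show ?thesis by (simp add: grassmann_sign_def power_add)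
qed

lemma gs_swap:
  assumes "finite J" "l \<notin> J"
  shows "grassmann_sign {l} J * grassmann_sign J {l} = (- 1) ^ card J"
proof -
  have "card {(i, j). i \<in> {l} \<and> j \<in> J \<and> j < i} = card {j \<in> J. j < l}"
    by (rule bij_betw_same_card[of snd]) (auto simp: bij_betw_def inj_on_def image_iff)
  moreover have "card {(i, j). i \<in> J \<and> j \<in> {l} \<and> j < i} = card {i \<in> J. l < i}"
    by (rule bij_betw_same_card[of fst]) (auto simp: bij_betw_def inj_on_def image_iff)
  moreover have "card J = card {j \<in> J. j < l} + card {i \<in> J. l < i}"
    using assms by (subst card_Un_disjoint[symmetric]) (auto intro!: arg_cong[of _ _ card], metis linorder_neqE_nat)
  ultimately show ?thesis by (simp add: grassmann_sign_def power_add)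
qed

section \<open>Superfunctions on a superdomain\<close>

type_synonym family = "nat set \<Rightarrow> (nat \<Rightarrow> real) \<Rightarrow> real"

definition family_mult :: "family \<Rightarrow> family \<Rightarrow> family"
  where "family_mult F G = (\<lambda>I x. \<Sum>J\<in>Pow I. grassmann_sign J (I - J) * F J x * G (I - J) x)"

lemma superdomain_sec_simps [simp]:
  "\<one>\<^bsub>superdomain_sec p q V\<^esub> = (\<lambda>I x. if I = {} \<and> x \<in> V then 1 else 0)"
  "\<zero>\<^bsub>superdomain_sec p q V\<^esub> = (\<lambda>I x. 0)"
  "F \<otimes>\<^bsub>superdomain_sec p q V\<^esub> G = family_mult F G"
  "F \<oplus>\<^bsub>superdomain_sec p q V\<^esub> G = (\<lambda>I x. F I x + G I x)"
  "r \<odot>\<^bsub>superdomain_sec p q V\<^esub> F = (\<lambda>I x. r * F I x)"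
  by (simp_all add: superdomain_sec_def Let_def family_mult_def)

lemma superdomain_sec_carrier: "F \<in> carrier (superdomain_sec p q V) \<longleftrightarrow>
    (\<forall>I. smooth_on p V (F I)) \<and> (\<forall>I x. \<not> I \<subseteq> {..<q} \<or> x \<notin> V \<longrightarrow> F I x = 0)"
  by (simp add: superdomain_sec_def Let_def)

lemma superdomain_sec_grade: "F \<in> grade (superdomain_sec p q V) e \<longleftrightarrow>
    F \<in> carrier (superdomain_sec p q V) \<and> (\<forall>I x. of_nat (card I) \<noteq> e \<longrightarrow> F I x = 0)"
  by (simp add: superdomain_sec_def Let_def)

lemma family_mult_scalar_left:
  assumes "finite I" "\<And>J. J \<noteq> {} \<Longrightarrow> F J x = 0"
  shows "family_mult F G I x = F {} x * G I x"
proof -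
  have "family_mult F G I x = (\<Sum>J\<in>{{}}. grassmann_sign J (I - J) * F J x * G (I - J) x)"
    unfolding family_mult_def using assms by (intro sum.mono_neutral_right) auto
  then show ?thesis by simp
qed

lemma family_mult_scalar_right:
  assumes "finite I" "\<And>J. J \<noteq> {} \<Longrightarrow> G J x = 0"
  shows "family_mult F G I x = F I x * G {} x"
proof -
  have "family_mult F G I x = (\<Sum>J\<in>{I}. grassmann_sign J (I - J) * F J x * G (I - J) x)"
    unfolding family_mult_def
  proof (intro sum.mono_neutral_right ballI)
    fix J assume "J \<in> Pow I - {I}"
    then have "I - J \<noteq> {}" by auto
    then show "grassmann_sign J (I - J) * F J x * G (I - J) x = 0" using assms(2) by simp
  qed (use assms in auto)
  then show ?thesis by simp
qed

lemma family_mult_theta_left: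
  assumes "finite I" "\<And>J. J \<noteq> {l} \<Longrightarrow> F J x = 0"
  shows "family_mult F G I x = (if l \<in> I then grassmann_sign {l} (I - {l}) * F {l} x * G (I - {l}) x else 0)"
proof -
  have "family_mult F G I x = (\<Sum>J\<in>{{l}} \<inter> Pow I. grassmann_sign J (I - J) * F J x * G (I - J) x)"
    unfolding family_mult_def using assms by (intro sum.mono_neutral_right) auto
  then show ?thesis by auto
qed

text \<open>The derivative with respect to \<open>\<theta>\<^sub>l\<close>; the sign comes from moving \<open>\<theta>\<^sub>l\<close> to the front.\<close>

definition odd_partial :: "nat \<Rightarrow> family \<Rightarrow> family"
  where "odd_partial l F = (\<lambda>I x. if l \<in> I then 0 else grassmann_sign {l} I * F (insert l I) x)"

lemma sum_Pow_insert:
  assumes "finite I" "l \<notin> I"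
  shows "(\<Sum>J\<in>Pow (insert l I). f J) = (\<Sum>J\<in>Pow I. f J + (f (insert l J) :: real))"
proof -
  have "Pow (insert l I) = Pow I \<union> insert l ` Pow I" by (rule Pow_insert)
  moreover have "inj_on (insert l) (Pow I)"
    using assms unfolding inj_on_def by (metis Pow_iff insert_ident subsetD)
  moreover have "Pow I \<inter> insert l ` Pow I = {}" using assms by auto
  ultimately show ?thesis
    using assms by (simp add: sum.union_disjoint sum.reindex sum.distrib)
qed

lemma of_nat_bit: "(of_nat n :: bit) = (if even n then 0 else 1)"
  by (induction n) auto

text \<open>Moving \<open>\<theta>\<^sub>l\<close> past \<open>\<theta>\<^sub>J\<close> costs \<open>(- 1) ^ card J\<close>, which is the sign of the parity of \<open>F\<close> wherever
  \<open>F J\<close> is not zero. For \<open>l \<in> I\<close> the terms of the two products on the right cancel in pairs, which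
  reflects \<open>\<theta>\<^sub>l \<theta>\<^sub>l = 0\<close>.\<close>

lemma odd_partial_leibniz:
  assumes I: "finite I" and F: "\<And>J x. of_nat (card J) \<noteq> e \<Longrightarrow> F J x = 0"
  shows "odd_partial l (family_mult F G) I x
    = family_mult (odd_partial l F) G I x + sg e * family_mult F (odd_partial l G) I x"
proof -
  have sg_card: "(- 1) ^ card J * F J x = sg e * F J x" for J
    using F[of J x] by (cases e; cases "even (card J)") (auto simp: of_nat_bit)
  show ?thesis
  proof (cases "l \<in> I")
    case False
    have "odd_partial l (family_mult F G) I x = grassmann_sign {l} I *
        (\<Sum>J\<in>Pow I. grassmann_sign J (insert l I - J) * F J x * G (insert l I - J) x
          + grassmann_sign (insert l J) (insert l I - insert l J) * F (insert l J) x * G (insert l I - insert l J) x)"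
      using False by (simp add: odd_partial_def family_mult_def sum_Pow_insert[OF I False])
    also have "\<dots> = (\<Sum>J\<in>Pow I. grassmann_sign J (I - J) * odd_partial l F J x * G (I - J) x
        + sg e * (grassmann_sign J (I - J) * F J x * odd_partial l G (I - J) x))"
      unfolding sum_distrib_left
    proof (intro sum.cong refl)
      fix J assume "J \<in> Pow I"
      then have J: "J \<subseteq> I" "finite J" "l \<notin> J" "finite (I - J)" "l \<notin> I - J"
        using I False finite_subset[of J I] by auto
      have diff: "insert l I - J = {l} \<union> (I - J)" "insert l I - insert l J = I - J" "insert l J = {l} \<union> J"
        using J by auto
      have 1: "grassmann_sign {l} I = grassmann_sign {l} J * grassmann_sign {l} (I - J)"
        using gs_union_right[of "{l}" J "I - J"] J by (simp add: Un_absorb1)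
      have 2: "grassmann_sign J ({l} \<union> (I - J)) = grassmann_sign J {l} * grassmann_sign J (I - J)"
        using J by (intro gs_union_right) auto
      have 3: "grassmann_sign ({l} \<union> J) (I - J) = grassmann_sign {l} (I - J) * grassmann_sign J (I - J)"
        using J by (intro gs_union_left) auto
      have "grassmann_sign {l} I * (grassmann_sign J ({l} \<union> (I - J)) * F J x * G ({l} \<union> (I - J)) x)
          = (grassmann_sign {l} J * grassmann_sign J {l}) * F J x *
            (grassmann_sign {l} (I - J) * grassmann_sign J (I - J) * G ({l} \<union> (I - J)) x)"
        unfolding 1 2 by (simp add: algebra_simps)
      also have "\<dots> = sg e * (grassmann_sign J (I - J) * F J x * odd_partial l G (I - J) x)"
        unfolding gs_swap[OF J(2,3)] sg_card odd_partial_def using J by simp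
      finally have A: "grassmann_sign {l} I * (grassmann_sign J ({l} \<union> (I - J)) * F J x * G ({l} \<union> (I - J)) x)
          = sg e * (grassmann_sign J (I - J) * F J x * odd_partial l G (I - J) x)" .
      have B: "grassmann_sign {l} I * (grassmann_sign ({l} \<union> J) (I - J) * F ({l} \<union> J) x * G (I - J) x)
          = grassmann_sign J (I - J) * odd_partial l F J x * G (I - J) x"
        unfolding 1 3 odd_partial_def using J by (simp add: algebra_simps)
      show "grassmann_sign {l} I * (grassmann_sign J (insert l I - J) * F J x * G (insert l I - J) x
          + grassmann_sign (insert l J) (insert l I - insert l J) * F (insert l J) x * G (insert l I - insert l J) x)
          = grassmann_sign J (I - J) * odd_partial l F J x * G (I - J) x
            + sg e * (grassmann_sign J (I - J) * F J x * odd_partial l G (I - J) x)"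
        unfolding diff(1,2) unfolding diff(3) distrib_left A B by simp
    qed
    finally show ?thesis
      by (simp add: family_mult_def sum.distrib sum_distrib_left)
  next
    case True
    define K where "K = I - {l}"
    have K: "I = insert l K" "l \<notin> K" "finite K" using True I by (auto simp: K_def)
    have "family_mult (odd_partial l F) G I x + sg e * family_mult F (odd_partial l G) I x
        = (\<Sum>J\<in>Pow K. grassmann_sign J (I - J) * odd_partial l F J x * G (I - J) x
          + sg e * (grassmann_sign (insert l J) (K - J) * F (insert l J) x * odd_partial l G (K - J) x))"
    proof -
      have "family_mult (odd_partial l F) G I x
          = (\<Sum>J\<in>Pow K. grassmann_sign J (I - J) * odd_partial l F J x * G (I - J) x)"
        unfolding family_mult_def K(1) sum_Pow_insert[OF K(3,2)]
        by (intro sum.cong refl) (simp add: odd_partial_def)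
      moreover have "family_mult F (odd_partial l G) I x
          = (\<Sum>J\<in>Pow K. grassmann_sign (insert l J) (K - J) * F (insert l J) x * odd_partial l G (K - J) x)"
        unfolding family_mult_def K(1) sum_Pow_insert[OF K(3,2)]
      proof (intro sum.cong refl)
        fix J assume "J \<in> Pow K"
        then have "l \<in> insert l K - J" "insert l K - insert l J = K - J" using K(2) by auto
        then show "grassmann_sign J (insert l K - J) * F J x * odd_partial l G (insert l K - J) x
          + grassmann_sign (insert l J) (insert l K - insert l J) * F (insert l J) x *
            odd_partial l G (insert l K - insert l J) x
          = grassmann_sign (insert l J) (K - J) * F (insert l J) x * odd_partial l G (K - J) x"
          by (simp only:) (simp add: odd_partial_def)
      qed
      ultimately show ?thesis by (simp add: sum.distrib sum_distrib_left)
    qed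
    also have "\<dots> = 0"
    proof (rule sum.neutral, intro ballI)
      fix J assume "J \<in> Pow K"
      then have J: "J \<subseteq> K" "finite J" "l \<notin> J" "finite (K - J)" "l \<notin> K - J"
        using K finite_subset[of J K] by auto
      have diff: "I - J = {l} \<union> (K - J)" "insert l J = {l} \<union> J" using J K by auto
      have 1: "grassmann_sign J ({l} \<union> (K - J)) = grassmann_sign J {l} * grassmann_sign J (K - J)"
        using J by (intro gs_union_right) auto
      have 2: "grassmann_sign ({l} \<union> J) (K - J) = grassmann_sign {l} (K - J) * grassmann_sign J (K - J)"
        using J by (intro gs_union_left) auto
      have 3: "(- 1) ^ card J * F ({l} \<union> J) x = - sg e * F ({l} \<union> J) x"
        using sg_card[of "insert l J"] J by simp
      have "grassmann_sign J (I - J) * odd_partial l F J x * G (I - J) x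
          = ((grassmann_sign {l} J * grassmann_sign J {l}) * F ({l} \<union> J) x) * (grassmann_sign J (K - J) * G ({l} \<union> (K - J)) x)"
        unfolding diff 1 odd_partial_def using J by (simp add: algebra_simps)
      also have "\<dots> = - (sg e * (grassmann_sign (insert l J) (K - J) * F (insert l J) x * odd_partial l G (K - J) x))"
        unfolding gs_swap[OF J(2,3)] 3 diff 2 odd_partial_def using J by (simp add: algebra_simps)
      finally show "grassmann_sign J (I - J) * odd_partial l F J x * G (I - J) x
          + sg e * (grassmann_sign (insert l J) (K - J) * F (insert l J) x * odd_partial l G (K - J) x) = 0"
        by simp
    qed
    also have "0 = odd_partial l (family_mult F G) I x" using True by (simp add: odd_partial_def)
    finally show ?thesis by simp
  qed
qed

section \<open>Charts onto cubes\<close>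

text \<open>A chart as seen from the algebra \<open>A\<close> of global superfunctions: \<open>hat\<close> restricts to the chart, and
  \<open>\<rho>\<close> restricts to the complement of a compact cube inside the chart. These two open sets cover the
  supermanifold, and \<open>detect\<close> and \<open>extend\<close> are what the sheaf axioms give for this cover.\<close>

locale cube_chart = superalgebra A + cube_domain p c r
  for A :: "'a salgebra" (structure) and p :: nat and c :: "nat \<Rightarrow> real" and r :: real +
  fixes q :: nat and hat :: "'a \<Rightarrow> family" and B :: "'a salgebra" and \<rho> :: "'a \<Rightarrow> 'a"
  assumes r_pos: "0 < r"
    and hat_hom: "hat \<in> salgebra_hom A (superdomain_sec p q (cube p c r))"
    and B: "superalgebra B"
    and \<rho>_hom: "\<rho> \<in> salgebra_hom A B"
    and detect: "\<lbrakk>f \<in> carrier A; hat f = (\<lambda>I x. 0); \<rho> f = \<zero>\<^bsub>B\<^esub>\<rbrakk> \<Longrightarrow> f = \<zero>"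
    and extend: "\<lbrakk>F \<in> carrier (superdomain_sec p q (cube p c r));
      \<And>I x i. \<lbrakk>i < p; 4/5 * r \<le> \<bar>x i - c i\<bar>\<rbrakk> \<Longrightarrow> F I x = 0\<rbrakk> \<Longrightarrow>
      \<exists>f\<in>carrier A. hat f = F \<and> \<rho> f = \<zero>\<^bsub>B\<^esub>"
begin

abbreviation Q :: "(nat \<Rightarrow> real) set" where "Q \<equiv> cube p c r"
abbreviation S :: "family salgebra" where "S \<equiv> superdomain_sec p q Q"

lemma hat_carrier: "f \<in> carrier A \<Longrightarrow> hat f \<in> carrier S"
  by (rule salgebra_homD(1)[OF hat_hom])

lemma hat_smooth: "f \<in> carrier A \<Longrightarrow> smooth_on p Q (hat f I)"
  and hat_outside: "f \<in> carrier A \<Longrightarrow> \<not> I \<subseteq> {..<q} \<or> x \<notin> Q \<Longrightarrow> hat f I x = 0"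
  using hat_carrier[of f] unfolding superdomain_sec_carrier by blast+

lemma hat_add: "\<lbrakk>f \<in> carrier A; g \<in> carrier A\<rbrakk> \<Longrightarrow> hat (f \<oplus> g) = (\<lambda>I x. hat f I x + hat g I x)"
  and hat_mult: "\<lbrakk>f \<in> carrier A; g \<in> carrier A\<rbrakk> \<Longrightarrow> hat (f \<otimes> g) = family_mult (hat f) (hat g)"
  and hat_one: "hat \<one> = (\<lambda>I x. if I = {} \<and> x \<in> Q then 1 else 0)"
  and hat_smult: "f \<in> carrier A \<Longrightarrow> hat (k \<odot> f) = (\<lambda>I x. k * hat f I x)"
  using salgebra_homD(2-5)[OF hat_hom] by simp_all

lemma hat_grade: "f \<in> grade A e \<Longrightarrow> hat f \<in> grade S e"
  by (rule salgebra_homD(6)[OF hat_hom])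

lemma hat_zero: "hat \<zero> = (\<lambda>I x. 0)"
  using hat_smult[of \<zero> 0] by simp

lemma hat_signed: "f \<in> carrier A \<Longrightarrow> hat (signed A e f) = (\<lambda>I x. sg e * hat f I x)"
  by (simp add: signed_eq_smult hat_smult)

lemma hat_diff: "\<lbrakk>f \<in> carrier A; g \<in> carrier A\<rbrakk> \<Longrightarrow> hat (f \<ominus> g) = (\<lambda>I x. hat f I x - hat g I x)"
  by (simp add: minus_eq_smult hat_add hat_smult)

lemmas hat_simps = hat_add hat_mult hat_one hat_smult hat_zero hat_signed hat_diff

lemma hat_vf_sum:
  assumes "\<And>k. k < n \<Longrightarrow> V k \<in> HV a" "f \<in> carrier A"
  shows "hat (vf_sum V n f) I x = (\<Sum>k<n. hat (V k f) I x)"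
  using assms(1)
proof (induction n)
  case (Suc n)
  then have "V n \<in> HV a" "vf_sum V n \<in> HV a" by (simp_all add: vf_sum_hvf)
  then have "vf_sum V n f \<in> carrier A" "V n f \<in> carrier A"
    using assms(2) by (auto intro: hvf_closed)
  moreover have "hat (vf_sum V n f) I x = (\<Sum>k<n. hat (V k f) I x)"
    using Suc.IH Suc.prems by simp
  ultimately show ?case using assms(2) by (simp add: hat_add)
qed (simp add: assms(2) hat_zero)

text \<open>The superfunctions that vanish off the compact cube; the chart determines them completely.\<close>

definition Zero :: "'a set"
  where "Zero = {f \<in> carrier A. \<rho> f = \<zero>\<^bsub>B\<^esub>}"

lemma Zero_closed [simp]: "f \<in> Zero \<Longrightarrow> f \<in> carrier A"
  by (simp add: Zero_def)

lemma Zero_ops: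
  assumes "f \<in> Zero"
  shows "g \<in> Zero \<Longrightarrow> f \<oplus> g \<in> Zero" "k \<odot> f \<in> Zero" "g \<in> carrier A \<Longrightarrow> f \<otimes> g \<in> Zero"
    "g \<in> carrier A \<Longrightarrow> g \<otimes> f \<in> Zero"
proof -
  interpret B: superalgebra B by (rule B)
  note h = salgebra_homD(1-3,5)[OF \<rho>_hom]
  show "g \<in> Zero \<Longrightarrow> f \<oplus> g \<in> Zero" "k \<odot> f \<in> Zero" "g \<in> carrier A \<Longrightarrow> f \<otimes> g \<in> Zero"
    "g \<in> carrier A \<Longrightarrow> g \<otimes> f \<in> Zero"
    using assms by (simp_all add: Zero_def h del: Zero_closed)
qed

lemma zero_Zero: "\<zero> \<in> Zero"
proof -
  interpret B: superalgebra B by (rule B)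
  show ?thesis
    using salgebra_homD(5)[OF \<rho>_hom, of \<zero> 0] salgebra_homD(1)[OF \<rho>_hom, of \<zero>] by (simp add: Zero_def del: Zero_closed)
qed

lemma Zero_eqI:
  assumes "f \<in> Zero" "g \<in> Zero" "\<And>I x. hat f I x = hat g I x" shows "f = g"
proof (rule diff_zero_eq)
  have "f \<ominus> g \<in> Zero"
    using assms Zero_ops(1)[of f "(- 1) \<odot> g"] Zero_ops(2)[of g] by (simp add: minus_eq_smult)
  moreover have "hat (f \<ominus> g) = (\<lambda>I x. 0)" using assms by (simp add: hat_diff)
  ultimately show "f \<ominus> g = \<zero>"
    by (intro detect) (simp_all add: Zero_def del: Zero_closed)
qed (use assms in simp_all)

definition supported :: "family \<Rightarrow> bool"
  where "supported F \<longleftrightarrow> F \<in> carrier S \<and> (\<forall>I x i. i < p \<longrightarrow> 4/5 * r \<le> \<bar>x i - c i\<bar> \<longrightarrow> F I x = 0)"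

text \<open>Extension by zero from the chart to the whole supermanifold.\<close>

definition lift :: "family \<Rightarrow> 'a"
  where "lift F = (SOME f. f \<in> Zero \<and> hat f = F)"

lemma lift:
  assumes "supported F" shows lift_Zero: "lift F \<in> Zero" and hat_lift: "hat (lift F) = F"
proof -
  have "\<exists>f. f \<in> Zero \<and> hat f = F"
    using assms extend[of F] unfolding supported_def Zero_def by blast
  then have "lift F \<in> Zero \<and> hat (lift F) = F"
    unfolding lift_def by (rule someI_ex)
  then show "lift F \<in> Zero" "hat (lift F) = F" by blast+
qed

lemma lift_closed: "supported F \<Longrightarrow> lift F \<in> carrier A"
  by (simp add: lift_Zero)

lemma lift_grade:
  assumes "supported F" "F \<in> grade S e" shows "lift F \<in> grade A e"
proof -
  interpret B: superalgebra B by (rule B)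
  obtain f0 f1 where f01: "f0 \<in> grade A 0" "f1 \<in> grade A 1" "lift F = f0 \<oplus> f1"
    using grade_decompose[OF lift_closed[OF assms(1)]] .
  obtain f f' where f: "f \<in> grade A e" "f' \<in> grade A (e + 1)" "lift F = f \<oplus> f'"
  proof (cases e)
    case zero then show ?thesis using f01 that[of f0 f1] by simp
  next
    case one then show ?thesis using f01 that[of f1 f0] by (simp add: a_comm)
  qed
  have "hat f' I x = 0" for I x
  proof (cases "of_nat (card I) = e")
    case True
    then have "of_nat (card I) \<noteq> e + 1" by (cases e) auto
    then show ?thesis using hat_grade[OF f(2)] unfolding superdomain_sec_grade by blast
  next
    case False
    have "hat f I x = 0" using hat_grade[OF f(1)] False unfolding superdomain_sec_grade by blast
    moreover have "hat (lift F) I x = hat f I x + hat f' I x"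
      using f by (simp add: hat_add)
    moreover have "hat (lift F) I x = 0"
      using assms False unfolding hat_lift[OF assms(1)] superdomain_sec_grade by blast
    ultimately show ?thesis by simp
  qed
  moreover have "\<rho> f' = \<zero>\<^bsub>B\<^esub>"
  proof -
    have gr: "\<rho> f \<in> grade B e" "\<rho> f' \<in> grade B (e + 1)"
      using salgebra_homD(6)[OF \<rho>_hom] f by blast+
    have "\<rho> (lift F) = \<zero>\<^bsub>B\<^esub>" using lift_Zero[OF assms(1)] by (simp add: Zero_def del: Zero_closed)
    then have sum: "\<rho> f \<oplus>\<^bsub>B\<^esub> \<rho> f' = \<zero>\<^bsub>B\<^esub>"
      using f salgebra_homD(2)[OF \<rho>_hom, of f f'] by simp
    then have "\<rho> f' = \<ominus>\<^bsub>B\<^esub> \<rho> f"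
      using gr B.minus_equality[of "\<rho> f'" "\<rho> f"] by (simp add: B.a_comm)
    then have "\<rho> f' \<in> grade B e" using gr(1) by (simp add: B.grade_minus)
    then show ?thesis using gr(2) by (rule B.grade_disjoint) (cases e; simp)
  qed
  ultimately have "f' = \<zero>" using f(2) by (intro detect) (auto simp: fun_eq_iff)
  then show ?thesis using f by simp
qed

definition single :: "nat set \<Rightarrow> ((nat \<Rightarrow> real) \<Rightarrow> real) \<Rightarrow> family"
  where "single I h = (\<lambda>J x. if J = I \<and> x \<in> Q then h x else 0)"

lemma single_carrier:
  assumes "I \<subseteq> {..<q}" "smooth_on p Q h" shows "single I h \<in> carrier S"
proof -
  have "smooth_on p Q (single I h J)" for J
    by (cases "J = I") (auto simp: single_def intro: smooth_on_cong[OF assms(2)] smooth_intros(1)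
        smooth_on_cong[OF smooth_intros(1)[of 0]])
  then show ?thesis using assms(1) unfolding superdomain_sec_carrier by (auto simp: single_def)
qed

lemma single_supported:
  assumes "I \<subseteq> {..<q}" "smooth_on p Q h" "\<And>x i. \<lbrakk>i < p; 4/5 * r \<le> \<bar>x i - c i\<bar>\<rbrakk> \<Longrightarrow> h x = 0"
  shows "supported (single I h)"
  using assms(3) single_carrier[OF assms(1,2)] unfolding supported_def by (auto simp: single_def)

lemma single_grade:
  assumes "I \<subseteq> {..<q}" "smooth_on p Q h" "of_nat (card I) = e"
  shows "single I h \<in> grade S e"
  using single_carrier[OF assms(1,2)] assms(3) unfolding superdomain_sec_grade by (auto simp: single_def)

text \<open>Nested cut-off functions: \<open>\<tau>\<close> is 1 on the support of \<open>\<beta>\<close>, and \<open>\<sigma>\<close> is 1 on the support of \<open>\<tau>\<close>.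
  Vector fields are cut off by \<open>\<beta>\<close>, functions by \<open>\<sigma>\<close>, and \<open>\<tau>\<close> serves to localize.\<close>

definition \<beta> :: "(nat \<Rightarrow> real) \<Rightarrow> real" where "\<beta> = bump p c (1/5 * r) (2/5 * r)"
definition \<tau> :: "(nat \<Rightarrow> real) \<Rightarrow> real" where "\<tau> = bump p c (2/5 * r) (3/5 * r)"
definition \<sigma> :: "(nat \<Rightarrow> real) \<Rightarrow> real" where "\<sigma> = bump p c (3/5 * r) (4/5 * r)"

lemma bumps_smooth: "smooth_on p Q \<beta>" "smooth_on p Q \<tau>" "smooth_on p Q \<sigma>"
  unfolding \<beta>_def \<tau>_def \<sigma>_def using r_pos by (auto intro!: smooth_on_bump)

lemma bumps_zero:
  assumes "i < p"
  shows "2/5 * r \<le> \<bar>x i - c i\<bar> \<Longrightarrow> \<beta> x = 0" "3/5 * r \<le> \<bar>x i - c i\<bar> \<Longrightarrow> \<tau> x = 0"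
    "4/5 * r \<le> \<bar>x i - c i\<bar> \<Longrightarrow> \<sigma> x = 0"
    "4/5 * r \<le> \<bar>x i - c i\<bar> \<Longrightarrow> \<beta> x = 0" "4/5 * r \<le> \<bar>x i - c i\<bar> \<Longrightarrow> \<tau> x = 0"
  unfolding \<beta>_def \<tau>_def \<sigma>_def using assms r_pos by (auto intro: bump_zero)

lemma bumps_one:
  "x \<in> cube p c (1/5 * r) \<Longrightarrow> \<beta> x = 1" "x \<in> cube p c (2/5 * r) \<Longrightarrow> \<tau> x = 1"
  "x \<in> cube p c (3/5 * r) \<Longrightarrow> \<sigma> x = 1"
  unfolding \<beta>_def \<tau>_def \<sigma>_def using r_pos by (auto intro!: bump_one simp: cube_def less_imp_le)

lemma cube_mono: "s \<le> s' \<Longrightarrow> x \<in> cube p c s \<Longrightarrow> x \<in> cube p c s'"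
  by (auto simp: cube_def intro: less_le_trans)

lemma cube_Q: "x \<in> cube p c (3/5 * r) \<Longrightarrow> x \<in> Q" "x \<in> cube p c (2/5 * r) \<Longrightarrow> x \<in> Q"
   "x \<in> cube p c (1/5 * r) \<Longrightarrow> x \<in> Q"
  "x \<in> cube p c (2/5 * r) \<Longrightarrow> x \<in> cube p c (3/5 * r)"
  using r_pos by (auto intro: cube_mono[rotated])

lemma cutoff_supported:
  "\<lbrakk>I \<subseteq> {..<q}; smooth_on p Q h\<rbrakk> \<Longrightarrow> supported (single I (\<lambda>x. \<sigma> x * h x))"
  using bumps_zero(3) by (intro single_supported smooth_intros(4) bumps_smooth) auto

definition cutoff :: "nat set \<Rightarrow> ((nat \<Rightarrow> real) \<Rightarrow> real) \<Rightarrow> 'a"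
  where "cutoff I h = lift (single I (\<lambda>x. \<sigma> x * h x))"

lemma cutoff_closed: "\<lbrakk>I \<subseteq> {..<q}; smooth_on p Q h\<rbrakk> \<Longrightarrow> cutoff I h \<in> carrier A"
  and cutoff_grade: "\<lbrakk>I \<subseteq> {..<q}; smooth_on p Q h; of_nat (card I) = e\<rbrakk> \<Longrightarrow> cutoff I h \<in> grade A e"
  and hat_cutoff: "\<lbrakk>I \<subseteq> {..<q}; smooth_on p Q h\<rbrakk> \<Longrightarrow> hat (cutoff I h) = single I (\<lambda>x. \<sigma> x * h x)"
  unfolding cutoff_def
  by (auto intro!: lift_closed cutoff_supported lift_grade single_grade hat_lift smooth_intros(4) bumps_smooth)

lemma hat_cutoff_inner:
  assumes "I \<subseteq> {..<q}" "smooth_on p Q h" "x \<in> cube p c (3/5 * r)"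
  shows "hat (cutoff I h) J x = (if J = I then h x else 0)"
  using assms cube_Q by (simp add: hat_cutoff single_def bumps_one)

subsection \<open>Partial derivatives\<close>

definition even_partial :: "nat \<Rightarrow> family \<Rightarrow> family"
  where "even_partial k F = (\<lambda>I x. if x \<in> Q then partial k (F I) x else 0)"

definition local_derivation :: "bit \<Rightarrow> (family \<Rightarrow> family) \<Rightarrow> bool"
  where "local_derivation u d \<longleftrightarrow>
    (\<forall>F\<in>carrier S. d F \<in> carrier S) \<and>
    (\<forall>F\<in>carrier S. \<forall>G\<in>carrier S. \<forall>I. \<forall>x\<in>Q. d (\<lambda>I x. F I x + G I x) I x = d F I x + d G I x) \<and>
    (\<forall>k. \<forall>F\<in>carrier S. \<forall>I. \<forall>x\<in>Q. d (\<lambda>I x. k * F I x) I x = k * d F I x) \<and>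
    (\<forall>e. \<forall>F\<in>grade S e. d F \<in> grade S (u + e)) \<and>
    (\<forall>e. \<forall>F\<in>grade S e. \<forall>G\<in>carrier S. \<forall>I. finite I \<longrightarrow> (\<forall>x\<in>Q.
      d (family_mult F G) I x = family_mult (d F) G I x + sg (u * e) * family_mult F (d G) I x))"

lemma local_derivation_carrier: "\<lbrakk>local_derivation u d; F \<in> carrier S\<rbrakk> \<Longrightarrow> d F \<in> carrier S"
  unfolding local_derivation_def by (elim conjE) simp

lemma local_derivation_add: "\<lbrakk>local_derivation u d; F \<in> carrier S; G \<in> carrier S; x \<in> Q\<rbrakk> \<Longrightarrow>
    d (\<lambda>I x. F I x + G I x) I x = d F I x + d G I x"
  unfolding local_derivation_def by (elim conjE) simp

lemma local_derivation_smult: "\<lbrakk>local_derivation u d; F \<in> carrier S; x \<in> Q\<rbrakk> \<Longrightarrow>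
    d (\<lambda>I x. k * F I x) I x = k * d F I x"
  unfolding local_derivation_def by (elim conjE) simp

lemma local_derivation_grade: "\<lbrakk>local_derivation u d; F \<in> grade S e\<rbrakk> \<Longrightarrow> d F \<in> grade S (u + e)"
  unfolding local_derivation_def by (elim conjE) simp

lemma local_derivation_mult: "\<lbrakk>local_derivation u d; F \<in> grade S e; G \<in> carrier S; finite I; x \<in> Q\<rbrakk> \<Longrightarrow>
    d (family_mult F G) I x = family_mult (d F) G I x + sg (u * e) * family_mult F (d G) I x"
  unfolding local_derivation_def by (elim conjE) simp

lemma even_partial_eqI:
  assumes "x \<in> Q" "((\<lambda>t. F I (x(k := t))) has_field_derivative D) (at (x k))"
  shows "even_partial k F I x = D"
  using assms by (simp add: even_partial_def partial_def DERIV_imp_deriv)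

lemma even_partial_derivation:
  assumes k: "k < p" shows "local_derivation 0 (even_partial k)"
proof -
  have deriv: "((\<lambda>t. F I (x(k := t))) has_field_derivative even_partial k F I x) (at (x k))"
    if "F \<in> carrier S" "x \<in> Q" for F I x
    using smooth_on_has_derivative[of "F I" k x] that k by (simp add: superdomain_sec_carrier even_partial_def)
  have carrier: "even_partial k F \<in> carrier S" if "F \<in> carrier S" for F
  proof -
    have "smooth_on p Q (even_partial k F I)" for I
      using smooth_on_partial[of "F I" k] that k
      by (auto simp: superdomain_sec_carrier even_partial_def intro: smooth_on_cong)
    moreover have "even_partial k F I x = 0" if "\<not> I \<subseteq> {..<q}" for I x
    proof -
      have "F I = (\<lambda>x. 0)"
        using \<open>F \<in> carrier S\<close> that unfolding superdomain_sec_carrier fun_eq_iff by blast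
      then show ?thesis by (simp add: even_partial_def partial_def)
    qed
    moreover have "even_partial k F I x = 0" if "x \<notin> Q" for I x
      using that by (simp add: even_partial_def)
    ultimately show ?thesis unfolding superdomain_sec_carrier by blast
  qed
  have grade: "even_partial k F \<in> grade S (0 + e)" if "F \<in> grade S e" for F e
  proof -
    have "even_partial k F I x = 0" if "of_nat (card I) \<noteq> e" for I x
    proof -
      have "F I = (\<lambda>x. 0)" using \<open>F \<in> grade S e\<close> that unfolding superdomain_sec_grade by auto
      then show ?thesis by (simp add: even_partial_def partial_def)
    qed
    then show ?thesis using carrier that unfolding superdomain_sec_grade by auto
  qed
  have mult: "even_partial k (family_mult F G) I x
      = family_mult (even_partial k F) G I x + sg (0 * e) * family_mult F (even_partial k G) I x"
    if "F \<in> grade S e" "G \<in> carrier S" "finite I" "x \<in> Q" for F G I x e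
  proof (rule even_partial_eqI[OF \<open>x \<in> Q\<close>])
    have F: "F \<in> carrier S" using that unfolding superdomain_sec_grade by blast
    have "((\<lambda>t. grassmann_sign J (I - J) * F J (x(k := t)) * G (I - J) (x(k := t))) has_field_derivative
        grassmann_sign J (I - J) * even_partial k F J x * G (I - J) x
        + grassmann_sign J (I - J) * F J x * even_partial k G (I - J) x) (at (x k))" for J
      using DERIV_mult[OF DERIV_cmult[OF deriv[OF F that(4)]] deriv[OF that(2,4)], of "grassmann_sign J (I - J)" J "I - J"]
      by (simp add: algebra_simps)
    then show "((\<lambda>t. family_mult F G I (x(k := t))) has_field_derivative
        family_mult (even_partial k F) G I x + sg (0 * e) * family_mult F (even_partial k G) I x) (at (x k))"
      unfolding family_mult_def mult_zero_left sg_simps mult_1 sum.distrib[symmetric] by (intro DERIV_sum)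
  qed
  show ?thesis
    unfolding local_derivation_def
    using carrier grade mult
    by (auto intro!: even_partial_eqI DERIV_add DERIV_cmult deriv)
qed

lemma odd_partial_derivation:
  assumes l: "l < q" shows "local_derivation 1 (odd_partial l)"
proof -
  have carrier: "odd_partial l F \<in> carrier S" if "F \<in> carrier S" for F
  proof -
    have "smooth_on p Q (odd_partial l F I)" for I
      using that unfolding superdomain_sec_carrier odd_partial_def
      by (cases "l \<in> I") (auto intro: smooth_intros)
    moreover have "odd_partial l F I x = 0" if "\<not> I \<subseteq> {..<q} \<or> x \<notin> Q" for I x
    proof -
      have "\<not> insert l I \<subseteq> {..<q} \<or> x \<notin> Q" using that by blast
      then have "F (insert l I) x = 0" using \<open>F \<in> carrier S\<close> unfolding superdomain_sec_carrier by blast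
      then show ?thesis by (simp add: odd_partial_def)
    qed
    ultimately show ?thesis unfolding superdomain_sec_carrier by blast
  qed
  have grade: "odd_partial l F \<in> grade S (1 + e)" if "F \<in> grade S e" for F e
  proof -
    have F: "F \<in> carrier S" using that unfolding superdomain_sec_grade by blast
    have "odd_partial l F I x = 0" if "of_nat (card I) \<noteq> 1 + e" for I x
    proof (cases "I \<subseteq> {..<q} \<and> l \<notin> I")
      case True
      then have "card (insert l I) = Suc (card I)" using finite_subset[of I] by auto
      then have "of_nat (card (insert l I)) \<noteq> e" using that by (cases e) (auto simp: of_nat_bit split: if_splits)
      then show ?thesis using \<open>F \<in> grade S e\<close> unfolding superdomain_sec_grade by (auto simp: odd_partial_def)
    next
      case False
      then have "l \<in> I \<or> \<not> insert l I \<subseteq> {..<q}" by blast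
      then have "l \<in> I \<or> F (insert l I) x = 0" using F unfolding superdomain_sec_carrier by blast
      then show ?thesis by (auto simp: odd_partial_def)
    qed
    then show ?thesis using carrier[OF F] unfolding superdomain_sec_grade by auto
  qed
  show ?thesis
    unfolding local_derivation_def
  proof (intro conjI ballI allI impI)
    fix e F G x and I :: "nat set" assume "F \<in> grade S e" "finite I"
    then show "odd_partial l (family_mult F G) I x
      = family_mult (odd_partial l F) G I x + sg (1 * e) * family_mult F (odd_partial l G) I x"
      using odd_partial_leibniz[of I e F l G x] unfolding superdomain_sec_grade by auto
  qed (use carrier grade in \<open>auto simp: odd_partial_def algebra_simps\<close>)
qed

text \<open>The vector field \<open>\<beta> d\<close>, extended by zero.\<close>

definition local_field :: "(family \<Rightarrow> family) \<Rightarrow> 'a \<Rightarrow> 'a"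
  where "local_field d = (\<lambda>f\<in>carrier A. lift (\<lambda>I x. \<beta> x * d (hat f) I x))"

lemma local_field:
  assumes d: "local_derivation u d" and f: "f \<in> carrier A"
  shows local_field_Zero: "local_field d f \<in> Zero"
    and hat_local_field: "hat (local_field d f) = (\<lambda>I x. \<beta> x * d (hat f) I x)"
    and local_field_grade: "f \<in> grade A e \<Longrightarrow> local_field d f \<in> grade A (u + e)"
proof -
  have dF: "d (hat f) \<in> carrier S" by (rule local_derivation_carrier[OF d hat_carrier[OF f]])
  have supp: "supported (\<lambda>I x. \<beta> x * d (hat f) I x)"
    unfolding supported_def superdomain_sec_carrier
  proof (intro conjI allI impI)
    show "smooth_on p Q (\<lambda>x. \<beta> x * d (hat f) I x)" for I
      using dF unfolding superdomain_sec_carrier by (intro smooth_intros(4) bumps_smooth) blast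
    show "\<beta> x * d (hat f) I x = 0" if "\<not> I \<subseteq> {..<q} \<or> x \<notin> Q" for I x
      using dF that unfolding superdomain_sec_carrier mult_eq_0_iff by blast
    show "\<beta> x * d (hat f) I x = 0" if "i < p" "4/5 * r \<le> \<bar>x i - c i\<bar>" for I x i
      using bumps_zero(4)[of i x] that unfolding mult_eq_0_iff by blast
  qed
  show "local_field d f \<in> Zero" "hat (local_field d f) = (\<lambda>I x. \<beta> x * d (hat f) I x)"
    using f lift[OF supp] by (simp_all add: local_field_def)
  assume fe: "f \<in> grade A e"
  have "d (hat f) \<in> grade S (u + e)" by (rule local_derivation_grade[OF d hat_grade[OF fe]])
  then have "(\<lambda>I x. \<beta> x * d (hat f) I x) \<in> grade S (u + e)"
    using supp unfolding superdomain_sec_grade supported_def mult_eq_0_iff by blast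
  then show "local_field d f \<in> grade A (u + e)"
    using f lift_grade[OF supp] by (simp add: local_field_def)
qed

lemma local_field_hvf:
  assumes d: "local_derivation u d" shows "local_field d \<in> HV u"
proof (rule hvfI)
  note Z = local_field_Zero[OF d] and H = hat_local_field[OF d]
  have out: "hat (local_field d f) I x = 0" if "f \<in> carrier A" "x \<notin> Q \<or> \<not> I \<subseteq> {..<q}" for f I x
    using hat_outside[of "local_field d f" I x] Z[OF that(1)] that(2) by auto
  show "local_field d \<in> extensional (carrier A)" by (simp add: local_field_def)
  show "\<And>f. f \<in> carrier A \<Longrightarrow> local_field d f \<in> carrier A" using Z by simp
  show "\<And>e f. f \<in> grade A e \<Longrightarrow> local_field d f \<in> grade A (u + e)"
    using local_field_grade[OF d] by simp
next
  fix f g assume fg: "f \<in> carrier A" "g \<in> carrier A"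
  show "local_field d (f \<oplus> g) = local_field d f \<oplus> local_field d g"
  proof (rule Zero_eqI)
    fix I x
    show "hat (local_field d (f \<oplus> g)) I x = hat (local_field d f \<oplus> local_field d g) I x"
    proof (cases "x \<in> Q")
      case True
      have "d (\<lambda>I x. hat f I x + hat g I x) I x = d (hat f) I x + d (hat g) I x"
        using fg True by (intro local_derivation_add[OF d] hat_carrier)
      then show ?thesis
        using fg local_field_Zero[OF d] by (simp add: hat_simps hat_local_field[OF d] algebra_simps)
    next
      case False
      then show ?thesis
        using fg local_field_Zero[OF d] hat_outside[of _ I x] by (simp add: hat_simps)
    qed
  qed (use fg local_field_Zero[OF d] in \<open>simp_all add: Zero_ops\<close>)
next
  fix k f assume f: "f \<in> carrier A"
  show "local_field d (k \<odot> f) = k \<odot> local_field d f"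
  proof (rule Zero_eqI)
    fix I x
    show "hat (local_field d (k \<odot> f)) I x = hat (k \<odot> local_field d f) I x"
    proof (cases "x \<in> Q")
      case True
      have "d (\<lambda>I x. k * hat f I x) I x = k * d (hat f) I x"
        using f True by (intro local_derivation_smult[OF d] hat_carrier)
      then show ?thesis
        using f local_field_Zero[OF d] by (simp add: hat_simps hat_local_field[OF d])
    next
      case False
      then show ?thesis
        using f local_field_Zero[OF d] hat_outside[of _ I x] by (simp add: hat_simps)
    qed
  qed (use f local_field_Zero[OF d] in \<open>simp_all add: Zero_ops\<close>)
next
  fix e f g assume f: "f \<in> grade A e" and g: "g \<in> carrier A"
  note Z = local_field_Zero[OF d]
  have Zs: "signed A (u * e) (f \<otimes> local_field d g) \<in> Zero"
    using f g Z by (simp add: signed_eq_smult Zero_ops)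
  show "local_field d (f \<otimes> g) = local_field d f \<otimes> g \<oplus> signed A (u * e) (f \<otimes> local_field d g)"
  proof (rule Zero_eqI)
    fix I x
    show "hat (local_field d (f \<otimes> g)) I x
      = hat (local_field d f \<otimes> g \<oplus> signed A (u * e) (f \<otimes> local_field d g)) I x"
    proof (cases "x \<in> Q \<and> I \<subseteq> {..<q}")
      case True
      then have "finite I" using finite_subset by blast
      then have mult: "d (family_mult (hat f) (hat g)) I x = family_mult (d (hat f)) (hat g) I x
          + sg (u * e) * family_mult (hat f) (d (hat g)) I x"
        using True by (intro local_derivation_mult[OF d] hat_grade[OF f] hat_carrier[OF g]) auto
      have scale: "family_mult (\<lambda>I x. \<beta> x * F I x) G I x = \<beta> x * family_mult F G I x"
        "family_mult F (\<lambda>I x. \<beta> x * G I x) I x = \<beta> x * family_mult F G I x" for F G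
        by (simp_all add: family_mult_def sum_distrib_left algebra_simps)
      show ?thesis
        using f g Z by (simp add: hat_simps hat_local_field[OF d] mult scale) (simp add: algebra_simps)
    next
      case False
      then have "\<not> I \<subseteq> {..<q} \<or> x \<notin> Q" by blast
      then have "hat h I x = 0" if "h \<in> carrier A" for h using hat_outside[OF that] by blast
      then show ?thesis using f g Z Zs by simp
    qed
  qed (use f g Z Zs in \<open>simp_all add: Zero_ops\<close>)
qed

text \<open>The even coordinates have the numbers below \<open>p\<close>, the odd ones those from \<open>p\<close> to \<open>p + q - 1\<close>.\<close>

definition coord :: "nat \<Rightarrow> 'a"
  where "coord k = (if k < p then cutoff {} (\<lambda>x. x k) else cutoff {k - p} (\<lambda>x. 1))"

definition coord_parity :: "nat \<Rightarrow> bit"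
  where "coord_parity k = (if k < p then 0 else 1)"

definition coord_partial :: "nat \<Rightarrow> family \<Rightarrow> family"
  where "coord_partial k = (if k < p then even_partial k else odd_partial (k - p))"

lemma coord_grade: "k < p + q \<Longrightarrow> coord k \<in> grade A (coord_parity k)"
  by (auto simp: coord_def coord_parity_def intro!: cutoff_grade smooth_intros)

lemma coord_partial_derivation: "k < p + q \<Longrightarrow> local_derivation (coord_parity k) (coord_partial k)"
  by (auto simp: coord_parity_def coord_partial_def intro!: even_partial_derivation odd_partial_derivation)

lemma coord_partial_coord:
  assumes k: "k < p + q" and j: "j < p + q" and x: "x \<in> cube p c (3/5 * r)" and I: "I \<subseteq> {..<q}"
  shows "coord_partial k (hat (coord j)) I x = (if j = k \<and> I = {} then 1 else 0)"
proof -
  interpret inner: open_domain p "cube p c (3/5 * r)" by unfold_locales (rule openin_cube)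
  have hat_coord: "hat (coord j) J y = (if j < p then (if J = {} then y j else 0) else if J = {j - p} then 1 else 0)"
    if "y \<in> cube p c (3/5 * r)" for y J
    using that j by (auto simp: coord_def hat_cutoff_inner smooth_intros)
  show ?thesis
  proof (cases "k < p")
    case True
    let ?f = "\<lambda>y::nat \<Rightarrow> real. if j < p then (if I = {} then y j else 0) else if I = {j - p} then 1 else 0"
    have "((\<lambda>t. ?f (x(k := t))) has_field_derivative (if j = k \<and> I = {} then 1 else 0)) (at (x k))"
    proof (cases "j < p \<and> I = {}")
      case True
      then show ?thesis by (cases "j = k") simp_all
    next
      case False
      then have "\<not> (j = k \<and> I = {})" using \<open>k < p\<close> by auto
      then show ?thesis using False
        by (cases "j < p") (simp_all only: if_True if_False simp_thms DERIV_const)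
    qed
    then have "partial k (hat (coord j) I) x = (if j = k \<and> I = {} then 1 else 0)"
      using inner.partial_cong[of "hat (coord j) I" ?f k x] hat_coord True x
      by (simp add: partial_def DERIV_imp_deriv)
    then show ?thesis using True x cube_Q by (simp add: coord_partial_def even_partial_def)
  next
    case False
    have "insert (k - p) I = {j - p} \<longleftrightarrow> k = j \<and> I = {}" if "k - p \<notin> I" "\<not> j < p"
      using that False by auto
    then show ?thesis using False j by (auto simp: coord_partial_def odd_partial_def hat_coord[OF x])
  qed
qed

end

section \<open>Vector fields are determined by their values on coordinates\<close>

text \<open>A vector field that maps all coordinates to functions vanishing at \<open>y\<close> does so with every
  superfunction. The superfunctions with this property are closed under sums and products,
  and Hadamard's lemma reduces smooth functions to the coordinates.\<close>

locale coordinate_annihilator = cube_chart A p c r q hat B \<rho>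
  for A :: "'a salgebra" (structure) and p c r q hat B \<rho> +
  fixes L :: "'a \<Rightarrow> 'a" and a :: bit and y :: "nat \<Rightarrow> real"
  assumes L: "L \<in> hom_vector_fields A a"
    and y: "y \<in> cube p c (2/5 * r)"
    and L_coord: "\<And>k I. k < p + q \<Longrightarrow> hat (L (coord k)) I y = 0"
begin

definition killed :: "'a \<Rightarrow> bool"
  where "killed g \<longleftrightarrow> g \<in> carrier A \<and> (\<forall>I. hat (L g) I y = 0)"

lemma y_Q: "y \<in> Q" "y \<in> cube p c (3/5 * r)"
  using cube_Q(2,4)[OF y] by blast+

lemma finite_index: "\<not> finite I \<Longrightarrow> f \<in> carrier A \<Longrightarrow> hat f I x = 0"
  using hat_outside[of f I x] finite_subset[of I "{..<q}"] by blast

lemma L_closed [simp]: "g \<in> carrier A \<Longrightarrow> L g \<in> carrier A"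
  by (rule hvf_closed[OF L])

lemma killed_add: "\<lbrakk>killed f; killed g\<rbrakk> \<Longrightarrow> killed (f \<oplus> g)"
  unfolding killed_def by (simp add: hvf_add[OF L] hat_add)

lemma killed_diff: "\<lbrakk>killed f; killed g\<rbrakk> \<Longrightarrow> killed (f \<ominus> g)"
  unfolding killed_def by (simp add: hvf_diff[OF L] hat_diff)

lemma killed_smult: "killed f \<Longrightarrow> killed (k \<odot> f)"
  unfolding killed_def by (simp add: hvf_smult[OF L] hat_smult)

lemma killed_one: "killed \<one>"
proof -
  have "L (\<one> \<otimes> \<one>) = L \<one> \<otimes> \<one> \<oplus> signed A (a * 0) (\<one> \<otimes> L \<one>)"
    by (rule hvf_mult[OF L one_grade one_closed])
  then have "L \<one> = L \<one> \<oplus> L \<one>" by (simp add: signed_def)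
  then have "L \<one> = \<zero>" by simp
  then show ?thesis by (simp add: killed_def hat_zero)
qed

lemma killed_mult:
  assumes f: "f \<in> grade A e" "killed f" and g: "g \<in> carrier A"
    and "killed g \<or> (\<forall>J. hat f J y = 0)"
  shows "killed (f \<otimes> g)"
proof -
  have "hat (L (f \<otimes> g)) I y = 0" for I
  proof -
    have "family_mult (hat (L f)) (hat g) I y = 0"
      using f(2) unfolding family_mult_def killed_def by simp
    moreover have "family_mult (hat f) (hat (L g)) I y = 0"
      using assms(4) unfolding family_mult_def killed_def by auto
    ultimately show ?thesis
      using f g by (simp add: hvf_mult[OF L f(1) g] hat_simps)
  qed
  then show ?thesis using f g by (simp add: killed_def)
qed

text \<open>Vector fields are local: for \<open>T\<close> equal to 1 at \<open>y\<close> and supported where \<open>g\<close> vanishes,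
  \<open>0 = L (T g) = L T g + T L g\<close>, and the first summand vanishes at \<open>y\<close>.\<close>

lemma killed_locally_zero:
  assumes g: "g \<in> carrier A" and zero: "\<And>I x. x \<in> cube p c (3/5 * r) \<Longrightarrow> hat g I x = 0"
  shows "killed g"
proof -
  have supp: "supported (single {} \<tau>)"
    using bumps_smooth bumps_zero by (intro single_supported) auto
  define T where "T = lift (single {} \<tau>)"
  have T: "T \<in> Zero" "hat T = single {} \<tau>" "T \<in> grade A 0"
    unfolding T_def using lift[OF supp] bumps_smooth by (auto intro!: lift_grade supp single_grade)
  have hatT: "hat T J x = 0" if "J \<noteq> {}" for J x using T(2) that by (simp add: single_def)
  have "T \<otimes> g = \<zero>"
  proof (rule Zero_eqI)
    fix I x
    show "hat (T \<otimes> g) I x = hat \<zero> I x"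
    proof (cases "finite I \<and> x \<in> Q")
      case True
      have "\<tau> x * hat g I x = 0"
      proof (cases "x \<in> cube p c (3/5 * r)")
        case False
        then obtain i where "i < p" "3/5 * r \<le> \<bar>x i - c i\<bar>"
          using True by (auto simp: cube_def not_less)
        then show ?thesis using bumps_zero(2) by simp
      qed (simp add: zero)
      then show ?thesis
        using True g T family_mult_scalar_left[of I "hat T" x "hat g"] hatT
        by (simp add: hat_mult hat_zero) (simp add: single_def)
    next
      case False
      then show ?thesis
        using hat_outside[of "T \<otimes> g" I x] finite_index[of I "T \<otimes> g" x] T(1) g by (auto simp: hat_zero)
    qed
  qed (use T g in \<open>simp_all add: Zero_ops zero_Zero\<close>)
  then have L0: "L T \<otimes> g \<oplus> T \<otimes> L g = \<zero>"
    using hvf_mult[OF L T(3) g] hvf_zero[OF L] by (simp add: signed_def)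
  have "hat (L g) I y = 0" for I
  proof (cases "finite I")
    case True
    have "hat (L T \<otimes> g \<oplus> T \<otimes> L g) I y = family_mult (hat (L T)) (hat g) I y + family_mult (hat T) (hat (L g)) I y"
      using T(1) g by (simp add: hat_simps)
    moreover have "family_mult (hat (L T)) (hat g) I y = 0"
      using zero[OF y_Q(2)] by (simp add: family_mult_def)
    moreover have "family_mult (hat T) (hat (L g)) I y = hat (L g) I y"
      using family_mult_scalar_left[of I "hat T" y "hat (L g)"] hatT True T(2) bumps_one(2)[OF y] y_Q
      by (simp add: single_def)
    ultimately show ?thesis unfolding L0 by (simp add: hat_zero)
  qed (use g finite_index in simp)
  then show ?thesis using g by (simp add: killed_def)
qed

lemma killed_cong:
  assumes g: "g \<in> carrier A" and h: "killed h"
    and eq: "\<And>I x. x \<in> cube p c (3/5 * r) \<Longrightarrow> hat g I x = hat h I x"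
  shows "killed g"
proof -
  have hc: "h \<in> carrier A" using h by (simp add: killed_def)
  have "killed (g \<ominus> h)"
    using g hc eq by (intro killed_locally_zero) (simp_all add: hat_diff)
  then have "killed ((g \<ominus> h) \<oplus> h)" using h by (rule killed_add)
  moreover have "(g \<ominus> h) \<oplus> h = g"
    using g hc by (intro functionals_separate) (simp_all add: functional_simps)
  ultimately show ?thesis by simp
qed

lemma killed_coord: "k < p + q \<Longrightarrow> killed (coord k)"
  using coord_grade[of k] L_coord[of k] by (auto simp: killed_def)

text \<open>In \<open>h = h y + (\<Sum>k. (x\<^sub>k - y\<^sub>k) H\<^sub>k)\<close> both \<open>x\<^sub>k - y\<^sub>k\<close> and its image under \<open>L\<close> vanish at \<open>y\<close>, so the
  Leibniz rule shows that \<open>L\<close> maps each summand to a function that vanishes at \<open>y\<close>.\<close>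

lemma killed_smooth:
  assumes h: "smooth_on p Q h" shows "killed (cutoff {} h)"
proof -
  obtain H where H: "\<And>k. k < p \<Longrightarrow> smooth_on p Q (H k)"
    and h_eq: "\<And>x. x \<in> Q \<Longrightarrow> h x = h y + (\<Sum>k<p. (x k - y k) * H k x)"
    using hadamard[OF h y_Q(1)] by blast
  have "\<exists>R. killed R \<and> (\<forall>I. \<forall>x\<in>cube p c (3/5 * r).
      hat R I x = (if I = {} then (\<Sum>k<n. (x k - y k) * H k x) else 0))" if "n \<le> p" for n
    using that
  proof (induction n)
    case 0
    have "killed \<zero>" using killed_smult[OF killed_one, of 0] by simp
    then show ?case by (intro exI[of _ \<zero>]) (simp add: hat_zero)
  next
    case (Suc n)
    then obtain R where R: "killed R" and hatR: "\<And>I x. x \<in> cube p c (3/5 * r) \<Longrightarrow>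
        hat R I x = (if I = {} then (\<Sum>k<n. (x k - y k) * H k x) else 0)" by auto
    have Rc: "R \<in> carrier A" using R by (simp add: killed_def)
    have n: "n < p" using Suc by simp
    define f where "f = coord n \<ominus> y n \<odot> \<one>"
    have f: "f \<in> grade A 0"
      unfolding f_def using coord_grade[of n] n by (simp add: coord_parity_def grade_diff grade_smult one_grade)
    have hatf: "hat f J x = (if J = {} then x n - y n else 0)" if "x \<in> cube p c (3/5 * r)" for J x
      unfolding f_def using coord_grade[of n] n that cube_Q
      by (simp add: hat_simps coord_def hat_cutoff_inner smooth_intros cutoff_closed)
    have "killed f" unfolding f_def using n by (intro killed_diff killed_coord killed_smult killed_one) simp
    then have "killed (f \<otimes> cutoff {} (H n))"
      using hatf[OF y_Q(2)] H[OF n] by (intro killed_mult[OF f]) (simp_all add: cutoff_closed)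
    then have "killed (R \<oplus> f \<otimes> cutoff {} (H n))" using R by (intro killed_add)
    moreover have "hat (R \<oplus> f \<otimes> cutoff {} (H n)) I x
        = (if I = {} then (\<Sum>k<Suc n. (x k - y k) * H k x) else 0)" if x: "x \<in> cube p c (3/5 * r)" for I x
    proof (cases "finite I")
      case True
      have "family_mult (hat f) (hat (cutoff {} (H n))) I x = hat f {} x * hat (cutoff {} (H n)) I x"
        using True hatf[OF x] by (intro family_mult_scalar_left) simp_all
      then show ?thesis
        using f Rc H[OF n] x by (simp add: hat_simps cutoff_closed hatR hatf hat_cutoff_inner)
    next
      case False
      then show ?thesis
        using finite_index[of I "R \<oplus> f \<otimes> cutoff {} (H n)" x] Rc f H[OF n] by (auto simp: cutoff_closed)
    qed
    ultimately show ?case by blast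
  qed
  then obtain R where R: "killed R" and hatR: "\<And>I x. x \<in> cube p c (3/5 * r) \<Longrightarrow>
        hat R I x = (if I = {} then (\<Sum>k<p. (x k - y k) * H k x) else 0)" by blast
  have Rc: "R \<in> carrier A" using R by (simp add: killed_def)
  have "killed (h y \<odot> \<one> \<oplus> R)" using R by (intro killed_add killed_smult killed_one)
  then show ?thesis
  proof (rule killed_cong[rotated])
    fix I x assume x: "x \<in> cube p c (3/5 * r)"
    then show "hat (cutoff {} h) I x = hat (h y \<odot> \<one> \<oplus> R) I x"
      using Rc h_eq[OF cube_Q(1)[OF x]] cube_Q(1)[OF x] by (simp add: hat_cutoff_inner h hat_simps hatR)
  qed (simp add: cutoff_closed h)
qed

text \<open>By induction on \<open>I\<close>: near \<open>y\<close>, adding \<open>l\<close> to \<open>I\<close> means multiplication by \<open>\<theta>\<^sub>l\<close>, up to sign.\<close>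

lemma killed_cutoff:
  assumes h: "smooth_on p Q h" and I: "I \<subseteq> {..<q}" shows "killed (cutoff I h)"
proof -
  have "finite I" using I finite_subset by blast
  then show ?thesis using I
  proof (induction I rule: finite_induct)
    case empty
    show ?case by (rule killed_smooth[OF h])
  next
    case (insert l I)
    have l: "p + l < p + q" "coord (p + l) \<in> grade A 1" using insert.prems coord_grade[of "p + l"]
      by (auto simp: coord_parity_def)
    have hatl: "hat (coord (p + l)) J x = (if J = {l} then 1 else 0)" if "x \<in> cube p c (3/5 * r)" for J x
      using l that by (simp add: coord_def hat_cutoff_inner smooth_intros)
    define g where "g = grassmann_sign {l} I \<odot> (coord (p + l) \<otimes> cutoff I h)"
    have I: "I \<subseteq> {..<q}" using insert.prems by simp
    have "killed g" unfolding g_def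
      using insert.IH[OF I] l cutoff_closed[OF I h] by (intro killed_smult killed_mult[OF l(2)] killed_coord) simp_all
    then show ?case
    proof (rule killed_cong[rotated])
      fix J x assume x: "x \<in> cube p c (3/5 * r)"
      show "hat (cutoff (insert l I) h) J x = hat g J x"
      proof (cases "finite J")
        case True
        have "family_mult (hat (coord (p + l))) (hat (cutoff I h)) J x = (if l \<in> J then
            grassmann_sign {l} (J - {l}) * hat (coord (p + l)) {l} x * hat (cutoff I h) (J - {l}) x else 0)"
          using True hatl[OF x] by (intro family_mult_theta_left) simp_all
        also have "\<dots> = (if J = insert l I then grassmann_sign {l} I * h x else 0)"
          using x insert.hyps hatl[OF x] by (auto simp: hat_cutoff_inner[OF I h])
        finally show ?thesis
          unfolding g_def using l x I by (simp add: hat_simps cutoff_closed h hat_cutoff_inner[OF insert.prems h])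
      next
        case False
        then show ?thesis
          using finite_index[of J g x] finite_index[of J "cutoff (insert l I) h" x] \<open>killed g\<close>
            cutoff_closed[OF insert.prems h] by (simp add: killed_def)
      qed
    qed (rule cutoff_closed[OF insert.prems h])
  qed
qed

text \<open>Near \<open>y\<close>, every superfunction is the sum of its cut-off components.\<close>

lemma all_killed:
  assumes g: "g \<in> carrier A" shows "hat (L g) I y = 0"
proof -
  have "\<exists>R. killed R \<and> (\<forall>J. \<forall>x\<in>cube p c (3/5 * r). hat R J x = (if J \<in> \<I> then hat g J x else 0))"
    if "finite \<I>" "\<I> \<subseteq> Pow {..<q}" for \<I>
    using that
  proof (induction \<I> rule: finite_induct)
    case empty
    have "killed \<zero>" using killed_smult[OF killed_one, of 0] by simp
    then show ?case by (intro exI[of _ \<zero>]) (simp add: hat_zero)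
  next
    case (insert I \<I>)
    then obtain R where R: "killed R"
      "\<And>J x. x \<in> cube p c (3/5 * r) \<Longrightarrow> hat R J x = (if J \<in> \<I> then hat g J x else 0)" by auto
    have I: "I \<subseteq> {..<q}" using insert.prems by simp
    have "killed (R \<oplus> cutoff I (hat g I))"
      using R(1) hat_smooth[OF g] I by (intro killed_add killed_cutoff)
    moreover have "hat (R \<oplus> cutoff I (hat g I)) J x = (if J \<in> insert I \<I> then hat g J x else 0)"
      if "x \<in> cube p c (3/5 * r)" for J x
      using R that insert.hyps hat_smooth[OF g] I
      by (auto simp: killed_def hat_add cutoff_closed hat_cutoff_inner)
    ultimately show ?case by blast
  qed
  from this[of "Pow {..<q}"] obtain R where R: "killed R"
    "\<And>J x. x \<in> cube p c (3/5 * r) \<Longrightarrow> hat R J x = (if J \<in> Pow {..<q} then hat g J x else 0)" by auto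
  have "killed g"
    using R(2) hat_outside[OF g] by (intro killed_cong[OF g R(1)]) auto
  then show ?thesis by (simp add: killed_def)
qed

end

context cube_chart
begin

definition plateau_function :: 'a
  where "plateau_function = lift (single {} \<beta>)"

lemma plateau_supported: "supported (single {} \<beta>)"
  using bumps_smooth bumps_zero by (intro single_supported) auto

lemma plateau_function: "plateau_function \<in> Zero" "plateau_function \<in> grade A 0"
  "hat plateau_function = single {} \<beta>"
  unfolding plateau_function_def using plateau_supported bumps_smooth
  by (auto intro!: lift lift_grade single_grade)

text \<open>Where \<open>\<beta>\<close> is not zero, the coordinates are uncut, so the difference of the two sides annihilates
  them and vanishes there; where \<open>\<beta>\<close> is zero, so are both sides.\<close>

lemma coordinate_expansion:
  assumes Y: "Y \<in> HV a"
  shows "vf_scale A plateau_function Y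
    = vf_sum (\<lambda>k. vf_scale A (Y (coord k)) (local_field (coord_partial k))) (p + q)"
proof -
  define V where "V k = vf_scale A (Y (coord k)) (local_field (coord_partial k))" for k
  define W where "W = vf_sum V (p + q)"
  have d: "local_derivation (coord_parity k) (coord_partial k)" if "k < p + q" for k
    using that by (rule coord_partial_derivation)
  have coord: "coord k \<in> carrier A" if "k < p + q" for k using coord_grade[OF that] by simp
  have V: "V k \<in> HV a" if "k < p + q" for k
  proof -
    have "V k \<in> HV (a + coord_parity k + coord_parity k)"
      unfolding V_def using that by (intro vf_scale_hvf hvf_grade[OF Y] coord_grade local_field_hvf d)
    then show ?thesis by (simp add: add.assoc)
  qed
  have W: "W \<in> HV a" unfolding W_def by (rule vf_sum_hvf[OF V])
  have bY: "vf_scale A plateau_function Y \<in> HV a"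
    using vf_scale_hvf[OF plateau_function(2) Y] by simp
  have hatW: "hat (W g) I x = (\<Sum>k<p + q. \<beta> x * family_mult (hat (Y (coord k))) (coord_partial k (hat g)) I x)"
    if g: "g \<in> carrier A" for g I x
  proof -
    have "hat (W g) I x = (\<Sum>k<p + q. hat (V k g) I x)"
      unfolding W_def by (rule hat_vf_sum[OF V g])
    also have "\<dots> = (\<Sum>k<p + q. \<beta> x * family_mult (hat (Y (coord k))) (coord_partial k (hat g)) I x)"
    proof (intro sum.cong refl)
      fix k assume "k \<in> {..<p + q}"
      then have k: "k < p + q" by simp
      have "local_field (coord_partial k) g \<in> carrier A" using local_field_Zero[OF d[OF k] g] by simp
      moreover have "Y (coord k) \<in> carrier A" by (rule hvf_closed[OF Y coord[OF k]])
      ultimately show "hat (V k g) I x = \<beta> x * family_mult (hat (Y (coord k))) (coord_partial k (hat g)) I x"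
        unfolding V_def using g
        by (simp add: hat_mult hat_local_field[OF d[OF k] g])
          (simp add: family_mult_def sum_distrib_left algebra_simps)
    qed
    finally show ?thesis .
  qed
  have hatbY: "hat (vf_scale A plateau_function Y g) I x = \<beta> x * hat (Y g) I x"
    if g: "g \<in> carrier A" for g I x
  proof (cases "finite I \<and> x \<in> Q")
    case True
    then show ?thesis
      using g plateau_function Y family_mult_scalar_left[of I "hat plateau_function" x "hat (Y g)"]
      by (simp add: hat_mult plateau_function(3) single_def)
  next
    case False
    then have "\<not> I \<subseteq> {..<q} \<or> x \<notin> Q" using finite_subset by blast
    then have "hat h I x = 0" if "h \<in> carrier A" for h using hat_outside[OF that] by blast
    then show ?thesis using hvf_closed[OF bY g] hvf_closed[OF Y g] by simp
  qed
  define L where "L = vf_diff A (vf_scale A plateau_function Y) W"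
  have L: "L \<in> HV a" unfolding L_def by (rule vf_diff_hvf[OF bY W])
  have hatL: "hat (L g) I x = \<beta> x * hat (Y g) I x - hat (W g) I x" if g: "g \<in> carrier A" for g I x
    using hatbY[OF g] hvf_closed[OF bY g] hvf_closed[OF W g] g unfolding L_def by (simp add: hat_diff)
  have L_coord: "hat (L (coord j)) I y = 0" if y: "y \<in> cube p c (2/5 * r)" and j: "j < p + q" for y I j
  proof (cases "I \<subseteq> {..<q}")
    case True
    then have fin: "finite I" using finite_subset by blast
    have y3: "y \<in> cube p c (3/5 * r)" using cube_Q(4)[OF y] .
    have "hat (W (coord j)) I y = (\<Sum>k<p + q. if k = j then \<beta> y * hat (Y (coord j)) I y else 0)"
      unfolding hatW[OF coord[OF j]]
    proof (intro sum.cong refl)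
      fix k assume "k \<in> {..<p + q}"
      then have k: "k < p + q" by simp
      have "coord_partial k (hat (coord j)) J y = 0" if "J \<noteq> {}" for J
      proof (cases "J \<subseteq> {..<q}")
        case True then show ?thesis using coord_partial_coord[OF k j y3 True] that by simp
      next
        case False
        have "coord_partial k (hat (coord j)) \<in> carrier S"
          by (rule local_derivation_carrier[OF d[OF k] hat_carrier[OF coord[OF j]]])
        then show ?thesis using False unfolding superdomain_sec_carrier by blast
      qed
      then have "family_mult (hat (Y (coord k))) (coord_partial k (hat (coord j))) I y
          = hat (Y (coord k)) I y * coord_partial k (hat (coord j)) {} y"
        by (intro family_mult_scalar_right fin)
      then show "\<beta> y * family_mult (hat (Y (coord k))) (coord_partial k (hat (coord j))) I y
          = (if k = j then \<beta> y * hat (Y (coord j)) I y else 0)"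
        using coord_partial_coord[OF k j y3, of "{}"] by auto
    qed
    then show ?thesis using hatL[OF coord[OF j]] j by simp
  next
    case False
    then show ?thesis using hat_outside[of "L (coord j)" I y] hvf_closed[OF L coord[OF j]] by blast
  qed
  have Wzero: "W g \<in> Zero" if g: "g \<in> carrier A" for g
  proof -
    have "vf_sum V n g \<in> Zero" if "n \<le> p + q" for n
      using that
    proof (induction n)
      case (Suc n)
      then have n: "n < p + q" by simp
      have "V n g \<in> Zero"
        unfolding V_def using g local_field_Zero[OF d[OF n] g] hvf_closed[OF Y coord[OF n]]
        by (simp add: Zero_ops)
      then show ?case using Suc g by (simp add: Zero_ops)
    qed (simp add: g zero_Zero)
    then show ?thesis unfolding W_def by blast
  qed
  show ?thesis
    unfolding V_def[symmetric] W_def[symmetric]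
  proof (rule extensional_eqI)
    fix g assume g: "g \<in> carrier A"
    show "vf_scale A plateau_function Y g = W g"
    proof (rule Zero_eqI)
      show "vf_scale A plateau_function Y g \<in> Zero"
        using g plateau_function(1) hvf_closed[OF Y g] by (simp add: Zero_ops)
      show "W g \<in> Zero" by (rule Wzero[OF g])
      fix I x
      have "hat (L g) I x = 0"
      proof (cases "x \<in> cube p c (2/5 * r)")
        case True
        interpret coordinate_annihilator A p c r q hat B \<rho> L a x
          by unfold_locales (use L True L_coord in auto)
        show ?thesis by (rule all_killed[OF g])
      next
        case False
        have "\<beta> x = 0 \<or> x \<notin> Q"
        proof (cases "x \<in> Q")
          case True
          then obtain i where "i < p" "2/5 * r \<le> \<bar>x i - c i\<bar>"
            using False by (auto simp: cube_def not_less)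
          then show ?thesis using bumps_zero(1) by blast
        qed simp
        then show ?thesis
          using hatL[OF g] hatW[OF g] hat_outside[OF hvf_closed[OF L g]] by auto
      qed
      then show "hat (vf_scale A plateau_function Y g) I x = hat (W g) I x"
        using hatL[OF g] hatbY[OF g] by simp
    qed
  qed (use hvf_extensional[OF W] in simp_all)
qed

end

section \<open>Patching connections\<close>

context superalgebra
begin

lemma vf_sum_eval_closed:
  "\<lbrakk>g \<in> carrier A; \<And>k. k < n \<Longrightarrow> V k g \<in> carrier A\<rbrakk> \<Longrightarrow> vf_sum V n g \<in> carrier A"
  by (induction n) simp_all

lemma vf_sum_eval_add:
  assumes "g \<in> carrier A" "\<And>k. k < n \<Longrightarrow> V k g = U k g \<oplus> W k g"
    "\<And>k. k < n \<Longrightarrow> U k g \<in> carrier A" "\<And>k. k < n \<Longrightarrow> W k g \<in> carrier A"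
  shows "vf_sum V n g = vf_sum U n g \<oplus> vf_sum W n g"
  using assms(2-)
proof (induction n)
  case (Suc n)
  have "vf_sum U n g \<in> carrier A" "vf_sum W n g \<in> carrier A"
    using assms(1) Suc.prems by (intro vf_sum_eval_closed; simp)+
  moreover have "U n g \<in> carrier A" "W n g \<in> carrier A" "V n g = U n g \<oplus> W n g"
    "vf_sum V n g = vf_sum U n g \<oplus> vf_sum W n g"
    using Suc.prems Suc.IH by simp_all
  ultimately show ?case using assms(1) by (simp add: a_ac)
qed (simp add: assms(1))

lemma vf_sum_eval_mult:
  assumes "g \<in> carrier A" "f \<in> carrier A" "\<And>k. k < n \<Longrightarrow> V k g = f \<otimes> U k g"
    "\<And>k. k < n \<Longrightarrow> U k g \<in> carrier A"
  shows "vf_sum V n g = f \<otimes> vf_sum U n g"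
  using assms(3-)
proof (induction n)
  case (Suc n)
  have "vf_sum U n g \<in> carrier A"
    using assms(1) Suc.prems by (intro vf_sum_eval_closed; simp)
  moreover have "U n g \<in> carrier A" "V n g = f \<otimes> U n g" "vf_sum V n g = f \<otimes> vf_sum U n g"
    using Suc.prems Suc.IH by simp_all
  ultimately show ?case using assms(1,2) by (simp add: r_distr)
qed (simp add: assms(1,2))

text \<open>Even elements commute with everything, which lets the even weights below pass superfunctions
  without signs.\<close>

lemma even_central:
  assumes "x \<in> grade A 0" "f \<in> carrier A" shows "x \<otimes> f = f \<otimes> x"
proof -
  obtain f0 f1 where f: "f0 \<in> grade A 0" "f1 \<in> grade A 1" "f = f0 \<oplus> f1" using grade_decompose[OF assms(2)] .
  then show ?thesis
    using assms(1) supercomm[OF assms(1) f(1)] supercomm[OF assms(1) f(2)]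
    by (simp add: l_distr r_distr signed_def)
qed

end

text \<open>A countable open cover as seen from the algebra \<open>A\<close> of global superfunctions: \<open>\<rho> n\<close> restricts to
  the \<open>n\<close>-th set, on which \<open>b n\<close> is 1. The fields \<open>d n k\<close> play the part of \<open>b n\<close> times the partial
  derivatives with respect to the coordinates \<open>x n k\<close>.\<close>

locale patched_superalgebra = superalgebra A for A :: "'a salgebra" (structure) +
  fixes B :: "nat \<Rightarrow> 'a salgebra" and \<rho> :: "nat \<Rightarrow> 'a \<Rightarrow> 'a" and b :: "nat \<Rightarrow> 'a"
    and m :: "nat \<Rightarrow> nat" and x :: "nat \<Rightarrow> nat \<Rightarrow> 'a" and d :: "nat \<Rightarrow> nat \<Rightarrow> 'a \<Rightarrow> 'a"
    and u :: "nat \<Rightarrow> nat \<Rightarrow> bit"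
  assumes B: "superalgebra (B n)"
    and \<rho>: "\<rho> n \<in> salgebra_hom A (B n)"
    and separated: "\<lbrakk>f \<in> carrier A; g \<in> carrier A; \<And>n. \<rho> n f = \<rho> n g\<rbrakk> \<Longrightarrow> f = g"
    and glue: "\<lbrakk>\<And>n. s n \<in> carrier A; \<And>n k. n \<le> k \<Longrightarrow> \<rho> n (s k) = \<rho> n (s n)\<rbrakk> \<Longrightarrow>
      \<exists>f\<in>carrier A. \<forall>n. \<rho> n f = \<rho> n (s n)"
    and b: "b n \<in> grade A 0"
    and \<rho>_b: "\<rho> n (b n) = \<one>\<^bsub>B n\<^esub>"
    and x: "k < m n \<Longrightarrow> x n k \<in> grade A (u n k)"
    and d: "k < m n \<Longrightarrow> d n k \<in> hom_vector_fields A (u n k)"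
    and expansion: "Y \<in> hom_vector_fields A a \<Longrightarrow>
      vf_scale A (b n) Y = vf_sum (\<lambda>k. vf_scale A (Y (x n k)) (d n k)) (m n)"
begin

lemmas \<rho>_simps = salgebra_homD(1-5)[OF \<rho>]
lemmas \<rho>_grade = salgebra_homD(6)[OF \<rho>]

lemma b_closed [simp]: "b n \<in> carrier A"
  using b[of n] by simp

lemma x_closed: "k < m n \<Longrightarrow> x n k \<in> carrier A"
  by (rule grade_closed[OF x])

lemma \<rho>_zero: "\<rho> n \<zero> = \<zero>\<^bsub>B n\<^esub>"
proof -
  interpret B: superalgebra "B n" by (rule B)
  show ?thesis using \<rho>_simps(5)[of \<zero> n 0] \<rho>_simps(1)[of \<zero> n] by simp
qed

text \<open>The factor \<open>1 - b n\<close> makes all later weights vanish on the \<open>n\<close>-th set. The products of \<open>weight n\<close>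
  and \<open>b n\<close> hence are a locally finite family, and it is a partition of unity by telescoping.\<close>

primrec weight :: "nat \<Rightarrow> 'a" where
  "weight 0 = \<one>"
| "weight (Suc n) = weight n \<otimes> (\<one> \<ominus> b n)"

lemma weight_even: "weight n \<in> grade A 0"
proof (induction n)
  case (Suc n)
  then show ?case using grade_mult[of "weight n" 0 "\<one> \<ominus> b n" 0] grade_diff[OF one_grade b] by simp
qed (simp add: one_grade)

lemma weight_closed [simp]: "weight n \<in> carrier A"
  using weight_even[of n] by simp

lemma \<rho>_weight: "n < k \<Longrightarrow> \<rho> n (weight k) = \<zero>\<^bsub>B n\<^esub>"
proof (induction k)
  case (Suc k)
  interpret B: superalgebra "B n" by (rule B)
  have "\<rho> n (weight (Suc k)) = \<rho> n (weight k) \<otimes>\<^bsub>B n\<^esub> \<rho> n (\<one> \<ominus> b k)"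
    by (simp add: \<rho>_simps)
  also have "\<dots> = \<zero>\<^bsub>B n\<^esub>"
  proof (cases "n = k")
    case True
    have "\<rho> n (\<one> \<ominus> b n) = \<one>\<^bsub>B n\<^esub> \<oplus>\<^bsub>B n\<^esub> (- 1) \<odot>\<^bsub>B n\<^esub> \<one>\<^bsub>B n\<^esub>"
      by (simp add: minus_eq_smult \<rho>_simps(2,4,5) \<rho>_b)
    also have "\<dots> = \<zero>\<^bsub>B n\<^esub>" by (simp add: B.smult_minus_1 B.r_neg)
    finally have "\<rho> n (\<one> \<ominus> b k) = \<zero>\<^bsub>B n\<^esub>" unfolding True .
    then show ?thesis using \<rho>_simps(1)[of "weight k" n] by simp
  next
    case False
    then show ?thesis using Suc \<rho>_simps(1)[of "\<one> \<ominus> b k" n] by simp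
  qed
  finally show ?case .
qed simp

primrec partial_sum :: "(nat \<Rightarrow> 'a) \<Rightarrow> nat \<Rightarrow> 'a" where
  "partial_sum t 0 = \<zero>"
| "partial_sum t (Suc n) = partial_sum t n \<oplus> weight n \<otimes> t n"

lemma partial_sum_closed [simp]: "(\<And>n. t n \<in> carrier A) \<Longrightarrow> partial_sum t n \<in> carrier A"
  by (induction n) simp_all

lemma \<rho>_partial_sum:
  assumes t: "\<And>n. t n \<in> carrier A" and "n \<le> k"
  shows "\<rho> n (partial_sum t (Suc k)) = \<rho> n (partial_sum t (Suc n))"
  using assms(2)
proof (induction k rule: dec_induct)
  case (step k)
  interpret B: superalgebra "B n" by (rule B)
  have "\<rho> n (partial_sum t (Suc (Suc k))) = \<rho> n (partial_sum t (Suc k)) \<oplus>\<^bsub>B n\<^esub>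
      \<rho> n (weight (Suc k)) \<otimes>\<^bsub>B n\<^esub> \<rho> n (t (Suc k))"
    using t by (simp only: partial_sum.simps(2)[of t "Suc k"] \<rho>_simps(2,3) partial_sum_closed
        weight_closed m_closed)
  also have "\<dots> = \<rho> n (partial_sum t (Suc k))"
    using \<rho>_weight[of n "Suc k"] step.hyps \<rho>_simps(1)[OF t] \<rho>_simps(1)[OF partial_sum_closed[of t "Suc k", OF t]]
    by (simp del: partial_sum.simps weight.simps)
  finally show ?case using step.IH by simp
qed simp

text \<open>The sum of the products of \<open>weight n\<close> and \<open>t n\<close>: on the \<open>n\<close>-th set all terms after the \<open>n\<close>-th
  one vanish.\<close>

definition Sum :: "(nat \<Rightarrow> 'a) \<Rightarrow> 'a"
  where "Sum t = (SOME f. f \<in> carrier A \<and> (\<forall>n. \<rho> n f = \<rho> n (partial_sum t (Suc n))))"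

lemma Sum:
  assumes "\<And>n. t n \<in> carrier A"
  shows Sum_closed: "Sum t \<in> carrier A" and \<rho>_Sum: "\<rho> n (Sum t) = \<rho> n (partial_sum t (Suc n))"
proof -
  have "\<exists>f\<in>carrier A. \<forall>n. \<rho> n f = \<rho> n (partial_sum t (Suc n))"
    by (intro glue partial_sum_closed \<rho>_partial_sum assms)
  then have "\<exists>f. f \<in> carrier A \<and> (\<forall>n. \<rho> n f = \<rho> n (partial_sum t (Suc n)))" by blast
  then have "Sum t \<in> carrier A \<and> (\<forall>n. \<rho> n (Sum t) = \<rho> n (partial_sum t (Suc n)))"
    unfolding Sum_def by (rule someI_ex)
  then show "Sum t \<in> carrier A" "\<rho> n (Sum t) = \<rho> n (partial_sum t (Suc n))" by blast+
qed

lemma Sum_eqI: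
  assumes "\<And>n. t n \<in> carrier A" "f \<in> carrier A" "\<And>n. \<rho> n f = \<rho> n (partial_sum t (Suc n))"
  shows "Sum t = f"
proof (rule separated)
  show "\<rho> n (Sum t) = \<rho> n f" for n unfolding \<rho>_Sum[OF assms(1)] assms(3) ..
qed (fact Sum_closed[OF assms(1)] assms(2))+

lemma Sum_add:
  assumes t: "\<And>n. t n \<in> carrier A" and s: "\<And>n. s n \<in> carrier A"
  shows "Sum (\<lambda>n. t n \<oplus> s n) = Sum t \<oplus> Sum s"
proof (rule Sum_eqI)
  have "partial_sum (\<lambda>n. t n \<oplus> s n) n = partial_sum t n \<oplus> partial_sum s n" for n
    using t s by (induction n) (simp_all add: r_distr a_ac)
  then show "\<rho> n (Sum t \<oplus> Sum s) = \<rho> n (partial_sum (\<lambda>n. t n \<oplus> s n) (Suc n))" for n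
    using t s by (simp only: \<rho>_simps(2) Sum_closed \<rho>_Sum partial_sum_closed)
qed (use t s Sum_closed in simp_all)

lemma Sum_mult_left:
  assumes t: "\<And>n. t n \<in> carrier A" and f: "f \<in> carrier A"
  shows "Sum (\<lambda>n. f \<otimes> t n) = f \<otimes> Sum t"
proof (rule Sum_eqI)
  have "weight n \<otimes> (f \<otimes> t n) = f \<otimes> (weight n \<otimes> t n)" for n
    using t f even_central[OF weight_even f, of n] by (simp add: m_assoc[symmetric])
  then have "partial_sum (\<lambda>n. f \<otimes> t n) n = f \<otimes> partial_sum t n" for n
    using t f by (induction n) (simp_all add: r_distr)
  then show "\<rho> n (f \<otimes> Sum t) = \<rho> n (partial_sum (\<lambda>n. f \<otimes> t n) (Suc n))" for n
    using t f by (simp only: \<rho>_simps(3) Sum_closed \<rho>_Sum partial_sum_closed)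
qed (use t f Sum_closed in simp_all)

lemma Sum_mult_right:
  assumes t: "\<And>n. t n \<in> carrier A" and f: "f \<in> carrier A"
  shows "Sum (\<lambda>n. t n \<otimes> f) = Sum t \<otimes> f"
proof (rule Sum_eqI)
  have "partial_sum (\<lambda>n. t n \<otimes> f) n = partial_sum t n \<otimes> f" for n
    using t f by (induction n) (simp_all add: l_distr m_assoc)
  then show "\<rho> n (Sum t \<otimes> f) = \<rho> n (partial_sum (\<lambda>n. t n \<otimes> f) (Suc n))" for n
    using t f by (simp only: \<rho>_simps(3) Sum_closed \<rho>_Sum partial_sum_closed)
qed (use t f Sum_closed in simp_all)

lemma Sum_smult:
  assumes t: "\<And>n. t n \<in> carrier A" shows "Sum (\<lambda>n. r \<odot> t n) = r \<odot> Sum t"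
  using Sum_mult_left[OF t, of "r \<odot> \<one>"] t Sum_closed[OF t] by (simp add: smult_mult_left)

lemma Sum_signed:
  assumes t: "\<And>n. t n \<in> carrier A" shows "Sum (\<lambda>n. signed A e (t n)) = signed A e (Sum t)"
  using Sum_smult[OF t, of "sg e"] t Sum_closed[OF t] by (simp add: signed_eq_smult)

lemma Sum_grade:
  assumes t: "\<And>n. t n \<in> grade A e" shows "Sum t \<in> grade A e"
proof -
  have tc: "\<And>n. t n \<in> carrier A" by (rule grade_closed[OF t])
  obtain f0 f1 where f01: "f0 \<in> grade A 0" "f1 \<in> grade A 1" "Sum t = f0 \<oplus> f1"
    using grade_decompose[OF Sum_closed[OF tc]] .
  obtain f f' where f: "f \<in> grade A e" "f' \<in> grade A (e + 1)" "Sum t = f \<oplus> f'"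
  proof (cases e)
    case zero then show ?thesis using f01 that[of f0 f1] by simp
  next
    case one then show ?thesis using f01 that[of f1 f0] by (simp add: a_comm)
  qed
  have "f' = \<zero>"
  proof (rule separated)
    fix n
    interpret B: superalgebra "B n" by (rule B)
    have "partial_sum t k \<in> grade A e" for k
    proof (induction k)
      case (Suc k)
      then show ?case using grade_mult[OF weight_even t, of k k] by (simp add: grade_add)
    qed simp
    then have s: "\<rho> n (Sum t) \<in> grade (B n) e"
      unfolding \<rho>_Sum[OF tc] by (intro \<rho>_grade)
    have gr: "\<rho> n f \<in> grade (B n) e" "\<rho> n f' \<in> grade (B n) (e + 1)"
      using f by (auto intro: \<rho>_grade)
    have sum: "\<rho> n (Sum t) = \<rho> n f \<oplus>\<^bsub>B n\<^esub> \<rho> n f'"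
      unfolding f(3) using f by (simp add: \<rho>_simps(2))
    have "\<rho> n f' = \<rho> n (Sum t) \<ominus>\<^bsub>B n\<^esub> \<rho> n f"
      unfolding sum using gr by (intro B.functionals_separate) (simp_all add: B.functional_simps)
    then have "\<rho> n f' \<in> grade (B n) e" using s gr(1) by (simp add: B.grade_diff)
    then have "\<rho> n f' = \<zero>\<^bsub>B n\<^esub>" using gr(2) by (rule B.grade_disjoint) (cases e; simp)
    then show "\<rho> n f' = \<rho> n \<zero>" by (simp add: \<rho>_zero)
  qed (use f in simp_all)
  then show ?thesis using f by simp
qed

lemma Sum_partition:
  assumes f: "f \<in> carrier A" shows "Sum (\<lambda>n. b n \<otimes> f) = f"
proof (rule Sum_eqI)
  have eq: "partial_sum (\<lambda>n. b n \<otimes> f) n = f \<ominus> weight n \<otimes> f" for n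
  proof (induction n)
    case 0
    then show ?case using f by (simp add: a_minus_def r_neg)
  next
    case (Suc n)
    have "weight (Suc n) \<otimes> f = weight n \<otimes> f \<ominus> weight n \<otimes> (b n \<otimes> f)"
      using f by (simp add: mult_minus_right mult_minus_left m_assoc)
    then show ?case
      using f Suc by (simp del: weight.simps) (intro functionals_separate, simp_all add: functional_simps)
  qed
  show "\<rho> n f = \<rho> n (partial_sum (\<lambda>n. b n \<otimes> f) (Suc n))" for n
  proof -
    interpret B: superalgebra "B n" by (rule B)
    have "\<rho> n (f \<ominus> weight (Suc n) \<otimes> f) = \<rho> n f \<oplus>\<^bsub>B n\<^esub> (- 1) \<odot>\<^bsub>B n\<^esub> (\<rho> n (weight (Suc n)) \<otimes>\<^bsub>B n\<^esub> \<rho> n f)"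
      using f by (simp only: minus_eq_smult \<rho>_simps(2,3,5) m_closed weight_closed real_smult_closed)
    also have "\<dots> = \<rho> n f"
      using \<rho>_weight[of n "Suc n"] \<rho>_simps(1)[OF f, of n] by (simp del: weight.simps)
    finally show ?thesis unfolding eq by simp
  qed
qed (use f in simp_all)

definition vf_Sum :: "(nat \<Rightarrow> 'a \<Rightarrow> 'a) \<Rightarrow> 'a \<Rightarrow> 'a"
  where "vf_Sum V = (\<lambda>f\<in>carrier A. Sum (\<lambda>n. V n f))"

lemma vf_Sum_hvf:
  assumes V: "\<And>n. V n \<in> HV a" shows "vf_Sum V \<in> HV a"
proof (rule hvfI)
  note closed = hvf_closed[OF V]
  show "vf_Sum V \<in> extensional (carrier A)" by (simp add: vf_Sum_def)
  show "\<And>f. f \<in> carrier A \<Longrightarrow> vf_Sum V f \<in> carrier A" by (simp add: vf_Sum_def Sum_closed closed)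
  show "\<And>f g. \<lbrakk>f \<in> carrier A; g \<in> carrier A\<rbrakk> \<Longrightarrow> vf_Sum V (f \<oplus> g) = vf_Sum V f \<oplus> vf_Sum V g"
    by (simp add: vf_Sum_def hvf_add[OF V] Sum_add closed)
  show "\<And>r f. f \<in> carrier A \<Longrightarrow> vf_Sum V (r \<odot> f) = r \<odot> vf_Sum V f"
    by (simp add: vf_Sum_def hvf_smult[OF V] Sum_smult closed)
  show "\<And>e f. f \<in> grade A e \<Longrightarrow> vf_Sum V f \<in> grade A (a + e)"
    by (simp add: vf_Sum_def Sum_grade hvf_grade[OF V])
  fix e f g assume f: "f \<in> grade A e" and g: "g \<in> carrier A"
  have "Sum (\<lambda>n. V n f \<otimes> g \<oplus> signed A (a * e) (f \<otimes> V n g))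
      = Sum (\<lambda>n. V n f \<otimes> g) \<oplus> Sum (\<lambda>n. signed A (a * e) (f \<otimes> V n g))"
    using f g by (intro Sum_add) (simp_all add: closed)
  then show "vf_Sum V (f \<otimes> g) = vf_Sum V f \<otimes> g \<oplus> signed A (a * e) (f \<otimes> vf_Sum V g)"
    using f g by (simp add: vf_Sum_def hvf_mult[OF V f g] Sum_mult_right Sum_signed Sum_mult_left closed)
qed

text \<open>The connection for which the coordinate fields of the \<open>n\<close>-th patch are parallel, cut off by \<open>b n\<close>.\<close>

definition local_term :: "('a \<Rightarrow> 'a) \<Rightarrow> ('a \<Rightarrow> 'a) \<Rightarrow> nat \<Rightarrow> 'a \<Rightarrow> 'a"
  where "local_term X Y n = vf_sum (\<lambda>k. vf_scale A (X (Y (x n k))) (d n k)) (m n)"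

lemma local_term_hvf:
  assumes X: "X \<in> HV a" and Y: "Y \<in> HV c" shows "local_term X Y n \<in> HV (a + c)"
  unfolding local_term_def
proof (rule vf_sum_hvf)
  fix k assume k: "k < m n"
  have "vf_scale A (X (Y (x n k))) (d n k) \<in> HV (a + (c + u n k) + u n k)"
    by (intro vf_scale_hvf hvf_grade[OF X] hvf_grade[OF Y] x d k)
  moreover have "a + (c + u n k) + u n k = a + c" by (simp add: add.assoc)
  ultimately show "vf_scale A (X (Y (x n k))) (d n k) \<in> HV (a + c)" by simp
qed

lemma coefficient_closed:
  assumes "X \<in> HV a" "Y \<in> HV c" "k < m n" "g \<in> carrier A"
  shows "X (Y (x n k)) \<in> carrier A" "Y (x n k) \<in> carrier A" "d n k g \<in> carrier A"
  using assms x_closed[of k n] hvf_closed[OF d[of k n] assms(4)] by simp_all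

lemma local_term_add_left:
  assumes X: "X \<in> HV a" "X' \<in> HV a" and Y: "Y \<in> HV c" and g: "g \<in> carrier A"
  shows "local_term (vf_add A X X') Y n g = local_term X Y n g \<oplus> local_term X' Y n g"
  unfolding local_term_def using coefficient_closed[OF X(1) Y _ g] coefficient_closed[OF X(2) Y _ g] g
  by (intro vf_sum_eval_add) (simp_all add: l_distr)

lemma local_term_add_right:
  assumes X: "X \<in> HV a" and Y: "Y \<in> HV c" "Y' \<in> HV c" and g: "g \<in> carrier A"
  shows "local_term X (vf_add A Y Y') n g = local_term X Y n g \<oplus> local_term X Y' n g"
  unfolding local_term_def using coefficient_closed[OF X Y(1) _ g] coefficient_closed[OF X Y(2) _ g] g
  by (intro vf_sum_eval_add) (simp_all add: l_distr x_closed hvf_add[OF X])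

lemma local_term_scale_left:
  assumes X: "X \<in> HV a" and Y: "Y \<in> HV c" and f: "f \<in> carrier A" and g: "g \<in> carrier A"
  shows "local_term (vf_scale A f X) Y n g = f \<otimes> local_term X Y n g"
  unfolding local_term_def using coefficient_closed[OF X Y _ g] f g
  by (intro vf_sum_eval_mult) (simp_all add: m_assoc)

text \<open>The terms that differentiate \<open>f\<close> assemble to the coordinate expansion of \<open>b n Y\<close>. The Leibniz
  rule is off by the factor \<open>b n\<close> only, and these factors sum up to 1 with the weights.\<close>

lemma local_term_leibniz:
  assumes X: "X \<in> HV a" and Y: "Y \<in> HV c" and f: "f \<in> grade A e" and g: "g \<in> carrier A"
  shows "local_term X (vf_scale A f Y) n g
    = X f \<otimes> (b n \<otimes> Y g) \<oplus> signed A (a * e) (f \<otimes> local_term X Y n g)"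
proof -
  let ?U = "\<lambda>k. vf_scale A (Y (x n k)) (d n k)" and ?W = "\<lambda>k. vf_scale A (X (Y (x n k))) (d n k)"
  let ?s = "signed A (a * e) f"
  note closed = coefficient_closed[OF X Y _ g]
  have Xf: "X f \<in> carrier A" and fc: "f \<in> carrier A" using X f by simp_all
  have "local_term X (vf_scale A f Y) n g
      = vf_sum (\<lambda>k. vf_scale A (X f) (?U k)) (m n) g \<oplus> vf_sum (\<lambda>k. vf_scale A ?s (?W k)) (m n) g"
    unfolding local_term_def using g closed Xf fc
    by (intro vf_sum_eval_add) (simp_all add: x_closed hvf_mult[OF X f] l_distr m_assoc mult_signed_left)
  also have "vf_sum (\<lambda>k. vf_scale A (X f) (?U k)) (m n) g = X f \<otimes> vf_sum ?U (m n) g"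
    using g closed Xf by (intro vf_sum_eval_mult) simp_all
  also have "vf_sum ?U (m n) g = b n \<otimes> Y g"
    using fun_cong[OF expansion[OF Y, of n], of g] g by simp
  also have "vf_sum (\<lambda>k. vf_scale A ?s (?W k)) (m n) g = ?s \<otimes> vf_sum ?W (m n) g"
    using g closed fc by (intro vf_sum_eval_mult) simp_all
  also have "\<dots> = signed A (a * e) (f \<otimes> local_term X Y n g)"
    using fc hvf_closed[OF local_term_hvf[OF X Y] g, of n] by (simp add: local_term_def mult_signed_left)
  finally show ?thesis .
qed

theorem patched_connection: "graded_connection A (\<lambda>a c X Y. vf_Sum (local_term X Y))"
proof
  fix X Y a c assume X: "X \<in> HV a" and Y: "Y \<in> HV c"
  show "vf_Sum (local_term X Y) \<in> HV (a + c)"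
    by (intro vf_Sum_hvf local_term_hvf X Y)
  note closed = hvf_closed[OF local_term_hvf[OF X Y]]
  fix f e assume f: "f \<in> grade A e"
  show "vf_Sum (local_term (vf_scale A f X) Y) = vf_scale A f (vf_Sum (local_term X Y))"
  proof (intro extensional_eqI)
    fix g assume g: "g \<in> carrier A"
    then show "vf_Sum (local_term (vf_scale A f X) Y) g = vf_scale A f (vf_Sum (local_term X Y)) g"
      using f closed by (simp add: vf_Sum_def local_term_scale_left[OF X Y] Sum_mult_left)
  qed (simp_all add: vf_Sum_def)
  show "vf_Sum (local_term X (vf_scale A f Y)) = vf_add A (vf_scale A (X f) Y)
      (vf_signed A (a * e) (vf_scale A f (vf_Sum (local_term X Y))))"
  proof (intro extensional_eqI)
    fix g assume g: "g \<in> carrier A"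
    have Xf: "X f \<in> carrier A" "Y g \<in> carrier A" using X Y f g by simp_all
    have "Sum (\<lambda>n. X f \<otimes> (b n \<otimes> Y g) \<oplus> signed A (a * e) (f \<otimes> local_term X Y n g))
        = Sum (\<lambda>n. X f \<otimes> (b n \<otimes> Y g)) \<oplus> Sum (\<lambda>n. signed A (a * e) (f \<otimes> local_term X Y n g))"
      using Xf f g closed by (intro Sum_add) simp_all
    also have "Sum (\<lambda>n. X f \<otimes> (b n \<otimes> Y g)) = X f \<otimes> Y g"
      using Xf Sum_mult_left[of "\<lambda>n. b n \<otimes> Y g" "X f"] by (simp add: Sum_partition)
    also have "Sum (\<lambda>n. signed A (a * e) (f \<otimes> local_term X Y n g)) = signed A (a * e) (f \<otimes> Sum (\<lambda>n. local_term X Y n g))"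
      using f g closed by (simp add: Sum_signed Sum_mult_left)
    finally show "vf_Sum (local_term X (vf_scale A f Y)) g = vf_add A (vf_scale A (X f) Y)
      (vf_signed A (a * e) (vf_scale A f (vf_Sum (local_term X Y)))) g"
      using g by (simp add: vf_Sum_def local_term_leibniz[OF X Y f])
  qed (simp_all add: vf_Sum_def)
next
  fix X X' Y a c assume X: "X \<in> HV a" "X' \<in> HV a" and Y: "Y \<in> HV c"
  show "vf_Sum (local_term (vf_add A X X') Y) = vf_add A (vf_Sum (local_term X Y)) (vf_Sum (local_term X' Y))"
  proof (intro extensional_eqI)
    fix g assume g: "g \<in> carrier A"
    then show "vf_Sum (local_term (vf_add A X X') Y) g
        = vf_add A (vf_Sum (local_term X Y)) (vf_Sum (local_term X' Y)) g"
      using hvf_closed[OF local_term_hvf[OF X(1) Y] g] hvf_closed[OF local_term_hvf[OF X(2) Y] g]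
      by (simp add: vf_Sum_def local_term_add_left[OF X Y] Sum_add)
  qed (simp_all add: vf_Sum_def)
next
  fix X Y Y' a c assume X: "X \<in> HV a" and Y: "Y \<in> HV c" "Y' \<in> HV c"
  show "vf_Sum (local_term X (vf_add A Y Y')) = vf_add A (vf_Sum (local_term X Y)) (vf_Sum (local_term X Y'))"
  proof (intro extensional_eqI)
    fix g assume g: "g \<in> carrier A"
    then show "vf_Sum (local_term X (vf_add A Y Y')) g
        = vf_add A (vf_Sum (local_term X Y)) (vf_Sum (local_term X Y')) g"
      using hvf_closed[OF local_term_hvf[OF X Y(1)] g] hvf_closed[OF local_term_hvf[OF X Y(2)] g]
      by (simp add: vf_Sum_def local_term_add_right[OF X Y] Sum_add)
  qed (simp_all add: vf_Sum_def)
qed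

end

section \<open>Supermanifolds\<close>

lemma salgebra_hom_compose:
  "\<lbrakk>h \<in> salgebra_hom A B; k \<in> salgebra_hom B C\<rbrakk> \<Longrightarrow> (\<lambda>x. k (h x)) \<in> salgebra_hom A C"
  unfolding salgebra_hom_def
  by (auto intro!: ring_hom_memI simp: ring_hom_closed ring_hom_mult ring_hom_add ring_hom_one image_subset_iff)

lemma cube_neighbourhood:
  assumes V: "openin (Euclidean_space p) V" and c: "c \<in> V"
  shows "\<exists>r>0. cube p c r \<subseteq> V"
proof -
  obtain T where T: "openin (powertop_real UNIV) T" "V = T \<inter> {x. \<forall>i\<ge>p. x i = 0}"
    using V unfolding Euclidean_space_def openin_subtopology by auto
  have "c \<in> T" using c T by auto
  then obtain U where "\<forall>i\<in>UNIV. openin euclideanreal (U i)"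
      and U': "c \<in> Pi\<^sub>E UNIV U" "Pi\<^sub>E UNIV U \<subseteq> T"
    using T(1) unfolding openin_product_topology_alt by meson
  then have U: "open (U i)" for i by (intro open_openin[THEN iffD2]) blast
  have "\<exists>e>0. \<forall>t. \<bar>t - c i\<bar> < e \<longrightarrow> t \<in> U i" for i
  proof -
    have "c i \<in> U i" using U'(1) by (rule PiE_mem) simp
    then show ?thesis using U[of i] unfolding open_dist dist_real_def by blast
  qed
  then obtain e where e: "\<And>i. e i > 0" "\<And>i t. \<bar>t - c i\<bar> < e i \<Longrightarrow> t \<in> U i" by metis
  define r where "r = Min (insert 1 (e ` {..<p}))"
  have "r > 0" using e(1) by (auto simp: r_def)
  moreover have "cube p c r \<subseteq> V"
  proof
    fix x assume x: "x \<in> cube p c r"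
    have "x i \<in> U i" for i
    proof (cases "i < p")
      case True
      then have "r \<le> e i" by (simp add: r_def)
      then show ?thesis using x True e(2)[of "x i" i] by (auto simp: cube_def)
    next
      case False
      then have "x i = c i" using x c T by (auto simp: cube_def topspace_Euclidean)
      then show ?thesis using U'(1) by auto
    qed
    then have "x \<in> T" using U'(2) by auto
    then show "x \<in> V" using x T by (auto simp: cube_def topspace_Euclidean)
  qed
  ultimately show ?thesis by blast
qed

definition closed_cube :: "nat \<Rightarrow> (nat \<Rightarrow> real) \<Rightarrow> real \<Rightarrow> (nat \<Rightarrow> real) set"
  where "closed_cube p c s = {x \<in> topspace (Euclidean_space p). \<forall>i<p. \<bar>x i - c i\<bar> \<le> s}"

lemma compactin_closed_cube: "compactin (Euclidean_space p) (closed_cube p c s)"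
proof -
  have "closed_cube p c s = Pi\<^sub>E UNIV (\<lambda>i. if i < p then {c i - s..c i + s} else {0})"
  proof (intro equalityI subsetI)
    fix x assume "x \<in> closed_cube p c s"
    then show "x \<in> Pi\<^sub>E UNIV (\<lambda>i. if i < p then {c i - s..c i + s} else {0})"
      by (auto simp: closed_cube_def topspace_Euclidean abs_le_iff algebra_simps)
  next
    fix x assume "x \<in> Pi\<^sub>E UNIV (\<lambda>i. if i < p then {c i - s..c i + s} else {0})"
    then have *: "x i \<in> (if i < p then {c i - s..c i + s} else {0})" for i by (simp add: PiE_iff)
    show "x \<in> closed_cube p c s"
      unfolding closed_cube_def topspace_Euclidean
    proof (intro CollectI conjI allI impI)
      show "x i = 0" if "p \<le> i" for i using *[of i] that by simp
      show "\<bar>x i - c i\<bar> \<le> s" if "i < p" for i using *[of i] that by (auto simp: abs_le_iff)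
    qed
  qed
  moreover have "compactin (powertop_real UNIV) \<dots>"
    unfolding compactin_PiE by (auto simp: compactin_euclidean_iff)
  ultimately have "compactin (powertop_real UNIV) (closed_cube p c s)" by simp
  then show ?thesis
    unfolding Euclidean_space_def compactin_subtopology
    by (auto simp: closed_cube_def topspace_Euclidean)
qed

lemma closed_cube_subset: "s < r \<Longrightarrow> closed_cube p c s \<subseteq> cube p c r"
  by (auto simp: closed_cube_def cube_def)

context superspace
begin

lemma superfunctions_superalgebra: "superalgebra (superfunctions M)"
  unfolding superfunctions_def by (rule sec_superalgebra) simp

end

context supermanifold
begin

abbreviation G :: "'a salgebra" where "G \<equiv> superfunctions M"
abbreviation T :: "'m set" where "T \<equiv> topspace (body M)"

lemma restr_global: "openin (body M) U \<Longrightarrow> restr M T U \<in> salgebra_hom G (sec M U)"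
  unfolding superfunctions_def by (rule restr_hom) (auto simp: openin_subset)

lemma restr_zero:
  assumes "openin (body M) U" "openin (body M) V" "V \<subseteq> U"
  shows "restr M U V \<zero>\<^bsub>sec M U\<^esub> = \<zero>\<^bsub>sec M V\<^esub>"
proof -
  interpret U: superalgebra "sec M U" by (rule sec_superalgebra[OF assms(1)])
  interpret V: superalgebra "sec M V" by (rule sec_superalgebra[OF assms(2)])
  note h = restr_hom[OF assms]
  show ?thesis
    using salgebra_homD(5)[OF h U.zero_closed, of 0] salgebra_homD(1)[OF h U.zero_closed] by simp
qed

text \<open>A chart is shrunk to a cube. The preimage \<open>K\<close> of a smaller closed cube is compact, hence closed in
  the Hausdorff space \<open>M\<close>, so the chart and the complement of \<open>K\<close> form an open cover to which locality
  and gluing apply.\<close>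

lemma cube_chart_exists:
  assumes x: "x \<in> T"
  shows "\<exists>c r hat B \<rho> W. cube_chart G p c r q hat B \<rho> \<and> openin (body M) W \<and> x \<in> W \<and>
    (\<forall>f\<in>carrier G. (\<forall>I. \<forall>z\<in>cube p c (1/5 * r). hat f I z = (if I = {} then 1 else 0)) \<longrightarrow>
      restr M T W f = \<one>\<^bsub>sec M W\<^esub>)"
proof -
  interpret G: superalgebra G by (rule superfunctions_superalgebra)
  obtain U V \<phi> \<Phi> where U: "openin (body M) U" "x \<in> U" and V: "openin (Euclidean_space p) V"
    and iso: "superspace_iso (open_subspace M U) (open_subspace (superdomain p q) V) \<phi> \<Phi>"
    using charts[OF x] by blast
  have UT: "U \<subseteq> T" by (rule openin_subset[OF U(1)])
  have VE: "V \<subseteq> topspace (Euclidean_space p)" by (rule openin_subset[OF V])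
  have homeo: "homeomorphic_map (subtopology (body M) U) (subtopology (Euclidean_space p) V) \<phi>"
    using iso unfolding superspace_iso_def open_subspace_def superdomain_def by simp
  have sub_open: "openin (subtopology (body M) U) U'" if "openin (body M) U'" "U' \<subseteq> U" for U'
    using that U(1) by (simp add: openin_open_subtopology)
  have \<Phi>_hom: "\<Phi> U' \<in> salgebra_hom (sec M U') (superdomain_sec p q (\<phi> ` U'))"
    and \<Phi>_bij: "bij_betw (\<Phi> U') (carrier (sec M U')) (carrier (superdomain_sec p q (\<phi> ` U')))"
    if "openin (body M) U'" "U' \<subseteq> U" for U'
    using iso sub_open[OF that] unfolding superspace_iso_def open_subspace_def superdomain_def by auto
  have \<Phi>_restr: "\<Phi> U2 (restr M U1 U2 f) = (\<lambda>I z. if z \<in> \<phi> ` U2 then \<Phi> U1 f I z else 0)"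
    if "openin (body M) U1" "U1 \<subseteq> U" "openin (body M) U2" "U2 \<subseteq> U1" "f \<in> carrier (sec M U1)" for U1 U2 f
    using iso sub_open[OF that(1,2)] sub_open[OF that(3)] that
    unfolding superspace_iso_def open_subspace_def superdomain_def by auto
  have \<Phi>_zero: "\<Phi> U' \<zero>\<^bsub>sec M U'\<^esub> = (\<lambda>I z. 0)" if U': "openin (body M) U'" "U' \<subseteq> U" for U'
  proof -
    interpret U': superalgebra "sec M U'" by (rule sec_superalgebra[OF U'(1)])
    show ?thesis using salgebra_homD(5)[OF \<Phi>_hom[OF U'] U'.zero_closed, of 0] by simp
  qed
  have \<Phi>_inj: "f = g" if "openin (body M) U'" "U' \<subseteq> U" "f \<in> carrier (sec M U')" "g \<in> carrier (sec M U')"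
    "\<Phi> U' f = \<Phi> U' g" for U' f g
    using \<Phi>_bij[OF that(1,2)] that(3-5) unfolding bij_betw_def inj_on_def by blast
  have \<phi>_image: "\<phi> ` U = V"
    using homeomorphic_imp_surjective_map[OF homeo] UT VE by (simp add: inf_absorb2)
  define c where "c = \<phi> x"
  have c: "c \<in> V" using \<phi>_image U(2) by (auto simp: c_def)
  obtain r where r: "r > 0" "cube p c r \<subseteq> V" using cube_neighbourhood[OF V c] by blast
  have preimage: "openin (body M) {z \<in> U. \<phi> z \<in> Q}" "\<phi> ` {z \<in> U. \<phi> z \<in> Q} = Q"
    if Q: "openin (Euclidean_space p) Q" "Q \<subseteq> V" for Q
  proof -
    have "openin (subtopology (Euclidean_space p) V) Q" using Q V by (simp add: openin_open_subtopology)
    then have "openin (subtopology (body M) U) {z \<in> topspace (subtopology (body M) U). \<phi> z \<in> Q}"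
      using homeomorphic_imp_continuous_map[OF homeo] by (intro openin_continuous_map_preimage)
    moreover have "{z \<in> topspace (subtopology (body M) U). \<phi> z \<in> Q} = {z \<in> U. \<phi> z \<in> Q}"
      using UT by auto
    ultimately show "openin (body M) {z \<in> U. \<phi> z \<in> Q}" using U(1) by (simp add: openin_open_subtopology)
    show "\<phi> ` {z \<in> U. \<phi> z \<in> Q} = Q" using \<phi>_image Q(2) by auto
  qed
  define U' where "U' = {z \<in> U. \<phi> z \<in> cube p c r}"
  have U': "openin (body M) U'" "\<phi> ` U' = cube p c r" "U' \<subseteq> U" "U' \<subseteq> T"
    using preimage[OF openin_cube r(2)] UT by (auto simp: U'_def)
  define W where "W = {z \<in> U. \<phi> z \<in> cube p c (1/5 * r)}"
  have small: "cube p c (1/5 * r) \<subseteq> cube p c r"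
    using r(1) by (auto simp: cube_def intro: less_trans)
  have W: "openin (body M) W" "\<phi> ` W = cube p c (1/5 * r)" "W \<subseteq> U'" "W \<subseteq> U" "W \<subseteq> T"
    using preimage[OF openin_cube, of c "1/5 * r"] small r(2) UT by (auto simp: W_def U'_def)
  have xW: "x \<in> W"
    using U(2) r(1) c VE by (auto simp: W_def c_def cube_def)
  define K where "K = {z \<in> U. \<phi> z \<in> closed_cube p c (4/5 * r)}"
  have Kr: "closed_cube p c (4/5 * r) \<subseteq> cube p c r" using r(1) by (intro closed_cube_subset) simp
  have "compactin (body M) K"
  proof -
    obtain \<psi> where \<psi>: "homeomorphic_maps (subtopology (body M) U) (subtopology (Euclidean_space p) V) \<phi> \<psi>"
      using homeo homeomorphic_map_maps by blast
    have "compactin (subtopology (Euclidean_space p) V) (closed_cube p c (4/5 * r))"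
      using compactin_closed_cube Kr r(2) by (simp add: compactin_subtopology)
    moreover have "continuous_map (subtopology (Euclidean_space p) V) (subtopology (body M) U) \<psi>"
      using \<psi> by (simp add: homeomorphic_maps_def)
    ultimately have "compactin (subtopology (body M) U) (\<psi> ` closed_cube p c (4/5 * r))"
      by (rule image_compactin)
    moreover have "\<psi> ` closed_cube p c (4/5 * r) = K"
    proof (intro equalityI subsetI)
      fix z assume "z \<in> \<psi> ` closed_cube p c (4/5 * r)"
      then obtain v where v: "v \<in> closed_cube p c (4/5 * r)" "z = \<psi> v" by blast
      then have "v \<in> topspace (subtopology (Euclidean_space p) V)" using Kr r(2) VE by auto
      with \<psi> have "\<phi> (\<psi> v) = v" unfolding homeomorphic_maps_def by blast
      have "\<psi> ` topspace (subtopology (Euclidean_space p) V) \<subseteq> topspace (subtopology (body M) U)"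
        using \<psi> unfolding homeomorphic_maps_def by (intro continuous_map_image_subset_topspace) blast
      then have "\<psi> v \<in> U" using \<open>v \<in> topspace (subtopology (Euclidean_space p) V)\<close> by auto
      then show "z \<in> K" using v \<open>\<phi> (\<psi> v) = v\<close> by (simp add: K_def)
    next
      fix z assume z: "z \<in> K"
      then have "z \<in> topspace (subtopology (body M) U)" using UT by (auto simp: K_def)
      then have "\<psi> (\<phi> z) = z" using \<psi> unfolding homeomorphic_maps_def by blast
      then show "z \<in> \<psi> ` closed_cube p c (4/5 * r)" using z by (force simp: K_def)
    qed
    ultimately show ?thesis by (simp add: compactin_subtopology)
  qed
  then have "closedin (body M) K" using Hausdorff compactin_imp_closedin by blast
  then have C: "openin (body M) (T - K)" by (simp add: openin_diff)
  define C where "C = T - K"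
  have openC: "openin (body M) C" "C \<subseteq> T" using C by (auto simp: C_def)
  have cover: "\<Union>{U', C} = T" using U'(4) Kr by (auto simp: C_def K_def U'_def)
  have xC: "U' \<noteq> C"
  proof -
    have "x \<in> K" "x \<in> U'" using U(2) r(1) c VE by (auto simp: K_def U'_def c_def closed_cube_def cube_def)
    then show ?thesis by (auto simp: C_def)
  qed
  define hat where "hat f = \<Phi> U' (restr M T U' f)" for f
  have hat_hom: "hat \<in> salgebra_hom G (superdomain_sec p q (cube p c r))"
    unfolding hat_def U'(2)[symmetric]
    by (intro salgebra_hom_compose[OF restr_global] \<Phi>_hom U')
  interpret S': superalgebra "sec M U'" by (rule sec_superalgebra[OF U'(1)])
  interpret SC: superalgebra "sec M C" by (rule sec_superalgebra[OF openC(1)])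
  have "cube_chart G p c r q hat (sec M C) (restr M T C)"
  proof (rule cube_chart.intro[OF G.superalgebra_axioms], rule cube_chart_axioms.intro,
      rule r(1), rule hat_hom, rule SC.superalgebra_axioms, rule restr_global[OF openC(1)])
    fix f assume f: "f \<in> carrier G" and hat0: "hat f = (\<lambda>I x. 0)" and C0: "restr M T C f = \<zero>\<^bsub>sec M C\<^esub>"
    have fU: "restr M T U' f \<in> carrier (sec M U')" by (rule salgebra_homD(1)[OF restr_global[OF U'(1)] f])
    have U0: "restr M T U' f = \<zero>\<^bsub>sec M U'\<^esub>"
    proof (rule \<Phi>_inj[OF U'(1,3) fU S'.zero_closed])
      show "\<Phi> U' (restr M T U' f) = \<Phi> U' \<zero>\<^bsub>sec M U'\<^esub>"
        using hat0 unfolding hat_def \<Phi>_zero[OF U'(1,3)] .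
    qed
    have Gz: "restr M T U' \<zero>\<^bsub>G\<^esub> = \<zero>\<^bsub>sec M U'\<^esub>" "restr M T C \<zero>\<^bsub>G\<^esub> = \<zero>\<^bsub>sec M C\<^esub>"
      using restr_zero[OF openin_topspace U'(1,4)] restr_zero[OF openin_topspace openC]
      by (simp_all only: superfunctions_def)
    show "f = \<zero>\<^bsub>G\<^esub>"
    proof (rule locality[of "{U', C}"])
      show "\<And>V. V \<in> {U', C} \<Longrightarrow> openin (body M) V" using U'(1) openC(1) by blast
      show "f \<in> carrier (sec M (\<Union>{U', C}))" "\<zero>\<^bsub>G\<^esub> \<in> carrier (sec M (\<Union>{U', C}))"
        unfolding cover using f G.zero_closed by (simp_all only: superfunctions_def)
      show "\<And>V. V \<in> {U', C} \<Longrightarrow> restr M (\<Union>{U', C}) V f = restr M (\<Union>{U', C}) V \<zero>\<^bsub>G\<^esub>"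
        unfolding cover using U0 C0 Gz by (elim insertE emptyE) simp_all
    qed
  next
    fix F assume F: "F \<in> carrier (superdomain_sec p q (cube p c r))"
      and F0: "\<And>I x i. \<lbrakk>i < p; 4/5 * r \<le> \<bar>x i - c i\<bar>\<rbrakk> \<Longrightarrow> F I x = 0"
    obtain s where s: "s \<in> carrier (sec M U')" "\<Phi> U' s = F"
    proof -
      have "F \<in> \<Phi> U' ` carrier (sec M U')"
        using bij_betw_imp_surj_on[OF \<Phi>_bij[OF U'(1,3)]] F unfolding U'(2) by simp
      then show ?thesis using that by blast
    qed
    define D where "D = U' \<inter> C"
    have D: "openin (body M) D" "D \<subseteq> U'" "D \<subseteq> C" "D \<subseteq> U"
      using U'(1,3) openC(1) by (auto simp: D_def)
    interpret SD: superalgebra "sec M D" by (rule sec_superalgebra[OF D(1)])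
    have "restr M U' D s = \<zero>\<^bsub>sec M D\<^esub>"
    proof (rule \<Phi>_inj[OF D(1,4)])
      show "restr M U' D s \<in> carrier (sec M D)"
        by (rule salgebra_homD(1)[OF restr_hom[OF U'(1) D(1,2)] s(1)])
      have "F I z = 0" if zD: "z \<in> \<phi> ` D" for I z
      proof -
        obtain v where v: "v \<in> U" "v \<notin> K" "z = \<phi> v" "v \<in> U'"
          using zD D(4) by (auto simp: D_def C_def)
        then have "z \<notin> closed_cube p c (4/5 * r)" "z \<in> cube p c r" by (auto simp: K_def U'_def)
        then obtain i where "i < p" "4/5 * r \<le> \<bar>z i - c i\<bar>"
          by (auto simp: closed_cube_def cube_def not_le intro: less_imp_le)
        then show ?thesis by (rule F0)
      qed
      then show "\<Phi> D (restr M U' D s) = \<Phi> D \<zero>\<^bsub>sec M D\<^esub>"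
        unfolding \<Phi>_restr[OF U'(1,3) D(1,2) s(1)] \<Phi>_zero[OF D(1,4)] s(2) fun_eq_iff by simp
    qed (rule SD.zero_closed)
    then have compat: "restr M U' D s = restr M C D \<zero>\<^bsub>sec M C\<^esub>"
      using restr_zero[OF openC(1) D(1,3)] by simp
    define g where "g V = (if V = U' then s else \<zero>\<^bsub>sec M C\<^esub>)" for V
    have "\<exists>f\<in>carrier (sec M (\<Union>{U', C})). \<forall>V\<in>{U', C}. restr M (\<Union>{U', C}) V f = g V"
    proof (rule gluing)
      show "\<And>V. V \<in> {U', C} \<Longrightarrow> openin (body M) V" using U'(1) openC(1) by blast
      show "\<And>V. V \<in> {U', C} \<Longrightarrow> g V \<in> carrier (sec M V)" using s(1) xC SC.zero_closed by (auto simp: g_def)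
      show "\<And>V W. \<lbrakk>V \<in> {U', C}; W \<in> {U', C}\<rbrakk> \<Longrightarrow> restr M V (V \<inter> W) (g V) = restr M W (V \<inter> W) (g W)"
      proof -
        fix V W assume VW: "V \<in> {U', C}" "W \<in> {U', C}"
        have "restr M C (C \<inter> U') \<zero>\<^bsub>sec M C\<^esub> = restr M U' (C \<inter> U') s"
          using compat by (simp add: D_def Int_commute)
        then show "restr M V (V \<inter> W) (g V) = restr M W (V \<inter> W) (g W)"
          using VW compat xC unfolding g_def D_def by (elim insertE emptyE) (simp_all only: if_True if_False refl xC[symmetric])
      qed
    qed
    then obtain f where f: "f \<in> carrier G" "restr M T U' f = s" "restr M T C f = \<zero>\<^bsub>sec M C\<^esub>"
    proof -
      assume "\<And>f. \<lbrakk>f \<in> carrier G; restr M T U' f = s; restr M T C f = \<zero>\<^bsub>sec M C\<^esub>\<rbrakk> \<Longrightarrow> thesis"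
        and "\<exists>f\<in>carrier (sec M (\<Union>{U', C})). \<forall>V\<in>{U', C}. restr M (\<Union>{U', C}) V f = g V"
      then show thesis unfolding cover superfunctions_def using xC by (auto simp: g_def)
    qed
    then show "\<exists>f\<in>carrier G. hat f = F \<and> restr M T C f = \<zero>\<^bsub>sec M C\<^esub>"
      using s(2) f unfolding hat_def by blast
  qed
  moreover have "restr M T W f = \<one>\<^bsub>sec M W\<^esub>"
    if f: "f \<in> carrier G" and hat1: "\<forall>I. \<forall>z\<in>cube p c (1/5 * r). hat f I z = (if I = {} then 1 else 0)" for f
  proof (rule \<Phi>_inj[OF W(1,4)])
    interpret SW: superalgebra "sec M W" by (rule sec_superalgebra[OF W(1)])
    show "\<one>\<^bsub>sec M W\<^esub> \<in> carrier (sec M W)" by simp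
    show "restr M T W f \<in> carrier (sec M W)" by (rule salgebra_homD(1)[OF restr_global[OF W(1)] f])
    have "restr M T W f = restr M U' W (restr M T U' f)"
      using restr_restr[OF openin_topspace U'(1) W(1,3) U'(4)] f by (simp add: superfunctions_def)
    then have "\<Phi> W (restr M T W f) = (\<lambda>I z. if z \<in> \<phi> ` W then \<Phi> U' (restr M T U' f) I z else 0)"
      using \<Phi>_restr[OF U'(1,3) W(1,3) salgebra_homD(1)[OF restr_global[OF U'(1)] f]] by (simp only:)
    also have "\<dots> = (\<lambda>I z. if z \<in> cube p c (1/5 * r) then hat f I z else 0)"
      unfolding hat_def W(2) ..
    also have "\<dots> = \<one>\<^bsub>superdomain_sec p q (\<phi> ` W)\<^esub>"
      using hat1 by (auto simp: fun_eq_iff W(2))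
    also have "\<dots> = \<Phi> W \<one>\<^bsub>sec M W\<^esub>"
      by (rule salgebra_homD(4)[OF \<Phi>_hom[OF W(1,4)], symmetric])
    finally show "\<Phi> W (restr M T W f) = \<Phi> W \<one>\<^bsub>sec M W\<^esub>" .
  qed
  ultimately show ?thesis using W(1) xW by blast
qed

definition patch :: "'m set \<Rightarrow> 'a \<Rightarrow> nat \<Rightarrow> (nat \<Rightarrow> 'a) \<Rightarrow> (nat \<Rightarrow> 'a \<Rightarrow> 'a) \<Rightarrow> (nat \<Rightarrow> bit) \<Rightarrow> bool"
  where "patch W b m x d u \<longleftrightarrow> openin (body M) W \<and> b \<in> grade G 0 \<and> restr M T W b = \<one>\<^bsub>sec M W\<^esub> \<and>
    (\<forall>k<m. x k \<in> grade G (u k) \<and> d k \<in> hom_vector_fields G (u k)) \<and>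
    (\<forall>a. \<forall>Y\<in>hom_vector_fields G a.
      vf_scale G b Y = superalgebra.vf_sum G (\<lambda>k. vf_scale G (Y (x k)) (d k)) m)"

lemma patch_exists:
  assumes "z \<in> T" shows "\<exists>W b m x d u. z \<in> W \<and> patch W b m x d u"
proof -
  obtain c r hat B \<rho> W where *: "cube_chart G p c r q hat B \<rho> \<and> openin (body M) W \<and> z \<in> W \<and>
    (\<forall>f\<in>carrier G. (\<forall>I. \<forall>z\<in>cube p c (1/5 * r). hat f I z = (if I = {} then 1 else 0)) \<longrightarrow>
      restr M T W f = \<one>\<^bsub>sec M W\<^esub>)"
    using cube_chart_exists[OF assms] by (elim exE)
  note chart = conjunct1[OF *] and W = conjunct1[OF conjunct2[OF *]] conjunct1[OF conjunct2[OF conjunct2[OF *]]]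
    and one = conjunct2[OF conjunct2[OF conjunct2[OF *]]]
  interpret cube_chart G p c r q hat B \<rho> by (rule chart)
  have "\<forall>I. \<forall>z\<in>cube p c (1/5 * r). hat plateau_function I z = (if I = {} then 1 else 0)"
    using cube_Q(3) bumps_one(1) by (simp add: plateau_function(3) single_def)
  moreover have "plateau_function \<in> carrier G" using plateau_function(1) by (rule Zero_closed)
  ultimately have one: "restr M T W plateau_function = \<one>\<^bsub>sec M W\<^esub>"
    using one by blast
  have "patch W plateau_function (p + q) coord (\<lambda>k. local_field (coord_partial k)) coord_parity"
    unfolding patch_def
  proof (intro conjI allI ballI impI)
    fix k assume "k < p + q"
    then show "coord k \<in> grade G (coord_parity k)" "local_field (coord_partial k) \<in> HV (coord_parity k)"
      by (rule coord_grade, intro local_field_hvf coord_partial_derivation)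
  qed (rule W(1) plateau_function(2) one coordinate_expansion; assumption?)+
  then show ?thesis using W(2) by blast
qed

text \<open>All superfunctions on the empty set are equal, by locality for the empty cover. Adding this trivial
  patch allows a countable cover to be enumerated by all natural numbers even if \<open>M\<close> is empty.\<close>

lemma patch_empty: "patch {} \<zero>\<^bsub>G\<^esub> 0 (\<lambda>k. \<zero>\<^bsub>G\<^esub>) (\<lambda>k. vf_zero G) (\<lambda>k. 0)"
proof -
  interpret G: superalgebra G by (rule superfunctions_superalgebra)
  interpret E: superalgebra "sec M {}" by (rule sec_superalgebra) simp
  have "f = g" if "f \<in> carrier (sec M {})" "g \<in> carrier (sec M {})" for f g
    using locality[of "{}" f g] that by simp
  moreover have "restr M T {} \<zero>\<^bsub>G\<^esub> \<in> carrier (sec M {})"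
    by (rule salgebra_homD(1)[OF restr_global]) auto
  ultimately have "restr M T {} \<zero>\<^bsub>G\<^esub> = \<one>\<^bsub>sec M {}\<^esub>" by blast
  moreover have "vf_scale G \<zero>\<^bsub>G\<^esub> Y = vf_zero G" if "Y \<in> hom_vector_fields G a" for Y a
    using that by (intro G.extensional_eqI) simp_all
  ultimately show ?thesis unfolding patch_def by auto
qed

lemma patch_cover:
  "\<exists>W b m x d u. (\<forall>n::nat. patch (W n) (b n) (m n) (x n) (d n) (u n)) \<and> \<Union>(range W) = T"
proof -
  define \<U> where "\<U> = {W. \<exists>b m x d u. patch W b m x d u}"
  have open\<U>: "openin (body M) U" if "U \<in> \<U>" for U
    using that unfolding \<U>_def patch_def by (elim CollectE exE conjE)
  have "z \<in> \<Union>\<U>" if z: "z \<in> T" for z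
  proof -
    obtain W b m x d u where "z \<in> W" "patch W b m x d u" using patch_exists[OF z] by (elim exE conjE)
    then have "W \<in> \<U>" unfolding \<U>_def by (intro CollectI exI)
    then show ?thesis using \<open>z \<in> W\<close> by (rule UnionI)
  qed
  then have union: "\<Union>\<U> = T" using open\<U> openin_subset by (intro equalityI subsetI; (elim UnionE)?) blast+
  have "Lindelof_space (body M)" by (rule second_countable_imp_Lindelof_space[OF second_countable])
  then obtain \<V> where \<V>: "countable \<V>" "\<V> \<subseteq> \<U>" "\<Union>\<V> = T"
    unfolding Lindelof_space_def using open\<U> union by (elim allE[of _ \<U>]) auto
  have empty: "{} \<in> \<U>" unfolding \<U>_def by (intro CollectI exI, rule patch_empty)
  define W where "W = from_nat_into (insert {} \<V>)"
  have range: "range W = insert {} \<V>"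
    unfolding W_def using \<V>(1) by (intro range_from_nat_into) auto
  have "\<exists>b m x d u. patch (W n) b m x d u" for n
  proof -
    have "W n \<in> insert {} \<V>" unfolding range[symmetric] by simp
    then have "W n \<in> \<U>" using \<V>(2) empty by (elim insertE) (simp_all add: subsetD)
    then show ?thesis unfolding \<U>_def by (rule CollectD)
  qed
  then have "\<exists>t. case t of (b, m, x, d, u) \<Rightarrow> patch (W n) b m x d u" for n
    by (simp only: split_paired_Ex prod.case)
  then have "\<exists>t. \<forall>n. case t n of (b, m, x, d, u) \<Rightarrow> patch (W n) b m x d u"
    by (intro choice allI)
  then obtain t where "\<forall>n. case t n of (b, m, x, d, u) \<Rightarrow> patch (W n) b m x d u" ..
  then have "patch (W n) (fst (t n)) (fst (snd (t n))) (fst (snd (snd (t n))))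
      (fst (snd (snd (snd (t n))))) (snd (snd (snd (snd (t n)))))" for n
    by (simp only: case_prod_beta)
  moreover have "\<Union>(range W) = T" unfolding range using \<V>(3) by simp
  ultimately show ?thesis by (intro exI conjI allI)
qed

lemma graded_connection_exists: "\<exists>D. graded_connection G D"
proof -
  interpret G: superalgebra G by (rule superfunctions_superalgebra)
  obtain W b m x d u where patches: "\<forall>n::nat. patch (W n) (b n) (m n) (x n) (d n) (u n)"
    and cover: "\<Union>(range W) = T"
    using patch_cover by (elim exE conjE)
  note patch = spec[OF patches]
  have openW: "openin (body M) (W n)" for n using patch[of n] by (simp add: patch_def)
  have WT: "W n \<subseteq> T" for n by (rule openin_subset[OF openW])
  have carG: "carrier G = carrier (sec M T)" by (simp add: superfunctions_def)
  have "patched_superalgebra G (\<lambda>n. sec M (W n)) (\<lambda>n. restr M T (W n)) b m x d u"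
  proof (rule patched_superalgebra.intro[OF G.superalgebra_axioms], rule patched_superalgebra_axioms.intro)
    show "superalgebra (sec M (W n))" for n by (rule sec_superalgebra[OF openW])
    show "restr M T (W n) \<in> salgebra_hom G (sec M (W n))" for n by (rule restr_global[OF openW])
    show "b n \<in> grade G 0" "restr M T (W n) (b n) = \<one>\<^bsub>sec M (W n)\<^esub>" for n
      using patch[of n] by (simp_all add: patch_def)
    show "x n k \<in> grade G (u n k)" "d n k \<in> hom_vector_fields G (u n k)" if "k < m n" for n k
      using patch[of n] that by (simp_all add: patch_def)
    show "vf_scale G (b n) Y = G.vf_sum (\<lambda>k. vf_scale G (Y (x n k)) (d n k)) (m n)"
      if "Y \<in> hom_vector_fields G a" for Y a n
      using patch[of n] that unfolding patch_def by blast
  next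
    fix f g assume "f \<in> carrier G" "g \<in> carrier G" and eq: "\<And>n. restr M T (W n) f = restr M T (W n) g"
    then show "f = g"
      using locality[of "range W" f g] openW unfolding cover carG by auto
  next
    fix s assume s: "\<And>n. s n \<in> carrier G"
      and compat: "\<And>n k. n \<le> k \<Longrightarrow> restr M T (W n) (s k) = restr M T (W n) (s n)"
    define i where "i V = (SOME n. V = W n)" for V
    have i: "W (i V) = V" if "V \<in> range W" for V
      unfolding i_def using that by (metis (mono_tags, lifting) imageE someI)
    have agree: "restr M T (W n \<inter> W k) (s n) = restr M T (W n \<inter> W k) (s k)" if "n \<le> k" for n k
    proof -
      have O: "openin (body M) (W n \<inter> W k)" using openW by auto
      have "restr M T (W n \<inter> W k) (s j) = restr M (W n) (W n \<inter> W k) (restr M T (W n) (s j))" for j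
        using restr_restr[OF openin_topspace openW O] WT s by (simp add: carG)
      then show ?thesis using compat[OF that] by simp
    qed
    have agree': "restr M T (W n \<inter> W k) (s n) = restr M T (W n \<inter> W k) (s k)" for n k
      using agree[of n k] agree[of k n] by (cases "n \<le> k") (simp_all add: Int_commute)
    have "\<exists>f\<in>carrier (sec M (\<Union>(range W))). \<forall>V\<in>range W. restr M (\<Union>(range W)) V f = restr M T V (s (i V))"
    proof (rule gluing)
      show "openin (body M) V" if "V \<in> range W" for V using that openW by auto
      show "restr M T V (s (i V)) \<in> carrier (sec M V)" if "V \<in> range W" for V
        using that openW s by (auto intro: salgebra_homD(1)[OF restr_global])
      fix V V' assume V: "V \<in> range W" "V' \<in> range W"
      then have O: "openin (body M) V" "openin (body M) V'" "openin (body M) (V \<inter> V')" using openW by auto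
      have "restr M V (V \<inter> V') (restr M T V (s (i V))) = restr M T (V \<inter> V') (s (i V))"
        "restr M V' (V \<inter> V') (restr M T V' (s (i V'))) = restr M T (V \<inter> V') (s (i V'))"
        using O s openin_subset[OF O(1)] openin_subset[OF O(2)]
        by (intro restr_restr openin_topspace; auto simp: carG[symmetric])+
      then show "restr M V (V \<inter> V') (restr M T V (s (i V))) = restr M V' (V \<inter> V') (restr M T V' (s (i V')))"
        using agree'[of "i V" "i V'"] i V by simp
    qed
    then obtain f where f: "f \<in> carrier G" "\<And>n. restr M T (W n) f = restr M T (W n) (s (i (W n)))"
      unfolding cover carG by blast
    moreover have "restr M T (W n) (s (i (W n))) = restr M T (W n) (s n)" for n
      using agree'[of n "i (W n)"] i[of "W n"] by simp
    ultimately show "\<exists>f\<in>carrier G. \<forall>n. restr M T (W n) f = restr M T (W n) (s n)" by auto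
  qed
  then show ?thesis using patched_superalgebra.patched_connection by blast
qed

end

theorem mainTheorem1:
  fixes p q :: nat
    and M :: "('m, 'a) superspace"
    and w :: bit
    and \<omega> :: "('a \<Rightarrow> 'a) \<Rightarrow> ('a \<Rightarrow> 'a) \<Rightarrow> 'a"
  assumes "supermanifold p q M"
    and "symplectic_form (superfunctions M) w \<omega>"
  shows "\<exists>D. symplectic_connection (superfunctions M) w \<omega> D"
proof -
  obtain D where D: "graded_connection (superfunctions M) D"
    using supermanifold.graded_connection_exists[OF assms(1)] by blast
  have A: "superalgebra (superfunctions M)"
    by (rule superspace.superfunctions_superalgebra[OF supermanifold.axioms(1)[OF assms(1)]])
  have "symplectic_superalgebra (superfunctions M) w \<omega>"
    by (intro symplectic_superalgebra.intro symplectic_superalgebra_axioms.intro A assms(2))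
  then have "symplectic_correction (superfunctions M) w \<omega> (graded_connection.symmetrized (superfunctions M) D)"
    by (intro symplectic_correction.intro graded_connection.symmetrized_symmetric[OF D])
  then show ?thesis by (rule symplectic_correction.symplectic_connection_exists)
qed

end
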